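(* For all integers $n\ge 4$, the space $X_{2,n}$ is not contractible.
   Context: Graphs are finite, undirected and connected; loops and multiple edges are allowed. The genus of $G$ is $|E(G)|-|V(G)|+1$. $\Delta(G)$ is the realization of $G$ as a 1-dimensional CW complex, edges parametrized by $[0,1]$. A graph is stable if it has no bridges and no vertex of valency $2$ unless that vertex is adjacent to a loop. $[n]=\{1,\dots,n\}$. The space $X_{g,n}$ ($g\ge2$, $n\ge0$): let $TM^b_{g,n}$ be the set of isometry classes of triples $(G,l_G,p_G)$ with $G$ a stable graph of genus $g$, $l_G:E(G)\to(0,\infty)$ a length function and $p_G:[n]\to\Delta(G)$ an arbitrary marking function (isometries carry markings to markings). It has the quotient topology from $\coprod_G L(G)\times\Delta(G)^n$, where $L(G)$ is the set of $l:E(G)\to[0,\infty)$ whose zero edges form a forest, and $(l,p)$ is sent to the class of the marked metric graph obtained by contracting all edges of length $0$ (a marked point at relative position $s$ in an edge $e$ of positive length sits at distance $s\,l(e)$ from the corresponding end). $X_{g,n}$ is the subspace of $TM^b_{g,n}$ consisting of points whose representing metric graphs have maximal edge length $1$ and for which the edges of length strictly less than $1$ form a forest (contain no cycles). *)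

theory Defs
  imports "HOL-Analysis.Analysis" "Graph_Theory.Digraph_Component"
begin

section \<open>Finite multigraphs\<close>

text \<open>
  A finite multigraph, loops and parallel edges allowed, is a record of type
  \<^typ>\<open>('v, 'e) pre_digraph\<close> satisfying \<^locale>\<open>fin_digraph\<close>. The direction of an arc carries
  no combinatorial meaning: it only records the parametrization by \<open>[0,1]\<close> of the corresponding
  edge of the realization (\<open>tail\<close> at \<open>0\<close>, \<open>head\<close> at \<open>1\<close>). The notions below that refer to
  paths and cycles are those of the underlying undirected graph. In particular
  \<^const>\<open>Digraph_Component.connected\<close> is connectedness of the underlying undirected graph (and
  includes nonemptiness), whereas \<^const>\<open>Digraph_Component.forest\<close> is about directed cycles and
  is not used.
\<close>

definition fin_conn_graph :: "('v, 'e) pre_digraph \<Rightarrow> bool" where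
  "fin_conn_graph G \<longleftrightarrow> fin_digraph G \<and> Digraph_Component.connected G"

definition genus :: "('v, 'e) pre_digraph \<Rightarrow> int" where
  "genus G = int (card (arcs G)) - int (card (verts G)) + 1"

text \<open>A loop contributes \<open>2\<close> to the valency.\<close>

definition valency :: "('v, 'e) pre_digraph \<Rightarrow> 'v \<Rightarrow> nat" where
  "valency G v = in_degree G v + out_degree G v"

definition bridge :: "('v, 'e) pre_digraph \<Rightarrow> 'e \<Rightarrow> bool" where
  "bridge G e \<longleftrightarrow> e \<in> arcs G \<and> \<not> Digraph_Component.connected (pre_digraph.del_arc G e)"

definition stable :: "('v, 'e) pre_digraph \<Rightarrow> bool" where
  "stable G \<longleftrightarrow> (\<forall>e. \<not> bridge G e) \<and>
     (\<forall>v \<in> verts G. valency G v = 2 \<longrightarrow> (\<exists>e \<in> arcs G. tail G e = v \<and> head G e = v))"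

text \<open>
  A cycle is a list of distinct vertices \<open>vs\<close> and a list of distinct edges \<open>es\<close> of the same
  positive length, the \<open>i\<close>-th edge joining the \<open>i\<close>-th vertex to the cyclically next one. Loops
  (length \<open>1\<close>) and pairs of parallel edges (length \<open>2\<close>) are cycles.
\<close>

definition undirected_cycle :: "('v, 'e) pre_digraph \<Rightarrow> 'v list \<Rightarrow> 'e list \<Rightarrow> bool" where
  "undirected_cycle G vs es \<longleftrightarrow>
     es \<noteq> [] \<and> length vs = length es \<and> distinct vs \<and> distinct es \<and> set es \<subseteq> arcs G \<and>
     (\<forall>i < length es. {tail G (es ! i), head G (es ! i)} = {vs ! i, vs ! (Suc i mod length vs)})"

definition forest_edges :: "('v, 'e) pre_digraph \<Rightarrow> 'e set \<Rightarrow> bool" where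
  "forest_edges G F \<longleftrightarrow> F \<subseteq> arcs G \<and> (\<nexists>vs es. undirected_cycle G vs es \<and> set es \<subseteq> F)"


section \<open>The realization of a graph\<close>

text \<open>
  Points of the realization: vertices, and points in the open edge \<open>e\<close> at relative
  position \<open>0 < s < 1\<close>.
\<close>

datatype ('v, 'e) point = Vert 'v | Inner 'e real

definition edge_point :: "('v, 'e) pre_digraph \<Rightarrow> 'e \<Rightarrow> real \<Rightarrow> ('v, 'e) point" where
  "edge_point G e s =
     (if s = 0 then Vert (tail G e) else if s = 1 then Vert (head G e) else Inner e s)"

definition realization_points :: "('v, 'e) pre_digraph \<Rightarrow> ('v, 'e) point set" where
  "realization_points G = Vert ` verts G \<union> {Inner e s | e s. e \<in> arcs G \<and> 0 < s \<and> s < 1}"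

text \<open>
  The CW topology: a set is open iff its preimage under the characteristic map of
  every edge is open (the condition on the discrete \<open>0\<close>-skeleton is void).
\<close>

definition realization :: "('v, 'e) pre_digraph \<Rightarrow> ('v, 'e) point topology" where
  "realization G = topology (\<lambda>U. U \<subseteq> realization_points G \<and>
     (\<forall>e \<in> arcs G. openin (top_of_set {0..1}) {s \<in> {0..1}. edge_point G e s \<in> U}))"

lemma openin_realization:
  "openin (realization G) U \<longleftrightarrow> U \<subseteq> realization_points G \<and>
     (\<forall>e \<in> arcs G. openin (top_of_set {0..1}) {s \<in> {0..1}. edge_point G e s \<in> U})"
proof -
  let ?T = "top_of_set {0..1::real}"
  have Int: "{s \<in> {0..1}. edge_point G e s \<in> S \<inter> T} =
      {s \<in> {0..1}. edge_point G e s \<in> S} \<inter> {s \<in> {0..1}. edge_point G e s \<in> T}" for e S T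
    by auto
  have Un: "{s \<in> {0..1}. edge_point G e s \<in> \<Union>K} =
      (\<Union>S\<in>K. {s \<in> {0..1}. edge_point G e s \<in> S})" for e K
    by auto
  have "istopology (\<lambda>U. U \<subseteq> realization_points G \<and>
     (\<forall>e \<in> arcs G. openin ?T {s \<in> {0..1}. edge_point G e s \<in> U}))"
    unfolding istopology_def Int Un by (blast intro: openin_Int openin_Union)
  then show ?thesis
    by (simp add: realization_def topology_inverse')
qed

lemma topspace_realization [simp]:
  assumes "fin_digraph G"
  shows "topspace (realization G) = realization_points G"
proof -
  interpret fin_digraph G by fact
  have "{s \<in> {0..1}. edge_point G e s \<in> realization_points G} = {0..1}" if "e \<in> arcs G" for e
    using that by (auto simp: edge_point_def realization_points_def)
  then have "openin (realization G) (realization_points G)"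
    by (simp add: openin_realization)
  then show ?thesis
    by (auto simp: topspace_def openin_realization)
qed

text \<open>
  The length metric of edge lengths \<open>l\<close>: the infimum of the lengths of chains of points in
  which consecutive points lie on a common closed edge.
\<close>

inductive chain_length ::
  "('v, 'e) pre_digraph \<Rightarrow> ('e \<Rightarrow> real) \<Rightarrow> ('v, 'e) point \<Rightarrow> ('v, 'e) point \<Rightarrow> real \<Rightarrow> bool"
  for G l where
  refl: "x \<in> realization_points G \<Longrightarrow> chain_length G l x x 0"
| step: "\<lbrakk>chain_length G l x (edge_point G e s) c; e \<in> arcs G; s \<in> {0..1}; t \<in> {0..1}\<rbrakk>
          \<Longrightarrow> chain_length G l x (edge_point G e t) (c + l e * \<bar>s - t\<bar>)"

definition length_dist ::
  "('v, 'e) pre_digraph \<Rightarrow> ('e \<Rightarrow> real) \<Rightarrow> ('v, 'e) point \<Rightarrow> ('v, 'e) point \<Rightarrow> real" where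
  "length_dist G l x y = Inf {c. chain_length G l x y c}"


section \<open>Contraction of edges\<close>

text \<open>
  The vertex of \<open>G/F\<close> arising from a component of the subgraph with edge set \<open>F\<close> is named by
  the least vertex of this component.
\<close>

definition contract_vert ::
  "('v::wellorder, 'e) pre_digraph \<Rightarrow> 'e set \<Rightarrow> 'v \<Rightarrow> 'v" where
  "contract_vert G F v = (LEAST w. v \<rightarrow>\<^sup>*\<^bsub>mk_symmetric (G\<lparr>arcs := F\<rparr>)\<^esub> w)"

definition contract_graph ::
  "('v::wellorder, 'e) pre_digraph \<Rightarrow> 'e set \<Rightarrow> ('v, 'e) pre_digraph" where
  "contract_graph G F =
     \<lparr>verts = contract_vert G F ` verts G, arcs = arcs G - F,
      tail = contract_vert G F \<circ> tail G, head = contract_vert G F \<circ> head G\<rparr>"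

fun contract_point ::
  "('v::wellorder, 'e) pre_digraph \<Rightarrow> 'e set \<Rightarrow> ('v, 'e) point \<Rightarrow> ('v, 'e) point" where
  "contract_point G F (Vert v) = Vert (contract_vert G F v)"
| "contract_point G F (Inner e s) =
     (if e \<in> F then Vert (contract_vert G F (tail G e)) else Inner e s)"


section \<open>Marked metric graphs up to isometry\<close>

text \<open>
  Every finite graph is isomorphic to one whose vertices and edges are natural numbers.
  Length functions and markings are taken to be \<^const>\<open>undefined\<close> outside their domains.
\<close>

type_synonym ngraph = "(nat, nat) pre_digraph"
type_synonym npoint = "(nat, nat) point"
type_synonym marked_graph = "ngraph \<times> (nat \<Rightarrow> real) \<times> (nat \<Rightarrow> npoint)"

definition stable_graphs :: "nat \<Rightarrow> ngraph set" where
  "stable_graphs g = {G. fin_conn_graph G \<and> stable G \<and> genus G = int g}"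

definition marked_graphs :: "nat \<Rightarrow> nat \<Rightarrow> marked_graph set" where
  "marked_graphs g n = {(G, l, p). G \<in> stable_graphs g \<and>
     l \<in> arcs G \<rightarrow>\<^sub>E {0<..} \<and> p \<in> {1..n} \<rightarrow>\<^sub>E realization_points G}"

definition marked_isometry ::
  "nat \<Rightarrow> marked_graph \<Rightarrow> marked_graph \<Rightarrow> (npoint \<Rightarrow> npoint) \<Rightarrow> bool" where
  "marked_isometry n = (\<lambda>(G, l, p) (G', l', p') f.
     bij_betw f (realization_points G) (realization_points G') \<and>
     (\<forall>x \<in> realization_points G. \<forall>y \<in> realization_points G.
        length_dist G' l' (f x) (f y) = length_dist G l x y) \<and>
     (\<forall>i \<in> {1..n}. f (p i) = p' i))"

definition isometry_rel :: "nat \<Rightarrow> nat \<Rightarrow> (marked_graph \<times> marked_graph) set" where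
  "isometry_rel g n = {(M, M'). M \<in> marked_graphs g n \<and> M' \<in> marked_graphs g n \<and>
     (\<exists>f. marked_isometry n M M' f)}"

lemma equiv_isometry_rel: "equiv (marked_graphs g n) (isometry_rel g n)"
proof (rule equivI)
  show "isometry_rel g n \<subseteq> marked_graphs g n \<times> marked_graphs g n"
    by (auto simp: isometry_rel_def)
  have "marked_isometry n M M id" for M
    by (auto simp: marked_isometry_def split: prod.splits)
  then show "refl_on (marked_graphs g n) (isometry_rel g n)"
    unfolding refl_on_def isometry_rel_def by blast
  have "\<exists>h. marked_isometry n M' M h"
    if M: "M \<in> marked_graphs g n" and f: "marked_isometry n M M' f" for M M' f
  proof -
    obtain G l p where M_eq: "M = (G, l, p)" by (cases M)
    obtain G' l' p' where M'_eq: "M' = (G', l', p')" by (cases M')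
    have b: "bij_betw f (realization_points G) (realization_points G')"
      and d: "\<And>x y. x \<in> realization_points G \<Longrightarrow> y \<in> realization_points G \<Longrightarrow>
        length_dist G' l' (f x) (f y) = length_dist G l x y"
      and m: "\<And>i. i \<in> {1..n} \<Longrightarrow> f (p i) = p' i"
      using f by (auto simp: marked_isometry_def M_eq M'_eq)
    have p: "\<And>i. i \<in> {1..n} \<Longrightarrow> p i \<in> realization_points G"
      using M by (auto simp: marked_graphs_def M_eq)
    let ?h = "inv_into (realization_points G) f"
    have bh: "bij_betw ?h (realization_points G') (realization_points G)"
      using b by (rule bij_betw_inv_into)
    have "length_dist G l (?h x) (?h y) = length_dist G' l' x y"
      if "x \<in> realization_points G'" "y \<in> realization_points G'" for x y
      using d[of "?h x" "?h y"] bij_betwE[OF bh] bij_betw_inv_into_right[OF b] that by simp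
    moreover have "?h (p' i) = p i" if "i \<in> {1..n}" for i
      using bij_betw_inv_into_left[OF b p[OF that]] m[OF that] by simp
    ultimately have "marked_isometry n M' M ?h"
      using bh by (simp add: marked_isometry_def M_eq M'_eq)
    then show ?thesis by blast
  qed
  then show "sym (isometry_rel g n)"
    unfolding sym_def isometry_rel_def by blast
  have "marked_isometry n M M'' (f' \<circ> f)"
    if "marked_isometry n M M' f" "marked_isometry n M' M'' f'" for M M' M'' f f'
    using that unfolding marked_isometry_def
    by (auto split: prod.splits simp: bij_betw_trans dest!: bij_betwE)
  then show "trans (isometry_rel g n)"
    unfolding trans_def isometry_rel_def by blast
qed


section \<open>The spaces \<open>TM\<^sup>b\<close> and \<open>X\<close>\<close>

text \<open>
  \<open>final_topology X f A\<close> is the finest topology on \<open>A\<close> making \<open>f : X \<rightarrow> A\<close> continuous,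
  i.e. the quotient topology if \<open>f\<close> is onto \<open>A\<close>.
\<close>

definition final_topology :: "'a topology \<Rightarrow> ('a \<Rightarrow> 'b) \<Rightarrow> 'b set \<Rightarrow> 'b topology" where
  "final_topology X f A = topology (\<lambda>U. U \<subseteq> A \<and> openin X {x \<in> topspace X. f x \<in> U})"

lemma openin_final_topology:
  "openin (final_topology X f A) U \<longleftrightarrow> U \<subseteq> A \<and> openin X {x \<in> topspace X. f x \<in> U}"
proof -
  have Int: "{x \<in> topspace X. f x \<in> S \<inter> T} =
      {x \<in> topspace X. f x \<in> S} \<inter> {x \<in> topspace X. f x \<in> T}" for S T
    by auto
  have Un: "{x \<in> topspace X. f x \<in> \<Union>K} = (\<Union>S\<in>K. {x \<in> topspace X. f x \<in> S})" for K
    by auto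
  have "istopology (\<lambda>U. U \<subseteq> A \<and> openin X {x \<in> topspace X. f x \<in> U})"
    unfolding istopology_def Int Un by (blast intro: openin_Int openin_Union)
  then show ?thesis
    by (simp add: final_topology_def topology_inverse')
qed

lemma quotient_map_final_topology:
  assumes "f ` topspace X = A"
  shows "quotient_map X (final_topology X f A) f"
proof -
  have "{x \<in> topspace X. f x \<in> A} = topspace X"
    using assms by auto
  then have "openin (final_topology X f A) A"
    by (simp add: openin_final_topology)
  then have "topspace (final_topology X f A) = A"
    by (auto simp: topspace_def openin_final_topology)
  then show ?thesis
    using assms by (auto simp: quotient_map_def openin_final_topology)
qed

definition length_space :: "ngraph \<Rightarrow> (nat \<Rightarrow> real) topology" where
  "length_space G = subtopology (product_topology (\<lambda>_. euclideanreal) (arcs G))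
     {l. (\<forall>e \<in> arcs G. 0 \<le> l e) \<and> forest_edges G {e \<in> arcs G. l e = 0}}"

definition parameter_space :: "nat \<Rightarrow> nat \<Rightarrow> marked_graph topology" where
  "parameter_space g n = sum_topology
     (\<lambda>G. prod_topology (length_space G) (product_topology (\<lambda>_. realization G) {1..n}))
     (stable_graphs g)"

definition contract_marked :: "nat \<Rightarrow> marked_graph \<Rightarrow> marked_graph" where
  "contract_marked n = (\<lambda>(G, l, p). let F = {e \<in> arcs G. l e = 0} in
     (contract_graph G F, restrict l (arcs G - F),
      restrict (\<lambda>i. contract_point G F (p i)) {1..n}))"

definition TMb :: "nat \<Rightarrow> nat \<Rightarrow> marked_graph set topology" where
  "TMb g n = final_topology (parameter_space g n)
     (\<lambda>M. isometry_rel g n `` {contract_marked n M})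
     (marked_graphs g n // isometry_rel g n)"

definition X_space :: "nat \<Rightarrow> nat \<Rightarrow> marked_graph set topology" where
  "X_space g n = subtopology (TMb g n)
     {isometry_rel g n `` {(G, l, p)} | G l p. (G, l, p) \<in> marked_graphs g n \<and>
        Max (l ` arcs G) = 1 \<and> forest_edges G {e \<in> arcs G. l e < 1}}"

end

theory Submission
  imports Defs
begin

text \<open>
  A metric graph of genus two with the normalization of \<open>X\<close> is a theta graph with
  edge lengths \<open>1, 1, c\<close>, \<open>0 \<le> c \<le> 1\<close>, where for \<open>c =
  0\<close> the short edge is contracted and a rose with two loops of length \<open>1\<close>
  remains. The space is not contractible because it carries a \<open>5\<close>-dimensional cycle
  that a continuous map to \<open>\<real>\<^sup>6\<close> minus the origin sends to a cycle of
  degree \<open>\<plusminus>2\<close>.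

  The cycle. Four marks move on the theta graph, and all further marks follow the fourth. For
  every distribution \<open>w\<close> of the four marks over the three edges and every choice
  \<open>\<epsilon>\<close> of a half of each of these edges there is a cube, whose coordinates
  are \<open>c\<close> and the relative distances of the marks from the midpoints of their edges.
  Faces of these cubes are glued: a mark at a midpoint belongs to both halves; a mark at a vertex
  forgets its edge; for \<open>c = 1\<close> the edges \<open>0\<close> and \<open>2\<close> can
  be exchanged; and for \<open>c = 0\<close> a mark on the edge \<open>2\<close> forgets its
  position, while without such marks one of the two loops can be reversed. With the product of the
  signs in \<open>\<epsilon>\<close> and of a weight of \<open>w\<close> as coefficient, all these
  gluings identify faces of opposite coefficients (lemma \<open>cube_faces\<close>). The weight is
  antisymmetric in the letters \<open>0\<close> and \<open>2\<close> for each of the marks three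
  and four, and for each of the marks one and two in the letters different from that of the other;
  this is what makes the faces at \<open>c = 0\<close> and \<open>c = 1\<close> cancel as well.

  The degree. Distances between marks are continuous functions on \<open>X\<close>, and six affine
  combinations of them form the map \<open>detector\<close>. If its first five coordinates vanish
  and the last one is not positive, then the metric graph with its four marks is determined up to
  isometry, and the last coordinate is \<open>-1/200\<close> (lemmas
  \<open>four_marks_unique\<close> and \<open>detected_configuration\<close>). So the map avoids
  the origin, and its degree on the cycle can be read off where the cycle meets this
  configuration: in the interior of exactly two cubes of nonzero coefficient, which are exchanged
  by the symmetry of the theta graph interchanging its vertices, and both contribute with the same
  sign (lemmas \<open>cube_hit\<close> and \<open>detector_near_hit\<close>).

  A cycle in a contractible space has degree \<open>0\<close> (theorem
  \<open>cubical_cycle_count\<close>). To avoid homology theory, the degree is counted on fine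
  grids: the cubes are cut into simplices, on which a cochain built from the signs of the
  coordinates is evaluated. A contraction of \<open>X\<close> extends the cubes by one dimension,
  and the discrete Stokes theorem \<open>cube_stokes\<close> does the rest.
\<close>

section \<open>Stokes' theorem for cubes cut into simplices\<close>

text \<open>
  The simplicial coboundary. Simplices are arbitrary lists of vertices, possibly degenerate, so
  that a cochain is just a function on lists and both operators below recurse on the first vertex.
\<close>

fun cobd :: "('p list \<Rightarrow> int) \<Rightarrow> 'p list \<Rightarrow> int" where
  "cobd \<phi> [] = 0"
| "cobd \<phi> (x # xs) = \<phi> xs - cobd (\<lambda>l. \<phi> (x # l)) xs"

text \<open>
  The dual of the prism operator that belongs to moving a simplex along \<open>\<tau>\<close>: the
  alternating sum of the values of \<open>\<phi>\<close> on the simplices that switch from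
  \<open>xs\<close> to its image at some vertex.
\<close>

fun prism :: "('p \<Rightarrow> 'p) \<Rightarrow> ('p list \<Rightarrow> int) \<Rightarrow> 'p list \<Rightarrow> int" where
  "prism \<tau> \<phi> [] = 0"
| "prism \<tau> \<phi> (x # xs) = \<phi> (x # map \<tau> (x # xs)) - prism \<tau> (\<lambda>l. \<phi> (x # l)) xs"

lemma cobd_diff: "cobd (\<lambda>l. \<phi> l - \<psi> l) xs = cobd \<phi> xs - cobd \<psi> xs"
  by (induction xs arbitrary: \<phi> \<psi>) auto

lemma cobd_map: "cobd (\<lambda>l. \<phi> (map \<tau> l)) xs = cobd \<phi> (map \<tau> xs)"
  by (induction xs arbitrary: \<phi>) auto

lemma cobd_mult: "cobd (\<lambda>l. c * \<phi> l) xs = c * cobd \<phi> xs"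
  by (induction xs arbitrary: \<phi>) (auto simp: algebra_simps)

lemma prism_add: "prism \<tau> (\<lambda>l. \<phi> l + \<psi> l) xs = prism \<tau> \<phi> xs + prism \<tau> \<psi> xs"
  by (induction xs arbitrary: \<phi> \<psi>) auto

lemma prism_diff: "prism \<tau> (\<lambda>l. \<phi> l - \<psi> l) xs = prism \<tau> \<phi> xs - prism \<tau> \<psi> xs"
  by (induction xs arbitrary: \<phi> \<psi>) auto

lemma prism_mult: "prism \<tau> (\<lambda>l. c * \<phi> l) xs = c * prism \<tau> \<phi> xs"
  by (induction xs arbitrary: \<phi>) (auto simp: algebra_simps)

lemma prism_zero: "prism \<tau> (\<lambda>l. 0) xs = 0"
  by (induction xs) auto

lemma prism_sum: "finite A \<Longrightarrow> prism \<tau> (\<lambda>l. \<Sum>i\<in>A. \<phi> i l) xs = (\<Sum>i\<in>A. prism \<tau> (\<phi> i) xs)"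
  by (induction A rule: finite_induct) (auto simp: prism_add prism_zero)

lemma prism_map:
  assumes "\<tau> \<circ> \<sigma> = \<sigma> \<circ> \<tau>"
  shows "prism \<tau> (\<lambda>l. \<phi> (map \<sigma> l)) xs = prism \<tau> \<phi> (map \<sigma> xs)"
proof (induction xs arbitrary: \<phi>)
  case (Cons x xs)
  have "map \<sigma> (map \<tau> ys) = map \<tau> (map \<sigma> ys)" for ys
    using assms by simp
  with Cons[of "\<lambda>l. \<phi> (\<sigma> x # l)"] show ?case
    using fun_cong[OF assms, of x] by (simp add: o_def del: map_map)
qed auto

text \<open>
  The usual chain homotopy identity. Since both operators peel off the first vertex, an induction
  over the simplex replaces the cancellation of double sums.
\<close>

theorem prism_homotopy:
  "cobd (prism \<tau> \<phi>) xs + prism \<tau> (cobd \<phi>) xs = \<phi> (map \<tau> xs) - \<phi> xs"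
proof (induction xs arbitrary: \<phi>)
  case (Cons x xs)
  let ?\<phi>x = "\<lambda>l. \<phi> (x # l)" and ?\<phi>xx = "\<lambda>l. \<phi> (x # \<tau> x # l)"
  have "cobd (\<lambda>l. \<phi> (x # \<tau> x # map \<tau> l)) xs = cobd ?\<phi>xx (map \<tau> xs)"
    by (rule cobd_map)
  then have "cobd (prism \<tau> \<phi>) (x # xs) =
      prism \<tau> \<phi> xs - (cobd ?\<phi>xx (map \<tau> xs) - cobd (prism \<tau> ?\<phi>x) xs)"
    by (simp add: cobd_diff)
  moreover have "prism \<tau> (cobd \<phi>) (x # xs) = \<phi> (map \<tau> (x # xs)) - ?\<phi>x (map \<tau> xs)
      + cobd ?\<phi>xx (map \<tau> xs) - (prism \<tau> \<phi> xs - prism \<tau> (cobd ?\<phi>x) xs)"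
    by (simp add: prism_diff)
  ultimately show ?case using Cons[of ?\<phi>x] by simp
qed auto

text \<open>
  Started from a single vertex, iterated prism operators integrate a cochain over a cube, which is
  cut into simplices according to the order in which the directions are taken.
\<close>

fun prisms :: "('p \<Rightarrow> 'p) list \<Rightarrow> ('p list \<Rightarrow> int) \<Rightarrow> 'p list \<Rightarrow> int" where
  "prisms [] \<phi> = \<phi>"
| "prisms (\<tau> # ts) \<phi> = prism \<tau> (prisms ts \<phi>)"

definition up :: "nat \<Rightarrow> (nat \<Rightarrow> nat) \<Rightarrow> nat \<Rightarrow> nat" where
  "up i v = (\<lambda>k. if k = i then Suc (v k) else v k)"

lemma up_commute: "up i \<circ> up j = up j \<circ> up i"
  by (simp add: up_def fun_eq_iff)

text \<open>
  Moving the coboundary past one prism operator after the other leaves, for each direction, the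
  difference of the two opposite faces. The signs matter only through being units, and hence are
  not made explicit.
\<close>

lemma cube_stokes:
  assumes "distinct is"
  shows "\<exists>s::nat \<Rightarrow> int. (\<forall>i. s i \<in> {1, -1}) \<and> (\<forall>\<phi> xs. prisms (map up is) (cobd \<phi>) xs =
     (-1) ^ length is * cobd (prisms (map up is) \<phi>) xs +
     (\<Sum>i\<in>set is. s i * (prisms (map up (removeAll i is)) \<phi> (map (up i) xs)
                         - prisms (map up (removeAll i is)) \<phi> xs)))"
  using assms
proof (induction "is")
  case Nil
  show ?case by (rule exI[of _ "\<lambda>_. 1"]) auto
next
  case (Cons j js)
  let ?P = "\<lambda>is. prisms (map up is)"
  obtain s :: "nat \<Rightarrow> int" where s: "\<And>i. s i \<in> {1, -1}"
    and IH: "\<And>\<phi> xs. ?P js (cobd \<phi>) xs = (-1) ^ length js * cobd (?P js \<phi>) xs +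
       (\<Sum>i\<in>set js. s i * (?P (removeAll i js) \<phi> (map (up i) xs) - ?P (removeAll i js) \<phi> xs))"
    using Cons.IH Cons.prems unfolding distinct.simps by blast
  let ?s = "s(j := (-1) ^ length js)"
  have j: "j \<notin> set js" using Cons.prems by simp
  have "?P (j # js) (cobd \<phi>) xs = (-1) ^ length (j # js) * cobd (?P (j # js) \<phi>) xs +
     (\<Sum>i\<in>set (j # js). ?s i * (?P (removeAll i (j # js)) \<phi> (map (up i) xs)
        - ?P (removeAll i (j # js)) \<phi> xs))" for \<phi> xs
  proof -
    have "?P (j # js) (cobd \<phi>) xs = prism (up j) (\<lambda>xs. (-1) ^ length js * cobd (?P js \<phi>) xs +
       (\<Sum>i\<in>set js. s i * (?P (removeAll i js) \<phi> (map (up i) xs) - ?P (removeAll i js) \<phi> xs))) xs"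
      unfolding list.map prisms.simps IH ..
    also have "\<dots> = (-1) ^ length js * prism (up j) (cobd (?P js \<phi>)) xs +
       (\<Sum>i\<in>set js. s i * (prism (up j) (?P (removeAll i js) \<phi>) (map (up i) xs)
          - prism (up j) (?P (removeAll i js) \<phi>) xs))"
      by (simp add: prism_add prism_mult prism_sum prism_diff prism_map[OF up_commute])
    also have "prism (up j) (cobd (?P js \<phi>)) xs =
        ?P js \<phi> (map (up j) xs) - ?P js \<phi> xs - cobd (?P (j # js) \<phi>) xs"
      using prism_homotopy[of "up j" "?P js \<phi>" xs] by simp
    also have "(\<Sum>i\<in>set js. s i * (prism (up j) (?P (removeAll i js) \<phi>) (map (up i) xs)
          - prism (up j) (?P (removeAll i js) \<phi>) xs)) =
        (\<Sum>i\<in>set js. ?s i * (?P (removeAll i (j # js)) \<phi> (map (up i) xs)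
          - ?P (removeAll i (j # js)) \<phi> xs))"
      using j by (intro sum.cong) auto
    finally show ?thesis
      using j by (simp add: algebra_simps)
  qed
  moreover have "\<And>i. ?s i \<in> {1, -1}"
    using s by (auto simp: power_minus1_even minus_one_power_iff)
  ultimately show ?case by blast
qed

definition cell :: "nat set \<Rightarrow> (nat \<Rightarrow> nat) \<Rightarrow> (nat \<Rightarrow> nat) set" where
  "cell A v = {w. \<forall>i. w i = v i \<or> i \<in> A \<and> w i = Suc (v i)}"

lemma prism_cong:
  assumes "\<And>l. set l \<subseteq> set xs \<union> \<tau> ` set xs \<Longrightarrow> \<phi> l = \<psi> l"
  shows "prism \<tau> \<phi> xs = prism \<tau> \<psi> xs"
  using assms
proof (induction xs arbitrary: \<phi> \<psi>)
  case (Cons x xs)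
  have "prism \<tau> (\<lambda>l. \<phi> (x # l)) xs = prism \<tau> (\<lambda>l. \<psi> (x # l)) xs"
    by (rule Cons.IH, rule Cons.prems) auto
  moreover have "\<phi> (x # map \<tau> (x # xs)) = \<psi> (x # map \<tau> (x # xs))"
    by (rule Cons.prems) auto
  ultimately show ?case by simp
qed auto

text \<open>
  Integrating over a cube evaluates the cochain only on simplices with vertices in the cell.
\<close>

lemma prisms_cong:
  assumes "distinct is" "\<And>l. set l \<subseteq> (\<Union>x\<in>set xs. cell (set is) x) \<Longrightarrow> \<phi> l = \<psi> l"
  shows "prisms (map up is) \<phi> xs = prisms (map up is) \<psi> xs"
  using assms
proof (induction "is" arbitrary: xs)
  case Nil
  have "x \<in> cell {} x" for x
    by (simp add: cell_def)
  then have "\<phi> xs = \<psi> xs"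
    by (intro Nil.prems(2)) auto
  then show ?case by simp
next
  case (Cons j js)
  have "prisms (map up js) \<phi> l = prisms (map up js) \<psi> l"
    if l: "set l \<subseteq> set xs \<union> up j ` set xs" for l
  proof (rule Cons.IH)
    have "cell (set js) y \<subseteq> cell (set (j # js)) x" if y: "y = x \<or> y = up j x" for x y
    proof
      fix w assume w: "w \<in> cell (set js) y"
      have "w i = x i \<or> i \<in> set (j # js) \<and> w i = Suc (x i)" for i
      proof -
        have "w i = y i \<or> i \<in> set js \<and> w i = Suc (y i)"
          using w by (auto simp: cell_def)
        moreover have "y i = x i" if "i \<noteq> j"
          using y that by (auto simp: up_def)
        moreover have "y j = x j \<or> y j = Suc (x j)"
          using y by (auto simp: up_def)
        moreover have "j \<notin> set js"
          using Cons.prems(1) by simp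
        ultimately show ?thesis
          by (cases "i = j") simp_all
      qed
      then show "w \<in> cell (set (j # js)) x"
        by (simp add: cell_def)
    qed
    note cell = this
    have sub: "(\<Union>x\<in>set l. cell (set js) x) \<subseteq> (\<Union>x\<in>set xs. cell (set (j # js)) x)"
    proof (rule UN_least)
      fix y assume "y \<in> set l"
      then have "\<exists>x\<in>set xs. y = x \<or> y = up j x" using l by auto
      then obtain x where "x \<in> set xs" "y = x \<or> y = up j x" ..
      then show "cell (set js) y \<subseteq> (\<Union>x\<in>set xs. cell (set (j # js)) x)"
        using cell[of y x] by (intro UN_upper[THEN order_trans[rotated]])
    qed
    show "\<phi> m = \<psi> m" if "set m \<subseteq> (\<Union>x\<in>set l. cell (set js) x)" for m
      using that sub by (intro Cons.prems(2)) (rule order_trans)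
    show "distinct js" using Cons.prems(1) by simp
  qed
  then show ?case
    unfolding list.map prisms.simps by (rule prism_cong)
qed

text \<open>
  The cup product of the \<open>1\<close>-cochains \<open>\<delta>b\<close>, for \<open>b\<close>
  in the list, and the \<open>0\<close>-cochain \<open>f\<close>.
\<close>

fun cup :: "('p \<Rightarrow> int) list \<Rightarrow> ('p \<Rightarrow> int) \<Rightarrow> 'p list \<Rightarrow> int" where
  "cup [] f [x] = f x"
| "cup (b # bs) f (x # y # zs) = (b y - b x) * cup bs f (y # zs)"
| "cup _ _ _ = 0"

text \<open>
  The factors \<open>\<delta>b\<close> are cocycles, so that the coboundary acts on
  \<open>f\<close> only.
\<close>

lemma cobd_cup: "cobd (cup bs f) xs = (-1) ^ length bs * cup (bs @ [f]) (\<lambda>_. 1) xs"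
proof (induction bs arbitrary: xs)
  case Nil
  have 0: "cobd (\<lambda>l. 0) zs = 0" for zs :: "'a list"
    by (induction zs) auto
  show ?case
  proof (cases xs rule: remdups_adj.cases)
    case (3 x y zs)
    then show ?thesis using 0 by (cases zs) auto
  qed auto
next
  case (Cons b bs)
  show ?case
  proof (cases xs rule: remdups_adj.cases)
    case (3 x y zs)
    have "cobd (\<lambda>l. cup (b # bs) f (x # y # l)) zs = (b y - b x) * cobd (\<lambda>l. cup bs f (y # l)) zs"
      by (simp add: cobd_mult)
    moreover have "cup (b # bs) f (y # zs) - cup (b # bs) f (x # zs) = - (b y - b x) * cup bs f zs"
      by (cases zs) (auto simp: algebra_simps)
    ultimately have "cobd (cup (b # bs) f) xs = - (b y - b x) * cobd (cup bs f) (y # zs)"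
      by (simp add: 3 algebra_simps)
    also have "\<dots> = - (b y - b x) * ((-1) ^ length bs * cup (bs @ [f]) (\<lambda>_. 1) (y # zs))"
      by (simp only: Cons)
    finally show ?thesis by (simp add: 3 algebra_simps)
  qed auto
qed

lemma cup_nonzero:
  assumes "cup bs f xs \<noteq> 0"
  shows "(\<forall>b\<in>set bs. \<exists>x\<in>set xs. \<exists>y\<in>set xs. b x \<noteq> b y) \<and> (\<exists>x\<in>set xs. f x \<noteq> 0)"
  using assms
proof (induction bs arbitrary: xs)
  case Nil
  then show ?case by (cases xs rule: remdups_adj.cases) auto
next
  case (Cons b bs)
  from Cons.prems obtain x y zs where xs: "xs = x # y # zs"
    by (cases xs rule: remdups_adj.cases) auto
  have "b x \<noteq> b y" and "cup bs f (y # zs) \<noteq> 0"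
    using Cons.prems by (auto simp: xs)
  note b = this(1) and IH = Cons.IH[OF this(2), THEN conjunct1] Cons.IH[OF this(2), THEN conjunct2]
  have sub: "set (y # zs) \<subseteq> set xs" "x \<in> set xs" "y \<in> set xs"
    by (auto simp: xs)
  have "\<exists>x\<in>set xs. \<exists>y\<in>set xs. c x \<noteq> c y" if "c \<in> set (b # bs)" for c
  proof (cases "c = b")
    case True
    then show ?thesis using b sub by blast
  next
    case False
    with that have "c \<in> set bs" by simp
    then show ?thesis using IH(1) sub by blast
  qed
  then show ?case using IH(2) sub by blast
qed

lemma cup_cong:
  assumes "\<And>x. x \<in> A \<Longrightarrow> f x = g x" "list_all2 (\<lambda>b c. \<forall>x\<in>A. b x = c x) bs cs" "set xs \<subseteq> A"
  shows "cup bs f xs = cup cs g xs"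
  using assms(2,3)
proof (induction bs cs arbitrary: xs rule: list_all2_induct)
  case Nil
  then show ?case
    by (cases xs rule: remdups_adj.cases) (simp_all add: assms(1))
next
  case (Cons b bs c cs)
  show ?case
  proof (cases xs rule: remdups_adj.cases)
    case (3 x y zs)
    then have "cup bs f (y # zs) = cup cs g (y # zs)"
      using Cons.prems by (intro Cons.IH) auto
    moreover have "b x = c x" "b y = c y"
      using Cons.hyps Cons.prems 3 by auto
    ultimately show ?thesis unfolding 3 cup.simps by simp
  next
    case 1
    show ?thesis unfolding 1 cup.simps ..
  next
    case (2 x)
    show ?thesis unfolding 2 cup.simps ..
  qed
qed

text \<open>
  The product of \<open>\<delta>b\<close> with an arbitrary cochain: once a prism operator has
  been applied, the remaining factor is no longer a cup product.
\<close>

definition cup_head :: "('p \<Rightarrow> int) \<Rightarrow> ('p list \<Rightarrow> int) \<Rightarrow> 'p list \<Rightarrow> int" where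
  "cup_head b \<psi> l = (case l of x # y # zs \<Rightarrow> (b y - b x) * \<psi> (y # zs) | _ \<Rightarrow> 0)"

lemma cup_Cons: "cup (b # bs) f = cup_head b (cup bs f)"
  by (rule ext) (auto simp: cup_head_def split: list.split)

lemma prism_cup_head:
  assumes "\<And>x. b (\<tau> x) = b x"
  shows "prism \<tau> (cup_head b \<psi>) xs = - cup_head b (prism \<tau> \<psi>) xs"
proof (cases xs rule: remdups_adj.cases)
  case (3 x y zs)
  have "prism \<tau> (\<lambda>l. cup_head b \<psi> (x # l)) (y # zs) = prism \<tau> (\<lambda>l. (b y - b x) * \<psi> l) (y # zs)"
    by (simp add: cup_head_def)
  also have "\<dots> = (b y - b x) * prism \<tau> \<psi> (y # zs)"
    by (rule prism_mult)
  finally have "prism \<tau> (cup_head b \<psi>) xs =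
      cup_head b \<psi> (x # map \<tau> (x # y # zs)) - (b y - b x) * prism \<tau> \<psi> (y # zs)"
    by (simp only: 3 prism.simps)
  then show ?thesis
    by (simp add: 3 cup_head_def assms)
next
  case (2 x)
  then show ?thesis by (simp add: cup_head_def assms)
qed (simp add: cup_head_def)

lemma prisms_cup_head:
  assumes "\<And>\<tau> x. \<tau> \<in> set ts \<Longrightarrow> b (\<tau> x) = b x"
  shows "prisms ts (cup_head b \<psi>) = (\<lambda>xs. (-1) ^ length ts * cup_head b (prisms ts \<psi>) xs)"
  using assms
proof (induction ts)
  case (Cons \<tau> ts)
  then have "prisms ts (cup_head b \<psi>) = (\<lambda>xs. (-1) ^ length ts * cup_head b (prisms ts \<psi>) xs)"
    by simp
  moreover have "prism \<tau> (cup_head b (prisms ts \<psi>)) xs = - cup_head b (prism \<tau> (prisms ts \<psi>)) xs" for xs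
    using Cons.prems by (intro prism_cup_head) simp
  ultimately show ?case
    by (simp add: prism_mult)
qed auto

text \<open>
  A discrete Fubini theorem: if the \<open>k\<close>-th function changes in the
  \<open>k\<close>-th direction only, then the integral of the cup product over a cube is the
  product of the increments, up to a sign that depends on the dimension only.
\<close>

lemma prisms_cup:
  "\<exists>s\<in>{1, -1::int}. \<forall>is bs x. length is = n \<longrightarrow> length bs = n \<longrightarrow>
    (\<forall>k<n. \<forall>l<n. k \<noteq> l \<longrightarrow> (\<forall>x. (bs ! k) (up (is ! l) x) = (bs ! k) x)) \<longrightarrow>
    prisms (map up is) (cup bs (\<lambda>_. 1)) [x] =
      s * (\<Prod>k<n. (bs ! k) (up (is ! k) x) - (bs ! k) x)"
proof (induction n)
  case 0
  show ?case by (rule bexI[of _ 1]) auto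
next
  case (Suc n)
  then obtain s :: int where s: "s \<in> {1, -1}"
    and IH: "\<forall>is bs x. length is = n \<longrightarrow> length bs = n \<longrightarrow>
    (\<forall>k<n. \<forall>l<n. k \<noteq> l \<longrightarrow> (\<forall>x. (bs ! k) (up (is ! l) x) = (bs ! k) x)) \<longrightarrow>
    prisms (map up is) (cup bs (\<lambda>_. 1)) [x] =
      s * (\<Prod>k<n. (bs ! k) (up (is ! k) x) - (bs ! k) x)"
    by blast
  have "prisms (map up is) (cup bs (\<lambda>_. 1)) [x] =
      ((-1) ^ n * s) * (\<Prod>k<Suc n. (bs ! k) (up (is ! k) x) - (bs ! k) x)"
    if len: "length is = Suc n" "length bs = Suc n"
      and inv: "\<forall>k<Suc n. \<forall>l<Suc n. k \<noteq> l \<longrightarrow> (\<forall>x. (bs ! k) (up (is ! l) x) = (bs ! k) x)"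
    for "is" bs x
  proof -
    obtain i is' where i: "is = i # is'" using len by (cases "is") auto
    obtain b bs' where b: "bs = b # bs'" using len by (cases bs) auto
    have len': "length is' = n" "length bs' = n" using len i b by auto
    have inv': "(bs' ! k) (up (is' ! l) y) = (bs' ! k) y" if "k < n" "l < n" "k \<noteq> l" for k l y
      using inv[rule_format, of "Suc k" "Suc l" y] that by (simp add: i b)
    have inv_i: "(bs' ! k) (up i y) = (bs' ! k) y" if "k < n" for k y
      using inv[rule_format, of "Suc k" 0 y] that by (simp add: i b)
    have inv_b: "b (up j y) = b y" if "j \<in> set is'" for j y
      using inv[rule_format, of 0 "Suc _" y] that len' by (auto simp: i b in_set_conv_nth)
    have "prisms (map up is) (cup bs (\<lambda>_. 1)) [x] =
        (-1) ^ n * ((b (up i x) - b x) * prisms (map up is') (cup bs' (\<lambda>_. 1)) [up i x])"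
    proof -
      have "prisms (map up is') (cup_head b (cup bs' (\<lambda>_. 1))) =
          (\<lambda>xs. (-1) ^ length (map up is') * cup_head b (prisms (map up is') (cup bs' (\<lambda>_. 1))) xs)"
        by (rule prisms_cup_head) (use inv_b in auto)
      then show ?thesis
        by (simp add: i b cup_Cons len') (simp add: cup_head_def)
    qed
    also have "prisms (map up is') (cup bs' (\<lambda>_. 1)) [up i x] =
        s * (\<Prod>k<n. (bs' ! k) (up (is' ! k) (up i x)) - (bs' ! k) (up i x))"
      by (rule IH[rule_format]) (use len' inv' in auto)
    also have "(\<Prod>k<n. (bs' ! k) (up (is' ! k) (up i x)) - (bs' ! k) (up i x)) =
        (\<Prod>k<n. (bs' ! k) (up (is' ! k) x) - (bs' ! k) x)"
      using inv_i fun_cong[OF up_commute] by (intro prod.cong) (auto simp: o_def)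
    finally show ?thesis
      unfolding prod.lessThan_Suc_shift by (simp add: i b)
  qed
  moreover have "(-1) ^ n * s \<in> {1, -1}"
    using s by (auto simp: minus_one_power_iff)
  ultimately show ?case by blast
qed

section \<open>Counting zeros on fine grids\<close>

text \<open>
  Cubes of all dimensions share one type: the grids of dimension \<open>n\<close> leave the
  coordinates from \<open>n\<close> on at \<open>0\<close>.
\<close>

definition unit_box :: "(nat \<Rightarrow> real) set" where
  "unit_box = {x. \<forall>i. 0 \<le> x i \<and> x i \<le> 1}"

definition grid_point :: "nat \<Rightarrow> (nat \<Rightarrow> nat) \<Rightarrow> nat \<Rightarrow> real" where
  "grid_point N v = (\<lambda>i. real (v i) / real N)"

definition grid_box :: "nat set \<Rightarrow> nat \<Rightarrow> (nat \<Rightarrow> nat) set" where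
  "grid_box A N = {v. (\<forall>i\<in>A. v i < N) \<and> (\<forall>i. i \<notin> A \<longrightarrow> v i = 0)}"

definition pos_ind :: "real \<Rightarrow> int" where "pos_ind r = (if r > 0 then 1 else 0)"

text \<open>
  A cochain dual to the ray on which the coordinates below \<open>n\<close> vanish and the
  coordinate \<open>n\<close> is negative. It sees a simplex only if each of the first
  \<open>n\<close> coordinates changes its sign there and the last one is not always positive.
\<close>

definition crossing :: "nat \<Rightarrow> nat \<Rightarrow> ((nat \<Rightarrow> real) \<Rightarrow> nat \<Rightarrow> real) \<Rightarrow> (nat \<Rightarrow> nat) list \<Rightarrow> int" where
  "crossing n N u = cup (map (\<lambda>i v. pos_ind (u (grid_point N v) i)) [0..<n])
     (\<lambda>v. 1 - pos_ind (u (grid_point N v) n))"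

text \<open>
  The degree of \<open>u\<close> along this ray, as read off from the grid of mesh
  \<open>1/N\<close>.
\<close>

definition cell_count :: "nat \<Rightarrow> nat \<Rightarrow> ((nat \<Rightarrow> real) \<Rightarrow> nat \<Rightarrow> real) \<Rightarrow> int" where
  "cell_count n N u = (\<Sum>v\<in>grid_box {..<n} N. prisms (map up [0..<n]) (crossing n N u) [v])"

lemma compact_unit_box: "compact unit_box"
proof -
  have "compactin (product_topology (\<lambda>_. euclidean) UNIV) (PiE UNIV (\<lambda>_::nat. {0..1::real}))"
    by (simp add: compactin_PiE)
  moreover have "PiE UNIV (\<lambda>_::nat. {0..1::real}) = unit_box"
    by (auto simp: unit_box_def PiE_UNIV_domain Pi_iff)
  ultimately show ?thesis by (simp add: euclidean_product_topology)
qed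

lemma tendsto_coordinatewise:
  fixes z :: "nat \<Rightarrow> nat \<Rightarrow> real"
  assumes "\<And>i. (\<lambda>k. z k i) \<longlonglongrightarrow> x i"
  shows "z \<longlonglongrightarrow> x"
proof -
  have "limitin (product_topology (\<lambda>_. euclidean) UNIV) z x sequentially"
    by (simp add: limitin_componentwise assms)
  then show ?thesis by (simp add: euclidean_product_topology)
qed

lemma grid_point_mem: "N > 0 \<Longrightarrow> (\<And>i. w i \<le> N) \<Longrightarrow> grid_point N w \<in> unit_box"
  by (simp add: grid_point_def unit_box_def)

text \<open>
  Compactness: vertices of ever smaller cells on which the coordinates in \<open>A\<close> change
  their signs accumulate at a common zero of these coordinates. The closed set \<open>S\<close>
  serves to exclude a neighbourhood of a known zero.
\<close>

lemma small_cells: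
  fixes u :: "(nat \<Rightarrow> real) \<Rightarrow> nat \<Rightarrow> real"
  assumes cont: "\<And>i. i \<in> A \<union> B \<Longrightarrow> continuous_on unit_box (\<lambda>x. u x i)" and "closed S"
    and none: "\<And>x. x \<in> unit_box \<Longrightarrow> x \<in> S \<Longrightarrow> (\<forall>i\<in>A. u x i = 0) \<Longrightarrow> (\<forall>i\<in>B. u x i \<le> 0) \<Longrightarrow> False"
  shows "\<forall>\<^sub>F N in sequentially. \<forall>v\<in>grid_box D N. grid_point N v \<in> S \<longrightarrow>
    \<not> ((\<forall>i\<in>A. \<exists>w\<in>cell D v. \<exists>w'\<in>cell D v. u (grid_point N w) i > 0 \<and> u (grid_point N w') i \<le> 0) \<and>
       (\<forall>i\<in>B. \<exists>w\<in>cell D v. u (grid_point N w) i \<le> 0))"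
proof (rule ccontr)
  define bad where "bad = (\<lambda>N v. v \<in> grid_box D N \<and> grid_point N v \<in> S \<and>
    (\<forall>i\<in>A. \<exists>w\<in>cell D v. \<exists>w'\<in>cell D v. u (grid_point N w) i > 0 \<and> u (grid_point N w') i \<le> 0) \<and>
       (\<forall>i\<in>B. \<exists>w\<in>cell D v. u (grid_point N w) i \<le> 0))"
  assume "\<not> ?thesis"
  then have "\<exists>N v. N \<ge> Suc m \<and> bad N v" for m
    unfolding eventually_sequentially bad_def by blast
  then obtain N v where N: "\<And>m. N m \<ge> Suc m" and bad: "\<And>m. bad (N m) (v m)"
    by metis
  have v: "v m \<in> grid_box D (N m)" for m using bad by (simp add: bad_def)
  have vertex: "grid_point (N m) w \<in> unit_box" "\<bar>grid_point (N m) w i - grid_point (N m) (v m) i\<bar> \<le> inverse (real (Suc m))"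
    if "w \<in> cell D (v m)" for m w i
  proof -
    have N0: "N m > 0" using N[of m] by simp
    show "grid_point (N m) w \<in> unit_box"
    proof (rule grid_point_mem[OF N0])
      show "w i \<le> N m" for i
      proof -
        have "w i = v m i \<or> i \<in> D \<and> w i = Suc (v m i)"
          using that by (simp add: cell_def)
        moreover have "i \<in> D \<Longrightarrow> v m i < N m" "i \<notin> D \<Longrightarrow> v m i = 0"
          using v[of m] by (auto simp: grid_box_def)
        ultimately show ?thesis by (cases "i \<in> D") auto
      qed
    qed
    have "w i = v m i \<or> w i = Suc (v m i)"
      using that by (auto simp: cell_def)
    then have "\<bar>grid_point (N m) w i - grid_point (N m) (v m) i\<bar> \<le> 1 / real (N m)"
      by (auto simp: grid_point_def diff_divide_distrib[symmetric])
    also have "\<dots> \<le> inverse (real (Suc m))"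
      using N[of m] by (simp add: field_simps)
    finally show "\<bar>grid_point (N m) w i - grid_point (N m) (v m) i\<bar> \<le> inverse (real (Suc m))" .
  qed
  have self: "v m \<in> cell D (v m)" for m by (simp add: cell_def)
  let ?z = "\<lambda>m. grid_point (N m) (v m)"
  have "seq_compact unit_box"
    using compact_unit_box by (rule compact_imp_seq_compact)
  then obtain x r where x: "x \<in> unit_box" and r: "strict_mono (r :: nat \<Rightarrow> nat)" and lim: "(?z \<circ> r) \<longlonglongrightarrow> x"
    using vertex(1)[OF self] by (elim seq_compactE[of _ ?z]) auto
  have lim_w: "(\<lambda>m. grid_point (N (r m)) (w m)) \<longlonglongrightarrow> x" if w: "\<And>m. w m \<in> cell D (v (r m))" for w
  proof (rule tendsto_coordinatewise)
    fix i
    have "(\<lambda>m. grid_point (N (r m)) (v (r m)) i) \<longlonglongrightarrow> x i"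
      using continuous_on_tendsto_compose[OF continuous_on_product_coordinates lim, of i] by (simp add: o_def)
    moreover have "(\<lambda>m. grid_point (N (r m)) (w m) i - grid_point (N (r m)) (v (r m)) i) \<longlonglongrightarrow> 0"
    proof (rule Lim_null_comparison)
      show "\<forall>\<^sub>F m in sequentially. norm (grid_point (N (r m)) (w m) i - grid_point (N (r m)) (v (r m)) i) \<le> inverse (real (Suc m))"
      proof (intro always_eventually allI)
        fix m
        have "inverse (real (Suc (r m))) \<le> inverse (real (Suc m))"
          using seq_suble[OF r, of m] by (intro le_imp_inverse_le) auto
        then show "norm (grid_point (N (r m)) (w m) i - grid_point (N (r m)) (v (r m)) i) \<le> inverse (real (Suc m))"
          unfolding real_norm_def by (rule order_trans[OF vertex(2)[OF w]])
      qed
      show "(\<lambda>m. inverse (real (Suc m))) \<longlonglongrightarrow> 0" by (rule LIMSEQ_inverse_real_of_nat)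
    qed
    ultimately show "(\<lambda>m. grid_point (N (r m)) (w m) i) \<longlonglongrightarrow> x i"
      using tendsto_add by fastforce
  qed
  have lim_u: "(\<lambda>m. u (grid_point (N (r m)) (w m)) i) \<longlonglongrightarrow> u x i"
    if "\<And>m. w m \<in> cell D (v (r m))" "i \<in> A \<union> B" for w i
    by (rule continuous_on_tendsto_compose[OF cont lim_w x])
       (use that vertex(1) in \<open>auto intro!: always_eventually\<close>)
  have nonpos: "u x i \<le> 0" if "i \<in> A \<union> B" for i
  proof -
    have "\<exists>w\<in>cell D (v (r m)). u (grid_point (N (r m)) w) i \<le> 0" for m
      using bad[of "r m"] that unfolding bad_def by blast
    then obtain w where "\<And>m. w m \<in> cell D (v (r m))" "\<And>m. u (grid_point (N (r m)) (w m)) i \<le> 0"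
      by metis
    then show ?thesis using lim_u[of w i] that by (intro LIMSEQ_le_const2) auto
  qed
  have "u x i = 0" if "i \<in> A" for i
  proof -
    have "\<exists>w\<in>cell D (v (r m)). u (grid_point (N (r m)) w) i > 0" for m
      using bad[of "r m"] that unfolding bad_def by blast
    then obtain w where "\<And>m. w m \<in> cell D (v (r m))" "\<And>m. u (grid_point (N (r m)) (w m)) i > 0"
      by metis
    then have "0 \<le> u x i" using lim_u[of w i] that by (intro LIMSEQ_le_const) (auto intro: less_imp_le)
    with nonpos[of i] that show ?thesis by auto
  qed
  moreover have "x \<in> S"
    by (rule Lim_in_closed_set[OF \<open>closed S\<close> _ _ lim]) (use bad in \<open>auto simp: bad_def\<close>)
  ultimately show False
    using none[OF x] nonpos by blast
qed

lemma crossing_nonzero: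
  assumes "crossing n N u l \<noteq> 0"
  shows "(\<forall>i<n. \<exists>x\<in>set l. \<exists>y\<in>set l. u (grid_point N x) i > 0 \<and> u (grid_point N y) i \<le> 0) \<and>
    (\<exists>x\<in>set l. u (grid_point N x) n \<le> 0)"
proof -
  have *: "\<exists>x\<in>set l. \<exists>y\<in>set l. pos_ind (u (grid_point N x) i) \<noteq> pos_ind (u (grid_point N y) i)" if "i < n" for i
    using cup_nonzero[OF assms[unfolded crossing_def]] that by auto
  have "\<exists>x\<in>set l. \<exists>y\<in>set l. u (grid_point N x) i > 0 \<and> u (grid_point N y) i \<le> 0" if "i < n" for i
    using *[OF that] by (force simp: pos_ind_def split: if_splits)
  moreover have "\<exists>x\<in>set l. 1 - pos_ind (u (grid_point N x) n) \<noteq> 0"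
    using cup_nonzero[OF assms[unfolded crossing_def]] by blast
  ultimately show ?thesis
    by (force simp: pos_ind_def split: if_splits)
qed

lemma prisms_zero: "prisms ts (\<lambda>_. 0) = (\<lambda>_. 0)"
  by (induction ts) (auto simp: prism_zero)

lemma prisms_nonzero:
  assumes "distinct is" "prisms (map up is) \<phi> [v] \<noteq> 0"
  obtains l where "set l \<subseteq> cell (set is) v" "\<phi> l \<noteq> 0"
proof (rule ccontr)
  assume "\<not> thesis"
  then have "\<phi> l = 0" if "set l \<subseteq> cell (set is) v" for l
    using that \<open>\<And>l. set l \<subseteq> cell (set is) v \<Longrightarrow> \<phi> l \<noteq> 0 \<Longrightarrow> thesis\<close> by blast
  then have "prisms (map up is) \<phi> [v] = prisms (map up is) (\<lambda>_. 0) [v]"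
    by (intro prisms_cong assms(1)) simp
  with assms(2) show False by (simp add: prisms_zero)
qed

lemma cell_count_eventually_zero:
  assumes "\<And>i. i \<le> n \<Longrightarrow> continuous_on unit_box (\<lambda>x. u x i)"
    and "\<And>x. x \<in> unit_box \<Longrightarrow> (\<forall>i<n. u x i = 0) \<Longrightarrow> u x n \<le> 0 \<Longrightarrow> False"
  shows "\<forall>\<^sub>F N in sequentially. cell_count n N u = 0"
proof -
  have "\<forall>\<^sub>F N in sequentially. \<forall>v\<in>grid_box {..<n} N. grid_point N v \<in> UNIV \<longrightarrow>
    \<not> ((\<forall>i\<in>{..<n}. \<exists>w\<in>cell {..<n} v. \<exists>w'\<in>cell {..<n} v. u (grid_point N w) i > 0 \<and> u (grid_point N w') i \<le> 0) \<and>
       (\<forall>i\<in>{n}. \<exists>w\<in>cell {..<n} v. u (grid_point N w) i \<le> 0))"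
    by (rule small_cells) (use assms in auto)
  then show ?thesis
  proof eventually_elim
    case (elim N)
    have "prisms (map up [0..<n]) (crossing n N u) [v] = 0" if "v \<in> grid_box {..<n} N" for v
    proof (rule ccontr)
      assume "prisms (map up [0..<n]) (crossing n N u) [v] \<noteq> 0"
      then obtain l where l: "set l \<subseteq> cell {..<n} v" "crossing n N u l \<noteq> 0"
        by (rule prisms_nonzero[rotated]) (auto simp: atLeast0LessThan)
      have "\<exists>w\<in>cell {..<n} v. \<exists>w'\<in>cell {..<n} v. u (grid_point N w) i > 0 \<and> u (grid_point N w') i \<le> 0"
        if "i \<in> {..<n}" for i
        using crossing_nonzero[OF l(2)] l(1) that by (meson lessThan_iff subsetD)
      moreover have "\<exists>w\<in>cell {..<n} v. u (grid_point N w) n \<le> 0"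
        using crossing_nonzero[OF l(2)] l(1) by (meson subsetD)
      ultimately show False
        using elim[rule_format, OF that UNIV_I] by blast
    qed
    then show ?case by (simp add: cell_count_def)
  qed
qed

lemma sum_grid_box_insert:
  assumes "finite A" "i \<notin> A"
  shows "(\<Sum>v\<in>grid_box (insert i A) N. g v) = (\<Sum>v\<in>grid_box A N. \<Sum>k<N. g (v(i := k)))"
proof -
  have "(\<Sum>v\<in>grid_box (insert i A) N. g v) = (\<Sum>(v,k)\<in>grid_box A N \<times> {..<N}. g (v(i := k)))"
  proof (rule sum.reindex_bij_witness[of _ "\<lambda>(v,k). v(i := k)" "\<lambda>v. (v(i := 0), v i)"])
    fix v assume "v \<in> grid_box (insert i A) N"
    then show "(v(i := 0), v i) \<in> grid_box A N \<times> {..<N}"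
      using assms(2) by (auto simp: grid_box_def)
  next
    fix p assume p: "p \<in> grid_box A N \<times> {..<N}"
    obtain v k where [simp]: "p = (v, k)" by (cases p)
    show "(case p of (v, k) \<Rightarrow> v(i := k)) \<in> grid_box (insert i A) N"
      using p assms(2) by (auto simp: grid_box_def)
    have "v i = 0" using p assms(2) by (auto simp: grid_box_def)
    then show "((case p of (v, k) \<Rightarrow> v(i := k))(i := 0), (case p of (v, k) \<Rightarrow> v(i := k)) i) = p"
      by (auto simp: fun_upd_idem)
  qed (auto simp: fun_upd_idem)
  then show ?thesis by (simp add: sum.cartesian_product)
qed

lemma sum_grid_box_prod:
  fixes g :: "nat \<Rightarrow> nat \<Rightarrow> int"
  shows "(\<Sum>v\<in>grid_box {..<n} N. \<Prod>i<n. g i (v i)) = (\<Prod>i<n. \<Sum>k<N. g i k)"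
proof (induction n)
  case 0
  have "grid_box {} N = {\<lambda>_. 0}" by (auto simp: grid_box_def)
  then show ?case by simp
next
  case (Suc n)
  have "(\<Sum>v\<in>grid_box {..<Suc n} N. \<Prod>i<Suc n. g i (v i)) =
    (\<Sum>v\<in>grid_box {..<n} N. \<Sum>k<N. (\<Prod>i<n. g i (v i)) * g n k)"
    unfolding lessThan_Suc by (subst sum_grid_box_insert) (auto simp: mult.commute)
  also have "\<dots> = (\<Sum>v\<in>grid_box {..<n} N. \<Prod>i<n. g i (v i)) * (\<Sum>k<N. g n k)"
    by (simp only: sum_product)
  finally show ?case by (simp add: Suc)
qed

text \<open>
  Suppose that the ray is met only at \<open>\<theta>\<close>, where the signs of the coordinates
  are those of a diagonal linear map. Far from \<open>\<theta>\<close> neither \<open>u\<close>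
  nor the diagonal map contributes on fine grids, and near \<open>\<theta>\<close> their signs
  agree; so the count is that of the diagonal map, which is a product of telescoping sums.
\<close>

lemma cell_count_eventually_unique:
  "\<exists>s\<in>{1, -1::int}. \<forall>u \<theta> \<sigma> \<eta>.
    (\<forall>i\<le>n. continuous_on unit_box (\<lambda>x. u x i)) \<longrightarrow>
    (\<forall>i<n. 0 < \<theta> i \<and> \<theta> i < 1 \<and> \<sigma> i \<in> {1, -1}) \<longrightarrow> \<eta> > 0 \<longrightarrow>
    (\<forall>x\<in>unit_box. (\<forall>i<n. \<bar>x i - \<theta> i\<bar> \<le> \<eta>) \<longrightarrow>
       u x n \<le> 0 \<and> (\<forall>i<n. u x i > 0 \<longleftrightarrow> real_of_int (\<sigma> i) * (x i - \<theta> i) > 0)) \<longrightarrow>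
    (\<forall>x\<in>unit_box. (\<forall>i<n. u x i = 0) \<longrightarrow> u x n \<le> 0 \<longrightarrow> (\<forall>i<n. x i = \<theta> i)) \<longrightarrow>
    (\<forall>\<^sub>F N in sequentially. cell_count n N u = s * (\<Prod>i<n. \<sigma> i))"
proof -
  obtain s :: int where s: "s \<in> {1, -1}"
    and cup: "\<forall>is bs x. length is = n \<longrightarrow> length bs = n \<longrightarrow>
    (\<forall>k<n. \<forall>l<n. k \<noteq> l \<longrightarrow> (\<forall>x. (bs ! k) (up (is ! l) x) = (bs ! k) x)) \<longrightarrow>
    prisms (map up is) (cup bs (\<lambda>_. 1)) [x] =
      s * (\<Prod>k<n. (bs ! k) (up (is ! k) x) - (bs ! k) x)"
    using prisms_cup[of n] by blast
  have "\<forall>\<^sub>F N in sequentially. cell_count n N u = s * (\<Prod>i<n. \<sigma> i)"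
    if cont: "\<And>i. i \<le> n \<Longrightarrow> continuous_on unit_box (\<lambda>x. u x i)"
      and \<theta>: "\<And>i. i < n \<Longrightarrow> 0 < \<theta> i \<and> \<theta> i < 1 \<and> \<sigma> i \<in> {1, -1}" and \<eta>: "\<eta> > 0"
      and near: "\<And>x. x \<in> unit_box \<Longrightarrow> (\<And>i. i < n \<Longrightarrow> \<bar>x i - \<theta> i\<bar> \<le> \<eta>) \<Longrightarrow>
         u x n \<le> 0 \<and> (\<forall>i<n. u x i > 0 \<longleftrightarrow> real_of_int (\<sigma> i) * (x i - \<theta> i) > 0)"
      and unique: "\<And>x. x \<in> unit_box \<Longrightarrow> (\<forall>i<n. u x i = 0) \<Longrightarrow> u x n \<le> 0 \<Longrightarrow> (\<forall>i<n. x i = \<theta> i)"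
    for u :: "(nat \<Rightarrow> real) \<Rightarrow> nat \<Rightarrow> real" and \<theta> \<sigma> \<eta>
  proof -
    define S where "S = (\<Union>i<n. {x::nat \<Rightarrow> real. \<eta> / 2 \<le> \<bar>x i - \<theta> i\<bar>})"
    have "closed {x::nat \<Rightarrow> real. \<eta> / 2 \<le> \<bar>x i - \<theta> i\<bar>}" for i
    proof -
      have "continuous_on UNIV (\<lambda>x::nat \<Rightarrow> real. \<bar>x i - \<theta> i\<bar>)"
        by (intro continuous_intros continuous_on_product_coordinates)
      from continuous_closed_preimage[OF this closed_UNIV closed_atLeast[of "\<eta> / 2"]]
      show ?thesis by (simp add: vimage_def)
    qed
    then have "closed S" unfolding S_def by (intro closed_UN) auto
    have "\<forall>\<^sub>F N in sequentially. \<forall>v\<in>grid_box {..<n} N. grid_point N v \<in> S \<longrightarrow>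
      \<not> ((\<forall>i\<in>{..<n}. \<exists>w\<in>cell {..<n} v. \<exists>w'\<in>cell {..<n} v. u (grid_point N w) i > 0 \<and> u (grid_point N w') i \<le> 0) \<and>
         (\<forall>i\<in>{n}. \<exists>w\<in>cell {..<n} v. u (grid_point N w) i \<le> 0))"
    proof (rule small_cells[OF _ \<open>closed S\<close>])
      fix x assume "x \<in> unit_box" "x \<in> S" "\<forall>i\<in>{..<n}. u x i = 0" "\<forall>i\<in>{n}. u x i \<le> 0"
      then show False using unique[of x] \<eta> by (auto simp: S_def)
    qed (use cont in auto)
    moreover have "\<forall>\<^sub>F N in sequentially. real N > 2 / \<eta>"
      using filterlim_real_sequentially unfolding filterlim_at_top_dense by blast
    ultimately show ?thesis
    proof eventually_elim
      case (elim N)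
      have N0: "real N > 0" using elim(2) \<eta> by (meson divide_pos_pos less_trans zero_less_numeral)
      have N1: "1 / real N < \<eta> / 2" using elim(2) \<eta> N0 by (simp add: field_simps)
      \<comment> \<open>The diagonal model; its last coordinate is negative everywhere.\<close>
      define u' where "u' = (\<lambda>(x::nat \<Rightarrow> real) i. if i < n then real_of_int (\<sigma> i) * (x i - \<theta> i) else - 1)"
      have step: "\<bar>grid_point N w i - grid_point N v i\<bar> \<le> 1 / real N" if "w \<in> cell {..<n} v" for w v i
      proof -
        have "w i = v i \<or> w i = Suc (v i)" using that by (auto simp: cell_def)
        then show ?thesis by (auto simp: grid_point_def diff_divide_distrib[symmetric])
      qed
      have eq: "prisms (map up [0..<n]) (crossing n N u) [v] = prisms (map up [0..<n]) (crossing n N u') [v]"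
        if v: "v \<in> grid_box {..<n} N" for v
      proof (cases "grid_point N v \<in> S")
        case True
        have "prisms (map up [0..<n]) (crossing n N u) [v] = 0"
        proof (rule ccontr)
          assume "prisms (map up [0..<n]) (crossing n N u) [v] \<noteq> 0"
          then obtain l where l: "set l \<subseteq> cell {..<n} v" "crossing n N u l \<noteq> 0"
            by (rule prisms_nonzero[rotated]) (auto simp: atLeast0LessThan)
          have "\<exists>w\<in>cell {..<n} v. \<exists>w'\<in>cell {..<n} v. u (grid_point N w) i > 0 \<and> u (grid_point N w') i \<le> 0"
            if "i \<in> {..<n}" for i
            using crossing_nonzero[OF l(2)] l(1) that by (meson lessThan_iff subsetD)
          moreover have "\<exists>w\<in>cell {..<n} v. u (grid_point N w) n \<le> 0"
            using crossing_nonzero[OF l(2)] l(1) by (meson subsetD)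
          ultimately show False
            using elim(1)[rule_format, OF v True] by blast
        qed
        moreover have "prisms (map up [0..<n]) (crossing n N u') [v] = 0"
        proof (rule ccontr)
          assume "prisms (map up [0..<n]) (crossing n N u') [v] \<noteq> 0"
          then obtain l where l: "set l \<subseteq> cell {..<n} v" "crossing n N u' l \<noteq> 0"
            by (rule prisms_nonzero[rotated]) (auto simp: atLeast0LessThan)
          have "\<bar>grid_point N v i - \<theta> i\<bar> < \<eta> / 2" if i: "i < n" for i
          proof -
            obtain w w' where w: "w \<in> cell {..<n} v" "w' \<in> cell {..<n} v"
              "u' (grid_point N w) i > 0" "u' (grid_point N w') i \<le> 0"
              using crossing_nonzero[OF l(2)] l(1) i by (meson subsetD)
            have "grid_point N w i > \<theta> i \<and> grid_point N w' i \<le> \<theta> i \<or>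
                grid_point N w i < \<theta> i \<and> grid_point N w' i \<ge> \<theta> i"
              using w(3,4) \<theta>[OF i] i by (auto simp: u'_def)
            then have "\<bar>grid_point N v i - \<theta> i\<bar> \<le> 1 / real N"
              using step[OF w(1), of i] step[OF w(2), of i] by linarith
            then show ?thesis using N1 by linarith
          qed
          then show False using True by (force simp: S_def)
        qed
        ultimately show ?thesis by simp
      next
        case False
        have close: "\<bar>grid_point N w i - \<theta> i\<bar> \<le> \<eta>" if "w \<in> cell {..<n} v" "i < n" for w i
        proof -
          have "\<bar>grid_point N v i - \<theta> i\<bar> < \<eta> / 2" using False that by (force simp: S_def)
          then show ?thesis using step[OF that(1), of i] N1 by linarith
        qed
        have mem: "grid_point N w \<in> unit_box" if "w \<in> cell {..<n} v" for w
        proof (rule grid_point_mem)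
          show "w i \<le> N" for i
          proof -
            have "w i = v i \<or> i < n \<and> w i = Suc (v i)" using that by (auto simp: cell_def)
            moreover have "i < n \<Longrightarrow> v i < N" "\<not> i < n \<Longrightarrow> v i = 0" using v by (auto simp: grid_box_def)
            ultimately show ?thesis by (cases "i < n") auto
          qed
        qed (use N0 in simp)
        have agree: "pos_ind (u (grid_point N w) i) = pos_ind (u' (grid_point N w) i)"
          if "w \<in> cell {..<n} v" "i \<le> n" for w i
          using near[OF mem[OF that(1)] close[OF that(1)]] that(2) by (auto simp: pos_ind_def u'_def)
        show ?thesis
        proof (rule prisms_cong)
          fix l assume l: "set l \<subseteq> (\<Union>x\<in>set [v]. cell (set [0..<n]) x)"
          show "crossing n N u l = crossing n N u' l"
            unfolding crossing_def
            by (rule cup_cong[of "cell {..<n} v"])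
               (use l agree in \<open>auto simp: list_all2_conv_all_nth atLeast0LessThan\<close>)
        qed simp
      qed
      let ?b = "\<lambda>i k. pos_ind (real_of_int (\<sigma> i) * (real k / real N - \<theta> i))"
      have "prisms (map up [0..<n]) (crossing n N u') [v] = s * (\<Prod>i<n. ?b i (Suc (v i)) - ?b i (v i))" for v
      proof -
        let ?bs = "map (\<lambda>i v. ?b i (v i)) [0..<n]"
        have "crossing n N u' = cup ?bs (\<lambda>_. 1)"
        proof
          show "crossing n N u' l = cup ?bs (\<lambda>_. 1) l" for l
            unfolding crossing_def
            by (rule cup_cong[of UNIV])
               (auto simp: list_all2_conv_all_nth u'_def pos_ind_def grid_point_def)
        qed
        moreover have "prisms (map up [0..<n]) (cup ?bs (\<lambda>_. 1)) [v] =
          s * (\<Prod>k<n. (?bs ! k) (up ([0..<n] ! k) v) - (?bs ! k) v)"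
          by (rule cup[rule_format]) (auto simp: up_def)
        ultimately show ?thesis by (simp add: up_def)
      qed
      then have "cell_count n N u = s * (\<Sum>v\<in>grid_box {..<n} N. \<Prod>i<n. ?b i (Suc (v i)) - ?b i (v i))"
        by (simp add: cell_count_def eq sum_distrib_left)
      also have "(\<Sum>v\<in>grid_box {..<n} N. \<Prod>i<n. ?b i (Suc (v i)) - ?b i (v i)) =
          (\<Prod>i<n. \<Sum>k<N. ?b i (Suc k) - ?b i k)"
        by (rule sum_grid_box_prod[of "\<lambda>i k. ?b i (Suc k) - ?b i k"])
      also have "\<dots> = (\<Prod>i<n. \<sigma> i)"
      proof (rule prod.cong[OF HOL.refl])
        fix i assume "i \<in> {..<n}"
        then have "0 < \<theta> i" "\<theta> i < 1" "\<sigma> i \<in> {1, -1}" using \<theta> by auto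
        moreover have "(\<Sum>k<N. ?b i (Suc k) - ?b i k) = ?b i N - ?b i 0"
          by (rule sum_lessThan_telescope)
        ultimately show "(\<Sum>k<N. ?b i (Suc k) - ?b i k) = \<sigma> i"
          using N0 by (auto simp: pos_ind_def)
      qed
      finally show ?case .
    qed
  qed
  note main = this
  show ?thesis
  proof (intro bexI[OF _ s] allI impI, goal_cases)
    case (1 u \<theta> \<sigma> \<eta>)
    show ?case
    proof (rule main[of u \<theta> \<sigma> \<eta>])
      show "u x n \<le> 0 \<and> (\<forall>i<n. u x i > 0 \<longleftrightarrow> real_of_int (\<sigma> i) * (x i - \<theta> i) > 0)"
        if "x \<in> unit_box" "\<And>i. i < n \<Longrightarrow> \<bar>x i - \<theta> i\<bar> \<le> \<eta>" for x
        using 1(4) that by blast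
      show "\<forall>i<n. x i = \<theta> i" if "x \<in> unit_box" "\<forall>i<n. u x i = 0" "u x n \<le> 0" for x
        using 1(5) that by blast
    qed (use 1 in blast)+
  qed
qed

section \<open>Cubical cycles in a contractible space\<close>

lemma prisms_crossing_const:
  assumes "0 < n" "\<And>w w' i. w \<in> cell {..<n} v \<Longrightarrow> w' \<in> cell {..<n} v \<Longrightarrow> i < n \<Longrightarrow>
    u (grid_point N w) i = u (grid_point N w') i"
  shows "prisms (map up [0..<n]) (crossing n N u) [v] = 0"
proof (rule ccontr)
  assume "prisms (map up [0..<n]) (crossing n N u) [v] \<noteq> 0"
  then obtain l where l: "set l \<subseteq> cell {..<n} v" "crossing n N u l \<noteq> 0"
    by (rule prisms_nonzero[rotated]) (auto simp: atLeast0LessThan)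
  obtain w w' where "w \<in> set l" "w' \<in> set l" "u (grid_point N w) 0 > 0" "u (grid_point N w') 0 \<le> 0"
    using crossing_nonzero[OF l(2)] \<open>0 < n\<close> by blast
  then show False using assms(2)[of w w' 0] l(1) \<open>0 < n\<close> by force
qed

lemma prisms_Nil: "ts \<noteq> [] \<Longrightarrow> prisms ts \<phi> [] = 0"
  by (cases ts) auto

text \<open>
  A contraction extends each cube \<open>f j\<close> to a cube \<open>K j\<close> of one more
  dimension, with time as its last coordinate. On fine grids the crossing cochain is closed along
  \<open>K j\<close>, because its coboundary sees only simplices on which all \<open>n + 1\<close>
  coordinates of \<open>y\<close> change their signs. By Stokes' theorem the weighted sum of the
  boundary contributions vanishes. The side faces cancel in pairs under \<open>\<iota>\<close>,
  the face at time \<open>1\<close> is mapped to a point, and the face at time \<open>0\<close>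
  yields the count.
\<close>

theorem cubical_cycle_count:
  fixes f :: "'j \<Rightarrow> (nat \<Rightarrow> real) \<Rightarrow> 'x" and k :: "'j \<Rightarrow> int" and y :: "'x \<Rightarrow> nat \<Rightarrow> real"
  assumes contr: "contractible_space X" and "finite J" and "0 < n"
    and f: "\<And>j. j \<in> J \<Longrightarrow> continuous_map (top_of_set unit_box) X (f j)"
    and y: "\<And>i. i \<le> n \<Longrightarrow> continuous_map X euclideanreal (\<lambda>x. y x i)"
    and nonzero: "\<And>x. x \<in> topspace X \<Longrightarrow> (\<forall>i\<le>n. y x i = 0) \<Longrightarrow> False"
    and faces: "\<And>i b. i < n \<Longrightarrow> b \<in> {0, 1} \<Longrightarrow> \<exists>\<iota>. bij_betw \<iota> J J \<and>
      (\<forall>j\<in>J. k (\<iota> j) = - k j \<and> (\<forall>x\<in>unit_box. x i = b \<longrightarrow> f (\<iota> j) x = f j x))"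
  shows "\<forall>\<^sub>F N in sequentially. (\<Sum>j\<in>J. k j * cell_count n N (\<lambda>x. y (f j x))) = 0"
proof -
  obtain h a where h: "continuous_map (prod_topology (top_of_set {0..1::real}) X) X h"
    and h0: "\<And>x. h (0, x) = x" and h1: "\<And>x. h (1, x) = a"
    using contr unfolding contractible_space_def homotopic_with_def by auto
  define K where "K = (\<lambda>j x. h (x n, f j (x(n := 0))))"
  have K: "continuous_map (top_of_set unit_box) X (K j)" if "j \<in> J" for j
  proof -
    have "continuous_map (top_of_set unit_box) (top_of_set {0..1}) (\<lambda>x. x n)"
      by (auto simp: unit_box_def intro: continuous_on_subset[OF continuous_on_product_coordinates])
    moreover have "continuous_on unit_box (\<lambda>x::nat \<Rightarrow> real. x(n := 0))"
    proof (rule continuous_on_coordinatewise_then_product)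
      show "continuous_on unit_box (\<lambda>x::nat \<Rightarrow> real. (x(n := 0)) i)" for i
        by (cases "i = n") (auto intro: continuous_on_subset[OF continuous_on_product_coordinates])
    qed
    then have "continuous_map (top_of_set unit_box) (top_of_set unit_box) (\<lambda>x::nat \<Rightarrow> real. x(n := 0))"
      by (auto simp: unit_box_def)
    then have "continuous_map (top_of_set unit_box) X (f j \<circ> (\<lambda>x. x(n := 0)))"
      by (rule continuous_map_compose) (rule f[OF that])
    ultimately have "continuous_map (top_of_set unit_box) (prod_topology (top_of_set {0..1}) X)
        (\<lambda>x. (x n, f j (x(n := 0))))"
      by (simp add: continuous_map_pairwise o_def)
    from continuous_map_compose[OF this h] show ?thesis by (simp add: K_def o_def)
  qed
  define u where "u = (\<lambda>j x. y (K j x))"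
  have u: "continuous_on unit_box (\<lambda>x. u j x i)" if "j \<in> J" "i \<le> n" for j i
    using continuous_map_compose[OF K[OF that(1)] y[OF that(2)]] by (simp add: u_def o_def)
  have K_mem: "K j x \<in> topspace X" if "j \<in> J" "x \<in> unit_box" for j x
    using continuous_map_image_subset_topspace[OF K[OF that(1)]] that(2) by auto
  have "\<forall>\<^sub>F N in sequentially. \<forall>j\<in>J. \<forall>v\<in>grid_box {..n} N. grid_point N v \<in> UNIV \<longrightarrow>
    \<not> ((\<forall>i\<in>{..n}. \<exists>w\<in>cell {..n} v. \<exists>w'\<in>cell {..n} v.
          u j (grid_point N w) i > 0 \<and> u j (grid_point N w') i \<le> 0) \<and>
       (\<forall>i\<in>{}. \<exists>w\<in>cell {..n} v. u j (grid_point N w) i \<le> 0))"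
    unfolding eventually_ball_finite_distrib[OF \<open>finite J\<close>]
  proof (intro ballI small_cells)
    fix j x assume "j \<in> J" "x \<in> unit_box" "\<forall>i\<in>{..n}. u j x i = 0"
    then show False using nonzero[OF K_mem] by (auto simp: u_def)
  qed (use u in auto)
  moreover have "\<forall>\<^sub>F N in sequentially. N > 0"
    by (rule eventually_gt_at_top)
  ultimately show ?thesis
  proof eventually_elim
    case (elim N)
    define \<phi> where "\<phi> = (\<lambda>j. crossing n N (u j))"
    let ?is = "[0..<Suc n]"
    have set_is: "set ?is = {..n}" by auto
    have "\<exists>s::nat \<Rightarrow> int. (\<forall>i. s i \<in> {1, -1}) \<and> (\<forall>\<phi> xs. prisms (map up ?is) (cobd \<phi>) xs =
     (-1) ^ length ?is * cobd (prisms (map up ?is) \<phi>) xs +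
     (\<Sum>i\<in>set ?is. s i * (prisms (map up (removeAll i ?is)) \<phi> (map (up i) xs)
                         - prisms (map up (removeAll i ?is)) \<phi> xs)))"
      by (rule cube_stokes) (rule distinct_upt)
    then obtain s :: "nat \<Rightarrow> int" where "(\<forall>i. s i \<in> {1, -1}) \<and> (\<forall>\<phi> xs. prisms (map up ?is) (cobd \<phi>) xs =
     (-1) ^ length ?is * cobd (prisms (map up ?is) \<phi>) xs +
     (\<Sum>i\<in>set ?is. s i * (prisms (map up (removeAll i ?is)) \<phi> (map (up i) xs)
                         - prisms (map up (removeAll i ?is)) \<phi> xs)))" ..
    note s = this[THEN conjunct1, rule_format] and stokes = this[THEN conjunct2, rule_format]
    define P where "P = (\<lambda>i j v. prisms (map up (removeAll i ?is)) (\<phi> j) [v])"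
    have cocycle: "prisms (map up ?is) (cobd (\<phi> j)) [v] = 0" if j: "j \<in> J" and v: "v \<in> grid_box {..n} N" for j v
    proof (rule ccontr)
      assume "prisms (map up ?is) (cobd (\<phi> j)) [v] \<noteq> 0"
      then obtain l where l': "set l \<subseteq> cell (set ?is) v" and l2: "cobd (\<phi> j) l \<noteq> 0"
        by (rule prisms_nonzero[OF distinct_upt])
      note l = l'[unfolded set_is] l2
      let ?bs = "map (\<lambda>i v. pos_ind (u j (grid_point N v) i)) [0..<n]"
      let ?f = "\<lambda>v. 1 - pos_ind (u j (grid_point N v) n)"
      have "cup (?bs @ [?f]) (\<lambda>_. 1) l \<noteq> 0"
        using l(2) unfolding \<phi>_def crossing_def cobd_cup by simp
      then have *: "\<forall>b\<in>set (?bs @ [?f]). \<exists>x\<in>set l. \<exists>y\<in>set l. b x \<noteq> b y"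
        using cup_nonzero by blast
      have "\<exists>x\<in>set l. \<exists>y\<in>set l. pos_ind (u j (grid_point N x) i) \<noteq> pos_ind (u j (grid_point N y) i)"
        if "i \<le> n" for i
      proof (cases "i = n")
        case True
        then show ?thesis using * by simp
      next
        case False
        then show ?thesis using * that by simp
      qed
      note ne = this
      have "\<exists>w\<in>cell {..n} v. \<exists>w'\<in>cell {..n} v.
          u j (grid_point N w) i > 0 \<and> u j (grid_point N w') i \<le> 0" if "i \<in> {..n}" for i
      proof -
        obtain x y where xy: "x \<in> set l" "y \<in> set l"
          "pos_ind (u j (grid_point N x) i) \<noteq> pos_ind (u j (grid_point N y) i)"
          using ne[of i] \<open>i \<in> {..n}\<close> by auto
        then have "x \<in> cell {..n} v" "y \<in> cell {..n} v" using l(1) by auto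
        moreover have "u j (grid_point N x) i > 0 \<and> u j (grid_point N y) i \<le> 0 \<or>
            u j (grid_point N y) i > 0 \<and> u j (grid_point N x) i \<le> 0"
          using xy(3) by (auto simp: pos_ind_def split: if_splits)
        ultimately show ?thesis by blast
      qed
      then show False
        using elim(1)[rule_format, OF j v UNIV_I] by blast
    qed
    have "prisms (map up ?is) (\<phi> j) [] = 0" for j
      by (rule prisms_Nil) simp
    then have "cobd (prisms (map up ?is) (\<phi> j)) [v] = 0" for j v
      by (simp only: cobd.simps)
    then have "prisms (map up ?is) (cobd (\<phi> j)) [v] = (\<Sum>i\<in>{..n}. s i * (P i j (up i v) - P i j v))" for j v
      unfolding stokes set_is by (simp add: P_def)
    then have "0 = (\<Sum>i\<in>{..n}. s i * (P i j (up i v) - P i j v))"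
      if "j \<in> J" "v \<in> grid_box {..n} N" for j v
      using cocycle[OF that] by simp
    then have "0 = (\<Sum>j\<in>J. k j * (\<Sum>v\<in>grid_box {..n} N. \<Sum>i\<in>{..n}. s i * (P i j (up i v) - P i j v)))"
      by simp
    also have "\<dots> = (\<Sum>j\<in>J. \<Sum>i\<in>{..n}. \<Sum>v\<in>grid_box {..n} N. k j * (s i * (P i j (up i v) - P i j v)))"
      unfolding sum_distrib_left by (subst sum.swap[of _ "{..n}"]) (rule HOL.refl)
    also have "\<dots> = (\<Sum>i\<in>{..n}. \<Sum>j\<in>J. \<Sum>v\<in>grid_box {..n} N. k j * (s i * (P i j (up i v) - P i j v)))"
      by (rule sum.swap)
    also have "\<dots> = (\<Sum>i\<in>{..n}. s i * (\<Sum>j\<in>J. k j * (\<Sum>v\<in>grid_box {..n} N. P i j (up i v) - P i j v)))"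
      by (simp add: sum_distrib_left mult.left_commute)
    also have "\<dots> = (\<Sum>i\<in>{..n}. s i * (\<Sum>j\<in>J. k j * (\<Sum>v\<in>grid_box ({..n} - {i}) N.
        P i j (v(i := N)) - P i j (v(i := 0)))))"
    proof -
      have inner: "(\<Sum>v\<in>grid_box {..n} N. P i j (up i v) - P i j v) =
        (\<Sum>v\<in>grid_box ({..n} - {i}) N. P i j (v(i := N)) - P i j (v(i := 0)))" if i: "i \<in> {..n}" for i j
      proof -
      from i have "{..n} = insert i ({..n} - {i})" by auto
      then have "(\<Sum>v\<in>grid_box {..n} N. P i j (up i v) - P i j v) =
          (\<Sum>v\<in>grid_box ({..n} - {i}) N. \<Sum>m<N. P i j (up i (v(i := m))) - P i j (v(i := m)))"
        using sum_grid_box_insert[of "{..n} - {i}" i "\<lambda>v. P i j (up i v) - P i j v" N] by simp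
      also have "\<dots> = (\<Sum>v\<in>grid_box ({..n} - {i}) N. P i j (v(i := N)) - P i j (v(i := 0)))"
      proof (intro sum.cong HOL.refl)
        fix v :: "nat \<Rightarrow> nat"
        have "up i (v(i := m)) = v(i := Suc m)" for m by (auto simp: up_def)
        then show "(\<Sum>m<N. P i j (up i (v(i := m))) - P i j (v(i := m))) = P i j (v(i := N)) - P i j (v(i := 0))"
          using sum_lessThan_telescope[of "\<lambda>m. P i j (v(i := m))" N] by simp
      qed
      finally show ?thesis .
      qed
      show ?thesis
        by (intro sum.cong HOL.refl) (simp only: inner)
    qed
    also have "\<dots> = s n * (\<Sum>j\<in>J. k j * (\<Sum>v\<in>grid_box ({..n} - {n}) N. P n j (v(n := N)) - P n j (v(n := 0))))"
    proof -
      have "(\<Sum>j\<in>J. k j * (\<Sum>v\<in>grid_box ({..n} - {i}) N. P i j (v(i := N)) - P i j (v(i := 0)))) = 0"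
        if i: "i < n" for i
      proof -
        have face: "(\<Sum>j\<in>J. k j * P i j (v(i := m))) = 0"
          if v: "v \<in> grid_box ({..n} - {i}) N" and m: "m = 0 \<or> m = N" for v m
        proof -
          define b :: real where "b = real m / real N"
          have "b \<in> {0, 1}" using m elim(2) by (auto simp: b_def)
          then obtain \<iota> where bij: "bij_betw \<iota> J J" and k: "\<And>j. j \<in> J \<Longrightarrow> k (\<iota> j) = - k j"
            and eq: "\<And>j x. j \<in> J \<Longrightarrow> x \<in> unit_box \<Longrightarrow> x i = b \<Longrightarrow> f (\<iota> j) x = f j x"
            using faces[OF i] by metis
          have P: "P i (\<iota> j) (v(i := m)) = P i j (v(i := m))" if j: "j \<in> J" for j
            unfolding P_def
          proof (rule prisms_cong)
            fix l assume l: "set l \<subseteq> (\<Union>x\<in>set [v(i := m)]. cell (set (removeAll i ?is)) x)"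
            have "u (\<iota> j) (grid_point N w) = u j (grid_point N w)" if w: "w \<in> cell ({..n} - {i}) (v(i := m))" for w
            proof -
              have wi: "w i = m" using w by (auto simp: cell_def dest: spec[of _ i])
              have "w r \<le> N" for r
              proof (cases "r = i")
                case True
                then show ?thesis using wi m by auto
              next
                case False
                have "w r = v r \<or> r \<in> {..n} - {i} \<and> w r = Suc (v r)"
                  using w False by (auto simp: cell_def dest: spec[of _ r])
                moreover have "r \<in> {..n} - {i} \<Longrightarrow> v r < N" "r \<notin> {..n} - {i} \<Longrightarrow> v r = 0"
                  using v by (auto simp: grid_box_def)
                ultimately show ?thesis by (cases "r \<in> {..n} - {i}") auto
              qed
              then have "grid_point N w \<in> unit_box" using elim(2) by (intro grid_point_mem)
              then have "(grid_point N w)(n := 0) \<in> unit_box" by (auto simp: unit_box_def)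
              moreover have "((grid_point N w)(n := 0)) i = b"
                using i wi by (simp add: grid_point_def b_def)
              ultimately show ?thesis using eq[OF j] by (simp add: u_def K_def)
            qed
            moreover have "set (removeAll i ?is) = {..n} - {i}" by auto
            ultimately have agree: "\<forall>w\<in>set l. u (\<iota> j) (grid_point N w) = u j (grid_point N w)"
              using l by auto
            show "\<phi> (\<iota> j) l = \<phi> j l"
              unfolding \<phi>_def crossing_def
              by (rule cup_cong[of "set l"]) (use agree in \<open>auto simp: list_all2_conv_all_nth\<close>)
          qed (simp add: distinct_removeAll)
          have "(\<Sum>j\<in>J. k j * P i j (v(i := m))) = (\<Sum>j\<in>J. k (\<iota> j) * P i (\<iota> j) (v(i := m)))"
            using sum.reindex_bij_betw[OF bij, of "\<lambda>j. k j * P i j (v(i := m))"] by simp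
          also have "\<dots> = - (\<Sum>j\<in>J. k j * P i j (v(i := m)))"
            by (simp add: k P sum_negf[symmetric])
          finally show ?thesis by simp
        qed
        have "(\<Sum>j\<in>J. k j * (\<Sum>v\<in>grid_box ({..n} - {i}) N. P i j (v(i := N)) - P i j (v(i := 0)))) =
          (\<Sum>v\<in>grid_box ({..n} - {i}) N. (\<Sum>j\<in>J. k j * P i j (v(i := N))) - (\<Sum>j\<in>J. k j * P i j (v(i := 0))))"
          by (simp add: sum_distrib_left right_diff_distrib sum_subtractf[symmetric] sum.swap[of _ _ J])
        then show ?thesis by (simp add: face)
      qed
      moreover have "{..n} = insert n {..<n}" by auto
      ultimately show ?thesis by simp
    qed
    also have "\<dots> = s n * (\<Sum>j\<in>J. k j * - cell_count n N (\<lambda>x. y (f j x)))"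
    proof -
      have inner: "(\<Sum>v\<in>grid_box ({..n} - {n}) N. P n j (v(n := N)) - P n j (v(n := 0))) =
          - cell_count n N (\<lambda>x. y (f j x))" for j
      proof -
      have rm: "removeAll n ?is = [0..<n]" by (simp add: removeAll_id)
      have sets: "{..n} - {n} = {..<n}" by auto
      have top: "P n j (v(n := N)) = 0" for v
        unfolding P_def rm \<phi>_def
      proof (rule prisms_crossing_const[OF \<open>0 < n\<close>])
        fix w w' i assume "w \<in> cell {..<n} (v(n := N))" "w' \<in> cell {..<n} (v(n := N))"
        then have "w n = N" "w' n = N" by (auto simp: cell_def dest: spec[of _ n])
        then show "u j (grid_point N w) i = u j (grid_point N w') i"
          using elim(2) by (simp add: u_def K_def grid_point_def h1)
      qed
      have bot: "P n j (v(n := 0)) = prisms (map up [0..<n]) (crossing n N (\<lambda>x. y (f j x))) [v]"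
        if v: "v \<in> grid_box {..<n} N" for v
      proof -
        have vn: "v n = 0" using v by (auto simp: grid_box_def)
        have upd: "v(n := 0) = v" using vn by (simp add: fun_upd_idem)
        show ?thesis
          unfolding P_def rm \<phi>_def upd
        proof (rule prisms_cong)
          fix l assume l: "set l \<subseteq> (\<Union>x\<in>set [v]. cell (set [0..<n]) x)"
          have "u j (grid_point N w) = y (f j (grid_point N w))" if "w \<in> set l" for w
          proof -
            have "w \<in> cell {..<n} v" using l that by (auto simp: atLeast0LessThan)
            then have "w n = 0" unfolding cell_def mem_Collect_eq by (elim allE[of _ n]) (simp add: vn)
            then have "grid_point N w n = 0" by (simp add: grid_point_def)
            then show ?thesis by (simp add: u_def K_def h0 fun_upd_idem)
          qed
          then show "crossing n N (u j) l = crossing n N (\<lambda>x. y (f j x)) l"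
            unfolding crossing_def
            by (intro cup_cong[of "set l"]) (auto simp: list_all2_conv_all_nth)
        qed simp
      qed
      show ?thesis
        unfolding sets cell_count_def by (simp add: top bot sum_negf)
      qed
      show ?thesis by (simp only: inner)
    qed
    finally have "s n * (\<Sum>j\<in>J. k j * - cell_count n N (\<lambda>x. y (f j x))) = 0" by simp
    moreover have "s n \<noteq> 0" using s[of n] by auto
    ultimately show ?case by (simp add: sum_negf)
  qed
qed

section \<open>The length metric of a graph\<close>

lemma edge_point_mem:
  assumes "wf_digraph G" "e \<in> arcs G" "s \<in> {0..1}"
  shows "edge_point G e s \<in> realization_points G"
proof -
  interpret wf_digraph G by fact
  show ?thesis using assms by (auto simp: edge_point_def realization_points_def)
qed

lemma realization_points_cases:
  assumes "x \<in> realization_points G"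
  obtains v where "v \<in> verts G" "x = Vert v"
  | e s where "e \<in> arcs G" "0 < s" "s < 1" "x = Inner e s" "x = edge_point G e s"
  using assms by (auto simp: realization_points_def edge_point_def)

locale metric_graph =
  fixes G :: "('v, 'e) pre_digraph" and l :: "'e \<Rightarrow> real"
  assumes conn: "fin_conn_graph G" and l_nonneg: "\<And>e. e \<in> arcs G \<Longrightarrow> 0 \<le> l e"
begin

sublocale fin_digraph G
  using conn by (simp add: fin_conn_graph_def)

abbreviation "ep \<equiv> edge_point G"
abbreviation "ch \<equiv> chain_length G l"
abbreviation "d \<equiv> length_dist G l"
abbreviation "pts \<equiv> realization_points G"

lemma ep_mem: "e \<in> arcs G \<Longrightarrow> s \<in> {0..1} \<Longrightarrow> ep e s \<in> pts"
  by (rule edge_point_mem) unfold_locales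

lemma ch_nonneg: "ch x y c \<Longrightarrow> 0 \<le> c"
  by (induction rule: chain_length.induct) (auto simp: l_nonneg)

lemma ch_trans:
  assumes "ch y z c'" "ch x y c"
  shows "ch x z (c + c')"
  using assms
proof (induction rule: chain_length.induct)
  case (step y e s c' t)
  then have "ch x (ep e t) ((c + c') + l e * \<bar>s - t\<bar>)"
    by (intro chain_length.step) auto
  then show ?case by (simp add: add.assoc)
qed auto

lemma ch_edge: "e \<in> arcs G \<Longrightarrow> s \<in> {0..1} \<Longrightarrow> t \<in> {0..1} \<Longrightarrow> ch (ep e s) (ep e t) (l e * \<bar>s - t\<bar>)"
  using chain_length.step[OF chain_length.refl[OF ep_mem]] by fastforce

lemma ch_sym: "ch x y c \<Longrightarrow> ch y x c"
proof (induction rule: chain_length.induct)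
  case (step x e s c t)
  from ch_trans[OF step.IH ch_edge[of e t s]] step.hyps show ?case
    by (simp add: abs_minus_commute add.commute)
qed (auto intro: chain_length.refl)

lemma ch_exists:
  assumes "x \<in> pts" "y \<in> pts"
  shows "\<exists>c. ch x y c"
proof -
  have vert: "\<exists>c. ch (Vert u) (Vert v) c" if "u \<in> verts G" "v \<in> verts G" for u v
  proof -
    have "u \<rightarrow>\<^sup>*\<^bsub>with_proj (mk_symmetric G)\<^esub> v"
      using conn that by (auto simp: fin_conn_graph_def connected_def strongly_connected_def mk_symmetric_def)
    then have "(u, v) \<in> rtrancl_on (verts G) (arcs_ends (with_proj (mk_symmetric G)))"
      by (simp add: reachable_def mk_symmetric_def)
    then show ?thesis
    proof (induction rule: rtrancl_on.induct)
      case (rtrancl_on_refl u)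
      then show ?case by (auto intro!: exI[of _ 0] chain_length.refl simp: realization_points_def)
    next
      case (rtrancl_on_into_rtrancl_on u a b)
      then obtain c where c: "ch (Vert u) (Vert a) c" by blast
      obtain e where e: "e \<in> arcs G" "(tail G e = a \<and> head G e = b) \<or> (head G e = a \<and> tail G e = b)"
        using rtrancl_on_into_rtrancl_on.hyps(2) by (auto simp: mk_symmetric_def arcs_ends_conv)
      have "ch (Vert (tail G e)) (Vert (head G e)) (l e * \<bar>0 - 1\<bar>)"
        using ch_edge[of e 0 1] e(1) by (simp add: edge_point_def)
      then have "\<exists>c'. ch (Vert a) (Vert b) c'"
        using e(2) ch_sym by blast
      then show ?case using ch_trans[OF _ c] by blast
    qed
  qed
  have to_vert: "\<exists>v\<in>verts G. \<exists>c. ch x (Vert v) c" if "x \<in> pts" for x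
    using that
  proof (cases rule: realization_points_cases)
    case (1 v)
    then show ?thesis using that by (auto intro: chain_length.refl)
  next
    case (2 e s)
    then show ?thesis using ch_edge[of e s 0] by (auto simp: edge_point_def)
  qed
  obtain u c where u: "u \<in> verts G" "ch x (Vert u) c" using to_vert[OF assms(1)] by blast
  obtain v c' where v: "v \<in> verts G" "ch y (Vert v) c'" using to_vert[OF assms(2)] by blast
  obtain c'' where "ch (Vert u) (Vert v) c''" using vert u v by blast
  then show ?thesis using ch_trans[OF ch_sym[OF v(2)] ch_trans[OF _ u(2)]] by blast
qed

lemma d_le: "ch x y c \<Longrightarrow> d x y \<le> c"
  unfolding length_dist_def by (rule cInf_lower) (auto intro!: bdd_belowI[of _ 0] ch_nonneg)

lemma d_greatest: "x \<in> pts \<Longrightarrow> y \<in> pts \<Longrightarrow> (\<And>c. ch x y c \<Longrightarrow> b \<le> c) \<Longrightarrow> b \<le> d x y"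
  unfolding length_dist_def using ch_exists by (intro cInf_greatest) auto

lemma d_nonneg: "x \<in> pts \<Longrightarrow> y \<in> pts \<Longrightarrow> 0 \<le> d x y"
  by (rule d_greatest) (auto intro: ch_nonneg)

lemma d_refl: "x \<in> pts \<Longrightarrow> d x x = 0"
  using d_le[OF chain_length.refl] d_nonneg by force

lemma d_sym: "d x y = d y x"
proof -
  have "ch x y = ch y x" by (auto intro!: ext ch_sym)
  then show ?thesis by (simp add: length_dist_def)
qed

lemma d_approx:
  assumes "x \<in> pts" "y \<in> pts" "\<epsilon> > 0"
  obtains c where "ch x y c" "c < d x y + \<epsilon>"
proof -
  have "\<exists>c. ch x y c \<and> c < d x y + \<epsilon>"
  proof (rule ccontr)
    assume "\<nexists>c. ch x y c \<and> c < d x y + \<epsilon>"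
    then have "\<And>c. ch x y c \<Longrightarrow> d x y + \<epsilon> \<le> c" by force
    from d_greatest[OF assms(1,2) this] assms(3) show False by simp
  qed
  with that show thesis by blast
qed

lemma d_triangle:
  assumes "x \<in> pts" "y \<in> pts" "z \<in> pts"
  shows "d x z \<le> d x y + d y z"
proof (rule field_le_epsilon)
  fix \<epsilon> :: real assume "\<epsilon> > 0"
  then obtain c where c: "ch x y c" "c < d x y + \<epsilon> / 2" using d_approx[of x y "\<epsilon> / 2"] assms by auto
  obtain c' where c': "ch y z c'" "c' < d y z + \<epsilon> / 2" using d_approx[of y z "\<epsilon> / 2"] assms \<open>\<epsilon> > 0\<close> by auto
  from d_le[OF ch_trans[OF c'(1) c(1)]] c(2) c'(2) show "d x z \<le> d x y + d y z + \<epsilon>" by simp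
qed

lemma d_edge: "e \<in> arcs G \<Longrightarrow> s \<in> {0..1} \<Longrightarrow> t \<in> {0..1} \<Longrightarrow> d (ep e s) (ep e t) \<le> l e * \<bar>s - t\<bar>"
  by (rule d_le[OF ch_edge])

text \<open>
  Lower bounds of distances come from functions that do not vary faster than arc length on any
  edge.
\<close>

lemma d_lipschitz:
  assumes "x \<in> pts" "y \<in> pts"
    and lip: "\<And>e s t. e \<in> arcs G \<Longrightarrow> s \<in> {0..1} \<Longrightarrow> t \<in> {0..1} \<Longrightarrow>
      \<bar>\<phi> (ep e s) - \<phi> (ep e t)\<bar> \<le> l e * \<bar>s - t\<bar>"
  shows "\<bar>\<phi> x - \<phi> y\<bar> \<le> d x y"
proof (rule d_greatest[OF assms(1,2)])
  fix c assume "ch x y c"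
  then show "\<bar>\<phi> x - \<phi> y\<bar> \<le> c"
  proof (induction rule: chain_length.induct)
    case (step x e s c t)
    from lip[OF step.hyps(2-4)] step.IH show ?case by linarith
  qed simp
qed

end

lemma chain_length_map:
  assumes "chain_length G l x y c" "wf_digraph G'"
    and pts: "\<And>x. x \<in> realization_points G \<Longrightarrow> f x \<in> realization_points G'"
    and arc: "\<And>e. e \<in> arcs G \<Longrightarrow> \<tau> e \<in> arcs G' \<and> l' (\<tau> e) = l e"
    and edge: "\<And>e s. e \<in> arcs G \<Longrightarrow> s \<in> {0..1} \<Longrightarrow> f (edge_point G e s) = edge_point G' (\<tau> e) (\<rho> e s)"
    and \<rho>: "\<And>e s t. s \<in> {0..1} \<Longrightarrow> t \<in> {0..1} \<Longrightarrow> \<rho> e s \<in> {0..1::real} \<and> \<bar>\<rho> e s - \<rho> e t\<bar> = \<bar>s - t\<bar>"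
  shows "chain_length G' l' (f x) (f y) c"
  using assms(1)
proof (induction rule: chain_length.induct)
  case (refl x)
  then show ?case by (intro chain_length.refl pts)
next
  case (step x e s c t)
  have "chain_length G' l' (f x) (edge_point G' (\<tau> e) (\<rho> e t)) (c + l' (\<tau> e) * \<bar>\<rho> e s - \<rho> e t\<bar>)"
    by (rule chain_length.step) (use step edge arc \<rho> in auto)
  then show ?case using step.hyps edge arc \<rho> by simp
qed

text \<open>
  Applied to both a pair of points and its image, the inequality for an involution gives equality.
\<close>

lemma (in metric_graph) d_involution:
  assumes f: "\<And>x. x \<in> pts \<Longrightarrow> f x \<in> pts \<and> f (f x) = x"
    and arc: "\<And>e. e \<in> arcs G \<Longrightarrow> \<tau> e \<in> arcs G \<and> l (\<tau> e) = l e"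
    and edge: "\<And>e s. e \<in> arcs G \<Longrightarrow> s \<in> {0..1} \<Longrightarrow> f (ep e s) = ep (\<tau> e) (\<rho> e s)"
    and \<rho>: "\<And>e s t. s \<in> {0..1} \<Longrightarrow> t \<in> {0..1} \<Longrightarrow> \<rho> e s \<in> {0..1} \<and> \<bar>\<rho> e s - \<rho> e t\<bar> = \<bar>s - t\<bar>"
    and xy: "x \<in> pts" "y \<in> pts"
  shows "d (f x) (f y) = d x y"
proof -
  have "d (f x) (f y) \<le> d x y" if "x \<in> pts" "y \<in> pts" for x y
  proof (rule d_greatest[OF that])
    fix c assume "ch x y c"
    then have "ch (f x) (f y) c"
      by (rule chain_length_map[where \<tau> = \<tau> and \<rho> = \<rho>]) (use f arc edge \<rho> in \<open>auto, unfold_locales\<close>)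
    then show "d (f x) (f y) \<le> c" by (rule d_le)
  qed
  from this[of x y] this[of "f x" "f y"] f xy show ?thesis by force
qed

section \<open>Contraction\<close>

locale contraction = metric_graph G l
  for G :: "('v::wellorder, 'e) pre_digraph" and l :: "'e \<Rightarrow> real" +
  fixes F
  assumes F: "F = {e \<in> arcs G. l e = 0}"
begin

abbreviation "G' \<equiv> contract_graph G F"
abbreviation "l' \<equiv> restrict l (arcs G - F)"
abbreviation "cv \<equiv> contract_vert G F"
abbreviation "cp \<equiv> contract_point G F"

lemma arcs_G': "arcs G' = arcs G - F"
  by (simp add: contract_graph_def)

definition "R = rtrancl_on (verts G) (\<Union>e\<in>F. {(tail G e, head G e), (head G e, tail G e)})"

lemma reach_R: "v \<rightarrow>\<^sup>*\<^bsub>with_proj (mk_symmetric (G\<lparr>arcs := F\<rparr>))\<^esub> w \<longleftrightarrow> (v, w) \<in> R"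
proof -
  have "arcs_ends (with_proj (mk_symmetric (G\<lparr>arcs := F\<rparr>))) = (\<Union>e\<in>F. {(tail G e, head G e), (head G e, tail G e)})"
    by (auto simp: mk_symmetric_def arcs_ends_def arc_to_ends_def)
  then show ?thesis by (simp add: reachable_def R_def mk_symmetric_def)
qed

lemma cv_eq: "cv v = (LEAST w. (v, w) \<in> R)"
  by (simp add: contract_vert_def reach_R)

lemma R_refl: "v \<in> verts G \<Longrightarrow> (v, v) \<in> R"
  by (simp add: R_def)

lemma R_sym: "(v, w) \<in> R \<Longrightarrow> (w, v) \<in> R"
  unfolding R_def by (rule symD[OF rtrancl_on_sym]) (auto intro!: symI)

lemma R_trans: "(u, v) \<in> R \<Longrightarrow> (v, w) \<in> R \<Longrightarrow> (u, w) \<in> R"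
  unfolding R_def by (rule rtrancl_on_trans)

lemma R_edge: "e \<in> F \<Longrightarrow> (tail G e, head G e) \<in> R"
  unfolding R_def
  by (rule rtrancl_on_into_rtrancl_on[OF rtrancl_on_refl]) (auto simp: F)

lemma cv_R: "v \<in> verts G \<Longrightarrow> (v, cv v) \<in> R"
  unfolding cv_eq by (rule LeastI) (rule R_refl)

lemma cv_cong: "(v, w) \<in> R \<Longrightarrow> cv v = cv w"
  unfolding cv_eq by (metis R_sym R_trans)

lemma cv_edge: "e \<in> F \<Longrightarrow> cv (head G e) = cv (tail G e)"
  by (rule cv_cong[symmetric]) (rule R_edge)

lemma conn': "fin_conn_graph G'"
  unfolding fin_conn_graph_def
proof
  show "fin_digraph G'"
    by unfold_locales (auto simp: contract_graph_def)
  have reach: "(cv u, cv w) \<in> rtrancl_on (verts G') (arcs_ends (with_proj (mk_symmetric G')))"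
    if "u \<in> verts G" "w \<in> verts G" for u w
  proof -
    have "u \<rightarrow>\<^sup>*\<^bsub>with_proj (mk_symmetric G)\<^esub> w"
      using conn that by (auto simp: fin_conn_graph_def connected_def strongly_connected_def mk_symmetric_def)
    then have "(u, w) \<in> rtrancl_on (verts G) (arcs_ends (with_proj (mk_symmetric G)))"
      by (simp add: reachable_def mk_symmetric_def)
    then show ?thesis
    proof (induction rule: rtrancl_on.induct)
      case (rtrancl_on_refl a)
      then show ?case by (intro rtrancl_on.rtrancl_on_refl) (simp add: contract_graph_def)
    next
      case (rtrancl_on_into_rtrancl_on a b c)
      obtain e where e: "e \<in> arcs G" "(tail G e = b \<and> head G e = c) \<or> (head G e = b \<and> tail G e = c)"
        using rtrancl_on_into_rtrancl_on.hyps(2) by (auto simp: mk_symmetric_def arcs_ends_conv)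
      show ?case
      proof (cases "e \<in> F")
        case True
        then have "cv c = cv b" using e(2) cv_edge by metis
        then show ?thesis using rtrancl_on_into_rtrancl_on.IH by simp
      next
        case False
        then have "(cv b, cv c) \<in> arcs_ends (with_proj (mk_symmetric G'))"
          using e by (auto simp: mk_symmetric_def arcs_ends_conv contract_graph_def)
        with rtrancl_on_into_rtrancl_on.IH show ?thesis
          by (rule rtrancl_on.rtrancl_on_into_rtrancl_on)
             (use rtrancl_on_into_rtrancl_on.hyps(3) in \<open>simp add: contract_graph_def\<close>)
      qed
    qed
  qed
  have "verts G \<noteq> {}"
    using conn by (auto simp: fin_conn_graph_def connected_def strongly_connected_def mk_symmetric_def)
  with reach show "Digraph_Component.connected G'"
    by (auto simp: connected_def strongly_connected_def reachable_def mk_symmetric_def contract_graph_def)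
qed

sublocale C: metric_graph G' l'
  by unfold_locales (use conn' l_nonneg in \<open>auto simp: arcs_G'\<close>)

lemma cp_edge_F: "e \<in> F \<Longrightarrow> s \<in> {0..1} \<Longrightarrow> cp (ep e s) = Vert (cv (tail G e))"
  by (auto simp: edge_point_def cv_edge)

lemma cp_edge: "e \<in> arcs G - F \<Longrightarrow> cp (ep e s) = edge_point G' e s"
  by (auto simp: edge_point_def contract_graph_def)

lemma cp_mem: "x \<in> pts \<Longrightarrow> cp x \<in> C.pts"
  by (auto simp: realization_points_def contract_graph_def)

lemma R_chain: "(v, w) \<in> R \<Longrightarrow> ch (Vert v) (Vert w) 0"
  unfolding R_def
proof (induction rule: rtrancl_on.induct)
  case (rtrancl_on_refl a)
  then show ?case by (intro chain_length.refl) (auto simp: realization_points_def)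
next
  case (rtrancl_on_into_rtrancl_on a b c)
  then obtain e where e: "e \<in> F" "(b, c) = (tail G e, head G e) \<or> (b, c) = (head G e, tail G e)" by auto
  have "ch (Vert (tail G e)) (Vert (head G e)) 0"
    using ch_edge[of e 0 1] e(1) by (auto simp: F edge_point_def)
  then have "ch (Vert b) (Vert c) 0" using e(2) ch_sym by auto
  from ch_trans[OF this rtrancl_on_into_rtrancl_on.IH] show ?case by simp
qed

lemma to_vert:
  assumes "x \<in> pts" "cp x = Vert a"
  obtains u where "u \<in> verts G" "cv u = a" "ch x (Vert u) 0"
  using assms(1)
proof (cases rule: realization_points_cases)
  case (1 v)
  then show ?thesis using that assms by (auto intro: chain_length.refl)
next
  case (2 e s)
  then have "e \<in> F" using assms(2) by (auto split: if_splits)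
  have "ch (ep e s) (ep e 0) (l e * \<bar>s - 0\<bar>)"
    by (rule ch_edge) (use 2 in auto)
  moreover have "l e = 0" using \<open>e \<in> F\<close> F by simp
  ultimately have "ch x (Vert (tail G e)) 0" using 2 by (simp add: edge_point_def)
  moreover have "cv (tail G e) = a" using assms(2) 2(4) \<open>e \<in> F\<close> by simp
  ultimately show ?thesis using that 2(1) tail_in_verts by blast
qed

text \<open>
  Contracted edges have length \<open>0\<close>, so a chain in the quotient can be lifted,
  bridging its jumps within the fibres for free.
\<close>

lemma fibre_chain:
  assumes "x \<in> pts" "y \<in> pts" "cp x = cp y"
  shows "ch x y 0"
proof (cases "cp x")
  case (Vert a)
  obtain u where u: "u \<in> verts G" "cv u = a" "ch x (Vert u) 0" using to_vert[OF assms(1) Vert] .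
  obtain w where w: "w \<in> verts G" "cv w = a" "ch y (Vert w) 0" using to_vert[OF assms(2)] Vert assms(3) by metis
  have "(u, w) \<in> R"
    using cv_R[OF u(1)] cv_R[OF w(1)] u(2) w(2) R_sym R_trans by metis
  then have "ch (Vert u) (Vert w) 0" by (rule R_chain)
  from ch_trans[OF ch_sym[OF w(3)] ch_trans[OF this u(3)]] show ?thesis by simp
next
  case (Inner e s)
  then have "x = Inner e s" "y = Inner e s"
    using assms(3) by (cases x; cases y; force split: if_splits)+
  then show ?thesis using assms(1) by (auto intro: chain_length.refl)
qed

lemma chain_down: "ch x y c \<Longrightarrow> C.ch (cp x) (cp y) c"
proof (induction rule: chain_length.induct)
  case (refl x)
  then show ?case by (intro chain_length.refl cp_mem)
next
  case (step x e s c t)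
  show ?case
  proof (cases "e \<in> F")
    case True
    then have "l e = 0" by (simp add: F)
    then show ?thesis using step cp_edge_F[OF True] by simp
  next
    case False
    then have e: "e \<in> arcs G - F" using step.hyps by simp
    have "C.ch (cp x) (C.ep e s) c" using step.IH by (simp only: cp_edge[OF e])
    then have "C.ch (cp x) (C.ep e t) (c + l' e * \<bar>s - t\<bar>)"
      by (rule chain_length.step) (use step.hyps e in \<open>simp_all add: arcs_G'\<close>)
    moreover have "l' e = l e" using e by simp
    ultimately show ?thesis by (simp only: cp_edge[OF e])
  qed
qed

lemma chain_up: "C.ch X Y c \<Longrightarrow> x \<in> pts \<Longrightarrow> y \<in> pts \<Longrightarrow> cp x = X \<Longrightarrow> cp y = Y \<Longrightarrow> ch x y c"
proof (induction arbitrary: y rule: chain_length.induct)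
  case (refl X)
  then show ?case by (intro fibre_chain) auto
next
  case (step X e s c t)
  then have e: "e \<in> arcs G - F" by (simp add: arcs_G')
  have "ch x (ep e s) c"
    by (rule step.IH) (use step e in \<open>auto simp: cp_edge intro: ep_mem\<close>)
  then have "ch x (ep e t) (c + l e * \<bar>s - t\<bar>)"
    using step.hyps e by (intro chain_length.step) auto
  moreover have "ch (ep e t) y 0"
    by (rule fibre_chain) (use step e in \<open>auto simp: cp_edge intro: ep_mem\<close>)
  ultimately show ?case using ch_trans e by fastforce
qed

lemma d_contract:
  assumes "x \<in> pts" "y \<in> pts"
  shows "C.d (cp x) (cp y) = d x y"
proof -
  have "C.ch (cp x) (cp y) = ch x y"
    using chain_down chain_up assms by blast
  then show ?thesis by (simp add: length_dist_def)
qed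

end

section \<open>Continuity\<close>

lemma chain_length_scale:
  assumes "chain_length G l x y c" "\<And>e. e \<in> arcs G \<Longrightarrow> l' e \<le> M * l e"
  shows "\<exists>c'\<le>M * c. chain_length G l' x y c'"
  using assms(1)
proof (induction rule: chain_length.induct)
  case (refl x)
  then show ?case by (auto intro!: exI[of _ 0] chain_length.refl)
next
  case (step x e s c t)
  then obtain c' where c': "c' \<le> M * c" "chain_length G l' x (edge_point G e s) c'" by blast
  have "l' e * \<bar>s - t\<bar> \<le> M * l e * \<bar>s - t\<bar>"
    using assms(2)[OF step.hyps(2)] by (rule mult_right_mono) simp
  then show ?case
    using c' chain_length.step[OF c'(2) step.hyps(2-4)]
    by (intro exI[of _ "c' + l' e * \<bar>s - t\<bar>"]) (simp add: algebra_simps)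
qed

text \<open>
  The constant is the total parameter length of the chain.
\<close>

lemma chain_length_perturb:
  assumes "chain_length G l x y c"
  shows "\<exists>K\<ge>0. \<forall>l' \<eta>. (\<forall>e\<in>arcs G. l' e \<le> l e + \<eta>) \<longrightarrow> (\<exists>c'\<le>c + K * \<eta>. chain_length G l' x y c')"
  using assms
proof (induction rule: chain_length.induct)
  case (refl x)
  then show ?case by (auto intro!: exI[of _ "0::real"] chain_length.refl)
next
  case (step x e s c t)
  then obtain K where K: "K \<ge> 0" "\<And>l' \<eta>. (\<forall>e\<in>arcs G. l' e \<le> l e + \<eta>) \<Longrightarrow>
      \<exists>c'\<le>c + K * \<eta>. chain_length G l' x (edge_point G e s) c'" by blast
  have "\<exists>c'\<le>(c + l e * \<bar>s - t\<bar>) + (K + \<bar>s - t\<bar>) * \<eta>. chain_length G l' x (edge_point G e t) c'"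
    if l': "\<forall>e\<in>arcs G. l' e \<le> l e + \<eta>" for l' \<eta>
  proof -
    obtain c' where c': "c' \<le> c + K * \<eta>" "chain_length G l' x (edge_point G e s) c'"
      using K(2)[OF l'] by blast
    have "l' e * \<bar>s - t\<bar> \<le> (l e + \<eta>) * \<bar>s - t\<bar>"
      using l' step.hyps(2) by (intro mult_right_mono) auto
    then show ?thesis
      using c' chain_length.step[OF c'(2) step.hyps(2-4)]
      by (intro exI[of _ "c' + l' e * \<bar>s - t\<bar>"]) (simp add: algebra_simps)
  qed
  then show ?case using K(1) by (intro exI[of _ "K + \<bar>s - t\<bar>"]) auto
qed

text \<open>
  For the upper bound one nearly shortest chain is measured with both length functions. For the
  lower bound all chains have to be compared: since \<open>l\<close> takes finitely many values, a
  nearby \<open>l'\<close> is at least \<open>(1 - \<theta>) l\<close> on every edge, whether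
  \<open>l\<close> vanishes there or not.
\<close>

lemma length_dist_lengths_continuous:
  assumes conn: "fin_conn_graph G" and l: "\<And>e. e \<in> arcs G \<Longrightarrow> 0 \<le> l e"
    and xy: "x \<in> realization_points G" "y \<in> realization_points G" and \<epsilon>: "\<epsilon> > 0"
  shows "\<exists>\<eta>>0. \<forall>l'. (\<forall>e\<in>arcs G. 0 \<le> l' e \<and> \<bar>l' e - l e\<bar> < \<eta>) \<longrightarrow>
    \<bar>length_dist G l' x y - length_dist G l x y\<bar> \<le> \<epsilon>"
proof -
  interpret metric_graph G l by unfold_locales (use conn l in auto)
  obtain c where c: "ch x y c" "c < d x y + \<epsilon> / 2" using d_approx[OF xy, of "\<epsilon> / 2"] \<epsilon> by auto
  obtain K where K: "K \<ge> 0" "\<And>l' \<eta>. (\<forall>e\<in>arcs G. l' e \<le> l e + \<eta>) \<Longrightarrow>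
      \<exists>c'\<le>c + K * \<eta>. chain_length G l' x y c'" using chain_length_perturb[OF c(1)] by blast
  define \<theta> where "\<theta> = min (1/2) (\<epsilon> / (1 + d x y))"
  have d0: "0 \<le> d x y" by (rule d_nonneg[OF xy])
  have \<theta>: "0 < \<theta>" "\<theta> \<le> 1/2" "\<theta> * d x y \<le> \<epsilon>"
  proof -
    show "0 < \<theta>" using \<epsilon> d0 by (auto simp: \<theta>_def)
    show "\<theta> \<le> 1/2" unfolding \<theta>_def by (rule min.cobounded1)
    have "\<theta> * d x y \<le> \<epsilon> / (1 + d x y) * d x y" using d0 by (intro mult_right_mono) (auto simp: \<theta>_def)
    also have "\<dots> \<le> \<epsilon>" using \<epsilon> d0 by (simp add: field_simps)
    finally show "\<theta> * d x y \<le> \<epsilon>" .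
  qed
  define m where "m = Min (insert 1 (l ` {e \<in> arcs G. l e > 0}))"
  have "finite (insert 1 (l ` {e \<in> arcs G. l e > 0}))" by simp
  then have m: "m > 0" "\<And>e. e \<in> arcs G \<Longrightarrow> l e > 0 \<Longrightarrow> m \<le> l e"
    unfolding m_def by (subst Min_gr_iff) (auto intro: Min_le)
  define \<eta> where "\<eta> = min (\<theta> * m) (\<epsilon> / (2 * (K + 1)))"
  have \<eta>: "\<eta> > 0" "K * \<eta> \<le> \<epsilon> / 2" "\<eta> \<le> \<theta> * m"
  proof -
    show "\<eta> > 0" "\<eta> \<le> \<theta> * m" using \<theta> m(1) \<epsilon> K(1) by (auto simp: \<eta>_def)
    have "K * \<eta> \<le> K * (\<epsilon> / (2 * (K + 1)))" using K(1) by (intro mult_left_mono) (auto simp: \<eta>_def)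
    also have "\<dots> \<le> \<epsilon> / 2" using K(1) \<epsilon> by (simp add: field_simps)
    finally show "K * \<eta> \<le> \<epsilon> / 2" .
  qed
  have "\<bar>length_dist G l' x y - d x y\<bar> \<le> \<epsilon>" if l': "\<forall>e\<in>arcs G. 0 \<le> l' e \<and> \<bar>l' e - l e\<bar> < \<eta>" for l'
  proof -
    interpret L: metric_graph G l' by unfold_locales (use conn l' in auto)
    have "\<forall>e\<in>arcs G. l' e \<le> l e + \<eta>" using l' by force
    then obtain c' where "c' \<le> c + K * \<eta>" "L.ch x y c'" using K(2) by blast
    then have "L.d x y \<le> c + K * \<eta>" using L.d_le by force
    then have up: "L.d x y \<le> d x y + \<epsilon>" using c(2) \<eta>(2) by linarith
    have le: "l e \<le> (1 / (1 - \<theta>)) * l' e" if e: "e \<in> arcs G" for e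
    proof (cases "l e > 0")
      case True
      then have "\<theta> * m \<le> \<theta> * l e" using m(2)[OF e] \<theta>(1) by simp
      moreover have "l e - l' e < \<eta>" using bspec[OF l' e] by (simp add: abs_less_iff)
      ultimately have "l e - \<theta> * l e \<le> l' e" using \<eta>(3) by linarith
      then have "l e * (1 - \<theta>) \<le> l' e" by (simp add: algebra_simps)
      then show ?thesis using \<theta> by (simp add: field_simps)
    next
      case False
      then have "l e = 0" using l[OF e] by simp
      then show ?thesis using bspec[OF l' e] \<theta> by simp
    qed
    have "(1 - \<theta>) * d x y \<le> L.d x y"
    proof (rule L.d_greatest[OF xy])
      fix c assume "L.ch x y c"
      from chain_length_scale[OF this le] obtain c' where "c' \<le> (1 / (1 - \<theta>)) * c" "ch x y c'" by blast
      then have "d x y \<le> (1 / (1 - \<theta>)) * c" using d_le by force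
      then show "(1 - \<theta>) * d x y \<le> c" using \<theta> by (simp add: field_simps)
    qed
    then have "d x y - \<epsilon> \<le> L.d x y" using \<theta>(3) by (simp add: algebra_simps)
    with up show ?thesis by simp
  qed
  with \<eta>(1) show ?thesis by blast
qed

text \<open>
  Along each edge the distance from \<open>x\<close> is a Lipschitz function of the parameter.
\<close>

lemma openin_realization_ball:
  assumes "fin_conn_graph G" "x \<in> realization_points G"
  shows "openin (realization G) {z \<in> realization_points G. length_dist G (\<lambda>_. 1) x z < \<eta>}"
proof -
  interpret metric_graph G "\<lambda>_. 1" by unfold_locales (use assms in auto)
  have "openin (top_of_set {0..1}) {s \<in> {0..1}. ep e s \<in> {z \<in> pts. d x z < \<eta>}}" if e: "e \<in> arcs G" for e
  proof -
    have "\<bar>d x (ep e s) - d x (ep e t)\<bar> \<le> \<bar>s - t\<bar>" if "s \<in> {0..1}" "t \<in> {0..1}" for s t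
    proof -
      have "d x (ep e s) \<le> d x (ep e t) + d (ep e t) (ep e s)" "d x (ep e t) \<le> d x (ep e s) + d (ep e s) (ep e t)"
        by (rule d_triangle[OF assms(2) ep_mem[OF e] ep_mem[OF e]]; fact)+
      with d_edge[OF e that] d_edge[OF e that(2,1)] show ?thesis by simp
    qed
    then have "continuous_on {0..1} (\<lambda>s. d x (ep e s))"
      unfolding continuous_on_iff dist_real_def by (meson le_less_trans)
    then have "openin (top_of_set {0..1}) ({0..1} \<inter> (\<lambda>s. d x (ep e s)) -` {..<\<eta>})"
      by (rule continuous_openin_preimage_gen) auto
    moreover have "{0..1} \<inter> (\<lambda>s. d x (ep e s)) -` {..<\<eta>} = {s \<in> {0..1}. ep e s \<in> {z \<in> pts. d x z < \<eta>}}"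
      using ep_mem[OF e] by auto
    ultimately show ?thesis by simp
  qed
  then show ?thesis unfolding openin_realization by auto
qed

lemma continuous_map_realI:
  assumes "\<And>x \<epsilon>. x \<in> topspace X \<Longrightarrow> \<epsilon> > 0 \<Longrightarrow> \<exists>U. openin X U \<and> x \<in> U \<and> (\<forall>y\<in>U. \<bar>f y - f x\<bar> < \<epsilon>)"
  shows "continuous_map X euclideanreal f"
  unfolding continuous_map
proof (intro conjI allI impI)
  fix V :: "real set" assume "openin euclidean V"
  then have V: "open V" by simp
  show "openin X {x \<in> topspace X. f x \<in> V}"
  proof (subst openin_subopen, intro ballI)
    fix x assume x: "x \<in> {x \<in> topspace X. f x \<in> V}"
    then have "x \<in> topspace X" "f x \<in> V" by auto
    then obtain \<epsilon> where "\<epsilon> > 0" and ball: "ball (f x) \<epsilon> \<subseteq> V"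
      using openE[OF V] by metis
    obtain U where U: "openin X U" "x \<in> U" "\<forall>y\<in>U. \<bar>f y - f x\<bar> < \<epsilon>"
      using assms[OF \<open>x \<in> topspace X\<close> \<open>\<epsilon> > 0\<close>] by (elim exE conjE)
    have "f y \<in> V" if "y \<in> U" for y
    proof -
      have "\<bar>f y - f x\<bar> < \<epsilon>" using U(3) that by blast
      then have "f y \<in> ball (f x) \<epsilon>" by (simp add: dist_real_def abs_minus_commute)
      with ball show ?thesis ..
    qed
    then have "U \<subseteq> {x \<in> topspace X. f x \<in> V}"
      using openin_subset[OF U(1)] by auto
    with U show "\<exists>T. openin X T \<and> x \<in> T \<and> T \<subseteq> {x \<in> topspace X. f x \<in> V}"
      by (intro exI[of _ U] conjI)
  qed
qed auto

text \<open>
  The displacement of the marks is measured in the metric with all edges of length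
  \<open>1\<close>, which does not depend on \<open>l\<close>; multiplied by a common bound of the
  edge lengths, it dominates the displacement in all metrics near \<open>l\<close>.
\<close>

lemma continuous_map_length_dist:
  assumes conn: "fin_conn_graph G" and ij: "i \<in> {1..n}" "j \<in> {1..n}"
  shows "continuous_map (prod_topology (length_space G) (product_topology (\<lambda>_. realization G) {1..n}))
    euclideanreal (\<lambda>(l, p). length_dist G l (p i) (p j))"
proof (rule continuous_map_realI)
  interpret fin_digraph G using conn by (simp add: fin_conn_graph_def)
  let ?X = "prod_topology (length_space G) (product_topology (\<lambda>_. realization G) {1..n})"
  let ?pts = "realization_points G"
  fix x and \<epsilon> :: real assume x: "x \<in> topspace ?X" and \<epsilon>: "\<epsilon> > 0"
  obtain l p where [simp]: "x = (l, p)" by (cases x)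
  have top: "topspace (realization G) = ?pts" by (rule topspace_realization) unfold_locales
  have l: "\<And>e. e \<in> arcs G \<Longrightarrow> 0 \<le> l e" "l \<in> topspace (length_space G)" using x by (auto simp: length_space_def)
  have p: "p \<in> PiE {1..n} (\<lambda>_. ?pts)" using x by (simp add: top)
  then have pij: "p i \<in> ?pts" "p j \<in> ?pts" using ij by auto
  have "\<exists>\<eta>>0. \<forall>l'. (\<forall>e\<in>arcs G. 0 \<le> l' e \<and> \<bar>l' e - l e\<bar> < \<eta>) \<longrightarrow>
      \<bar>length_dist G l' (p i) (p j) - length_dist G l (p i) (p j)\<bar> \<le> \<epsilon> / 2"
    by (rule length_dist_lengths_continuous) (use conn l(1) pij \<epsilon> in auto)
  then obtain \<eta> where \<eta>: "\<eta> > 0" "\<And>l'. (\<forall>e\<in>arcs G. 0 \<le> l' e \<and> \<bar>l' e - l e\<bar> < \<eta>) \<Longrightarrow>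
      \<bar>length_dist G l' (p i) (p j) - length_dist G l (p i) (p j)\<bar> \<le> \<epsilon> / 2"
    by blast
  define M where "M = (\<Sum>e\<in>arcs G. l e) + \<eta>"
  have M: "M > 0" "\<And>l' e. (\<forall>e\<in>arcs G. 0 \<le> l' e \<and> \<bar>l' e - l e\<bar> < \<eta>) \<Longrightarrow> e \<in> arcs G \<Longrightarrow> l' e \<le> M"
  proof -
    show "M > 0" using l(1) \<eta>(1) by (auto simp: M_def intro!: add_nonneg_pos sum_nonneg)
    fix l' e assume "\<forall>e\<in>arcs G. 0 \<le> l' e \<and> \<bar>l' e - l e\<bar> < \<eta>" and e: "e \<in> arcs G"
    then have "l' e < l e + \<eta>" by force
    moreover have "l e \<le> (\<Sum>e\<in>arcs G. l e)" using e l(1) by (intro member_le_sum) auto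
    ultimately show "l' e \<le> M" by (simp add: M_def)
  qed
  define \<delta> where "\<delta> = \<epsilon> / (4 * M)"
  have \<delta>: "\<delta> > 0" "M * \<delta> = \<epsilon> / 4" using M(1) \<epsilon> by (auto simp: \<delta>_def)
  let ?B = "\<lambda>x. {z \<in> ?pts. length_dist G (\<lambda>_. 1) x z < \<delta>}"
  define UL where "UL = {l' \<in> topspace (length_space G). \<forall>e\<in>arcs G. \<bar>l' e - l e\<bar> < \<eta>}"
  define UP where "UP = {p' \<in> PiE {1..n} (\<lambda>_. ?pts). p' i \<in> ?B (p i) \<and> p' j \<in> ?B (p j)}"
  have "openin (length_space G) UL"
  proof -
    have "openin (length_space G) {l' \<in> topspace (length_space G). l' e \<in> {l e - \<eta><..<l e + \<eta>}}" if "e \<in> arcs G" for e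
    proof (rule openin_continuous_map_preimage)
      show "continuous_map (length_space G) euclideanreal (\<lambda>l'. l' e)"
        unfolding length_space_def
        by (intro continuous_map_from_subtopology continuous_map_product_projection that)
    qed auto
    moreover have "UL = topspace (length_space G) \<inter>
        (\<Inter>e\<in>arcs G. {l' \<in> topspace (length_space G). l' e \<in> {l e - \<eta><..<l e + \<eta>}})"
      by (auto simp: UL_def abs_less_iff) force+
    ultimately show ?thesis
      using openin_Int_Inter[of "(\<lambda>e. {l' \<in> topspace (length_space G). l' e \<in> {l e - \<eta><..<l e + \<eta>}}) ` arcs G"
          "length_space G" "topspace (length_space G)"] by auto
  qed
  moreover have "openin (product_topology (\<lambda>_. realization G) {1..n}) UP"
  proof -
    have "openin (product_topology (\<lambda>_. realization G) {1..n})
        {p' \<in> topspace (product_topology (\<lambda>_. realization G) {1..n}). p' k \<in> ?B (p k)}" if "k \<in> {1..n}" "p k \<in> ?pts" for k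
      by (rule openin_continuous_map_preimage[OF continuous_map_product_projection[OF that(1)]
            openin_realization_ball[OF conn that(2)]])
    from openin_Int[OF this[OF ij(1) pij(1)] this[OF ij(2) pij(2)]] show ?thesis
      by (rule back_subst[of "openin _"]) (auto simp: UP_def top)
  qed
  ultimately have "openin ?X (UL \<times> UP)" by (simp add: openin_prod_Times_iff)
  moreover have "x \<in> UL \<times> UP"
  proof -
    interpret U: metric_graph G "\<lambda>_. 1" by unfold_locales (use conn in auto)
    show ?thesis using l p pij \<eta>(1) \<delta>(1) U.d_refl by (auto simp: UL_def UP_def)
  qed
  moreover have "\<bar>length_dist G l' (p' i) (p' j) - length_dist G l (p i) (p j)\<bar> < \<epsilon>"
    if l': "l' \<in> UL" and p': "p' \<in> UP" for l' p'
  proof -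
    have near: "\<forall>e\<in>arcs G. 0 \<le> l' e \<and> \<bar>l' e - l e\<bar> < \<eta>"
      using l' by (auto simp: UL_def length_space_def)
    interpret L: metric_graph G l' by unfold_locales (use conn near in auto)
    interpret U: metric_graph G "\<lambda>_. 1" by unfold_locales (use conn in auto)
    have close: "L.d a b \<le> M * U.d a b" if ab: "a \<in> ?pts" "b \<in> ?pts" for a b
    proof -
      have "L.d a b / M \<le> U.d a b"
      proof (rule U.d_greatest[OF ab])
        fix c assume "U.ch a b c"
        from chain_length_scale[OF this, of l' M] M(2)[OF near]
        obtain c' where "c' \<le> M * c" "L.ch a b c'" by auto
        then have "L.d a b \<le> M * c" using L.d_le by force
        then show "L.d a b / M \<le> c" using M(1) by (simp add: field_simps)
      qed
      then show ?thesis using M(1) by (simp add: field_simps)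
    qed
    have q: "p' i \<in> ?pts" "p' j \<in> ?pts" "U.d (p i) (p' i) < \<delta>" "U.d (p j) (p' j) < \<delta>"
      using p' by (auto simp: UP_def)
    have "M * U.d (p i) (p' i) < M * \<delta>" "M * U.d (p j) (p' j) < M * \<delta>"
      using q M(1) by auto
    then have *: "L.d (p i) (p' i) < \<epsilon> / 4" "L.d (p j) (p' j) < \<epsilon> / 4"
      using close[OF pij(1) q(1)] close[OF pij(2) q(2)] \<delta>(2) by linarith+
    have "L.d (p' i) (p' j) \<le> L.d (p' i) (p i) + L.d (p i) (p' j)" "L.d (p i) (p' j) \<le> L.d (p i) (p j) + L.d (p j) (p' j)"
      "L.d (p i) (p j) \<le> L.d (p i) (p' i) + L.d (p' i) (p j)" "L.d (p' i) (p j) \<le> L.d (p' i) (p' j) + L.d (p' j) (p j)"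
      using L.d_triangle pij q by blast+
    then show ?thesis
      using * \<eta>(2)[OF near] L.d_sym[of "p' i" "p i"] L.d_sym[of "p' j" "p j"] by linarith
  qed
  ultimately show "\<exists>U. openin ?X U \<and> x \<in> U \<and>
      (\<forall>y\<in>U. \<bar>(case y of (l, p) \<Rightarrow> length_dist G l (p i) (p j)) - (case x of (l, p) \<Rightarrow> length_dist G l (p i) (p j))\<bar> < \<epsilon>)"
    by (intro exI[of _ "UL \<times> UP"]) auto
qed

section \<open>Stable graphs of genus two\<close>

text \<open>
  The edges are numbered, but their orientations are left open.
\<close>

definition theta_graph :: "('v, 'e) pre_digraph \<Rightarrow> 'v \<Rightarrow> 'v \<Rightarrow> (nat \<Rightarrow> 'e) \<Rightarrow> bool" where
  "theta_graph G u v e \<longleftrightarrow> verts G = {u, v} \<and> u \<noteq> v \<and> arcs G = e ` {0, 1, 2} \<and> inj_on e {0, 1, 2} \<and>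
     (\<forall>k\<in>{0, 1, 2}. {tail G (e k), head G (e k)} = {u, v})"

definition rose_graph :: "('v, 'e) pre_digraph \<Rightarrow> 'v \<Rightarrow> (nat \<Rightarrow> 'e) \<Rightarrow> bool" where
  "rose_graph G u e \<longleftrightarrow> verts G = {u} \<and> arcs G = e ` {0, 1} \<and> inj_on e {0, 1} \<and>
     (\<forall>k\<in>{0, 1}. tail G (e k) = u \<and> head G (e k) = u)"

lemma connected_single: "verts G = {u} \<Longrightarrow> Digraph_Component.connected G"
  by (auto simp: connected_def strongly_connected_def reachable_def mk_symmetric_def)

lemma connected_pair:
  assumes "verts G = {u, v}" "a \<in> arcs G" "{tail G a, head G a} = {u, v}"
  shows "Digraph_Component.connected G"
proof -
  let ?S = "with_proj (mk_symmetric G)"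
  have adj: "(u, v) \<in> arcs_ends ?S" "(v, u) \<in> arcs_ends ?S"
    using assms(2,3) by (auto simp: mk_symmetric_def arcs_ends_conv doubleton_eq_iff)
  have "(x, y) \<in> rtrancl_on {u, v} (arcs_ends ?S)" if "x \<in> {u, v}" "y \<in> {u, v}" for x y
  proof (cases "x = y")
    case True
    then show ?thesis using that by (auto intro: rtrancl_on.rtrancl_on_refl)
  next
    case False
    then have "(x, y) \<in> arcs_ends ?S" using adj that by auto
    from rtrancl_on.rtrancl_on_into_rtrancl_on[OF rtrancl_on.rtrancl_on_refl this, of "{u, v}"] that
    show ?thesis by blast
  qed
  then show ?thesis
    by (simp add: connected_def strongly_connected_def reachable_def mk_symmetric_def assms(1))
qed

lemma connected_closed:
  assumes "Digraph_Component.connected G" "S \<subseteq> verts G" "S \<noteq> {}"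
    "\<And>e. e \<in> arcs G \<Longrightarrow> tail G e \<in> S \<longleftrightarrow> head G e \<in> S"
  shows "S = verts G"
proof -
  obtain u where u: "u \<in> S" using assms(3) by blast
  have "w \<in> S" if w: "w \<in> verts G" for w
  proof -
    have "u \<rightarrow>\<^sup>*\<^bsub>with_proj (mk_symmetric G)\<^esub> w"
      using assms(1,2) w u by (auto simp: connected_def strongly_connected_def mk_symmetric_def)
    then have "(u, w) \<in> rtrancl_on (verts G) (arcs_ends (with_proj (mk_symmetric G)))"
      by (simp add: reachable_def mk_symmetric_def)
    then show ?thesis
      using u
    proof (induction rule: rtrancl_on.induct)
      case (rtrancl_on_into_rtrancl_on a b c)
      then have "b \<in> S" by blast
      moreover obtain e where "e \<in> arcs G" "(tail G e = b \<and> head G e = c) \<or> (head G e = b \<and> tail G e = c)"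
        using rtrancl_on_into_rtrancl_on.hyps(2) by (auto simp: mk_symmetric_def arcs_ends_conv)
      ultimately show ?case using assms(4) by blast
    qed
  qed
  then show ?thesis using assms(2) by blast
qed

lemma bridgeI:
  assumes "e \<in> arcs G" "S \<subseteq> verts G" "S \<noteq> {}" "S \<noteq> verts G"
    "\<And>a. a \<in> arcs G \<Longrightarrow> a \<noteq> e \<Longrightarrow> tail G a \<in> S \<longleftrightarrow> head G a \<in> S"
  shows "bridge G e"
  unfolding bridge_def
proof
  show "\<not> Digraph_Component.connected (pre_digraph.del_arc G e)"
    using connected_closed[of "pre_digraph.del_arc G e" S] assms
    by (auto simp: pre_digraph.del_arc_def)
qed fact

lemma theta_edge_cases:
  assumes "theta_graph G u v e" "k \<in> {0, 1, 2}"
  shows "tail G (e k) = u \<and> head G (e k) = v \<or> tail G (e k) = v \<and> head G (e k) = u"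
  using assms unfolding theta_graph_def by (metis doubleton_eq_iff)

lemma theta_fin_conn:
  assumes "theta_graph G u v e"
  shows "fin_conn_graph G"
  unfolding fin_conn_graph_def
proof
  show "fin_digraph G"
    by unfold_locales (use assms theta_edge_cases[OF assms] in \<open>auto simp: theta_graph_def\<close>)
  show "Digraph_Component.connected G"
    by (rule connected_pair[of G u v "e 0"]) (use assms in \<open>auto simp: theta_graph_def\<close>)
qed

lemma rose_fin_conn:
  assumes "rose_graph G u e"
  shows "fin_conn_graph G"
  unfolding fin_conn_graph_def
proof
  show "fin_digraph G"
    by unfold_locales (use assms in \<open>auto simp: rose_graph_def\<close>)
  show "Digraph_Component.connected G"
    using assms by (auto simp: rose_graph_def intro: connected_single)
qed

lemma theta_stable:
  assumes "theta_graph G u v e"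
  shows "G \<in> stable_graphs 2"
proof -
  have G: "verts G = {u, v}" "u \<noteq> v" "arcs G = e ` {0, 1, 2}" "inj_on e {0, 1, 2}"
    using assms by (auto simp: theta_graph_def)
  interpret fin_digraph G using theta_fin_conn[OF assms] by (simp add: fin_conn_graph_def)
  have card: "card (arcs G) = 3" unfolding G(3) by (subst card_image[OF G(4)]) simp
  have "\<not> bridge G a" for a
  proof
    assume br: "bridge G a"
    then have a: "a \<in> arcs G" by (simp add: bridge_def)
    have "card (arcs G - {a}) = 2" using a card by simp
    then obtain b where b: "b \<in> arcs G" "b \<noteq> a" by (metis card.empty Diff_iff ex_in_conv insertI1 zero_neq_numeral)
    then obtain k where k: "k \<in> {0, 1, 2}" "b = e k" using G(3) by (auto simp only: image_iff)
    have "{tail G b, head G b} = {u, v}" unfolding k(2) using assms k(1) by (simp only: theta_graph_def)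
    then have "Digraph_Component.connected (del_arc a)"
      using b G(1) by (intro connected_pair[of _ u v b]) auto
    with br show False by (simp add: bridge_def)
  qed
  moreover have "valency G w = 3" if "w \<in> verts G" for w
  proof -
    have "(head G a = w) = (tail G a \<noteq> w)" if "a \<in> arcs G" for a
    proof -
      from that G(3) obtain k where k: "k \<in> {0, 1, 2}" "a = e k" by (auto simp only: image_iff)
      have "tail G a = u \<and> head G a = v \<or> tail G a = v \<and> head G a = u"
        unfolding k(2) by (rule theta_edge_cases[OF assms k(1)])
      then show ?thesis using \<open>w \<in> verts G\<close> G(1,2) by auto
    qed
    then have "in_arcs G w \<union> out_arcs G w = arcs G" "in_arcs G w \<inter> out_arcs G w = {}"
      by (auto simp: in_arcs_def out_arcs_def)
    then have "card (in_arcs G w) + card (out_arcs G w) = 3"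
      using card_Un_disjoint[OF finite_in_arcs finite_out_arcs, of w w] card by simp
    then show ?thesis by (simp add: valency_def in_degree_def out_degree_def)
  qed
  ultimately show ?thesis
    using theta_fin_conn[OF assms] card G(1,2) by (simp add: stable_graphs_def stable_def genus_def)
qed

lemma rose_stable:
  assumes "rose_graph G u e"
  shows "G \<in> stable_graphs 2"
proof -
  have G: "verts G = {u}" "arcs G = e ` {0, 1}" "inj_on e {0, 1}" "tail G (e 0) = u" "head G (e 0) = u"
    using assms by (auto simp: rose_graph_def)
  have "card (arcs G) = 2" unfolding G(2) by (subst card_image[OF G(3)]) simp
  moreover have "\<not> bridge G a" for a
    using connected_single[of "pre_digraph.del_arc G a" u] G(1) by (simp add: bridge_def pre_digraph.del_arc_def)
  moreover have "\<exists>a\<in>arcs G. tail G a = w \<and> head G a = w" if "w \<in> verts G" for w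
    using that G by auto
  ultimately show ?thesis
    using rose_fin_conn[OF assms] G(1) by (simp add: stable_graphs_def stable_def genus_def)
qed

text \<open>
  An edge that is the only one to leave a vertex is a bridge, and a vertex of valency
  \<open>2\<close> carries a loop, hence is a component of its own; so in a stable graph of genus
  two all valencies are at least \<open>3\<close>. Counting edge ends then gives \<open>3 |V|
  \<le> 2 |E| = 2 |V| + 2\<close>, so there are at most two vertices. If there are two and one of
  them carries a loop, the other one is attached by a bridge.
\<close>

lemma stable_genus2_cases:
  assumes "G \<in> stable_graphs 2"
  shows "(\<exists>u v e. theta_graph G u v e) \<or> (\<exists>u e. rose_graph G u e)"
proof -
  have conn: "Digraph_Component.connected G" and "fin_digraph G"
    and nobridge: "\<And>e. \<not> bridge G e"
    and val2: "\<And>v. v \<in> verts G \<Longrightarrow> valency G v = 2 \<Longrightarrow> \<exists>e\<in>arcs G. tail G e = v \<and> head G e = v"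
    and gen: "card (arcs G) = card (verts G) + 1"
    using assms by (auto simp: stable_graphs_def stable_def genus_def fin_conn_graph_def)
  interpret fin_digraph G by fact
  have val: "valency G v = card {e \<in> arcs G. head G e = v} + card {e \<in> arcs G. tail G e = v}" for v
    by (simp add: valency_def in_degree_def out_degree_def in_arcs_def out_arcs_def)
  have ne: "verts G \<noteq> {}"
    using conn by (auto simp: connected_def strongly_connected_def mk_symmetric_def)
  have val3: "valency G v \<ge> 3" if v: "v \<in> verts G" for v
  proof (rule ccontr)
    assume le: "\<not> valency G v \<ge> 3"
    show False
    proof (cases "\<forall>e\<in>arcs G. tail G e = v \<longleftrightarrow> head G e = v")
      case True
      then have "{v} = verts G" using v by (intro connected_closed[OF conn]) auto
      then have "\<And>e. e \<in> arcs G \<Longrightarrow> head G e = v \<and> tail G e = v" "card (arcs G) = 2"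
        using gen tail_in_verts head_in_verts by (auto simp flip: \<open>{v} = verts G\<close>)
      then have "{e \<in> arcs G. head G e = v} = arcs G" "{e \<in> arcs G. tail G e = v} = arcs G" by auto
      then show False using le \<open>card (arcs G) = 2\<close> by (simp add: val)
    next
      case False
      then obtain e where e: "e \<in> arcs G" "(tail G e = v) \<noteq> (head G e = v)" by blast
      let ?I = "{e \<in> arcs G. head G e = v}" and ?O = "{e \<in> arcs G. tail G e = v}"
      have fin: "finite ?I" "finite ?O" by (rule finite_subset[OF _ finite_arcs]; blast)+
      have "\<exists>a. a \<in> arcs G \<and> a \<noteq> e \<and> (tail G a = v) \<noteq> (head G a = v)"
      proof (rule ccontr)
        assume "\<nexists>a. a \<in> arcs G \<and> a \<noteq> e \<and> (tail G a = v) \<noteq> (head G a = v)"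
        then have none: "(tail G a = v) = (head G a = v)" if "a \<in> arcs G" "a \<noteq> e" for a
          using that by blast
        have "{v} \<noteq> verts G"
          using e(2) tail_in_verts[OF e(1)] head_in_verts[OF e(1)] by (metis singletonD)
        then have "bridge G e"
          by (intro bridgeI[OF e(1), of "{v}"]) (use v none in simp_all)
        then show False using nobridge by blast
      qed
      then obtain a where a: "a \<in> arcs G" "a \<noteq> e" "(tail G a = v) \<noteq> (head G a = v)" by blast
      have sub: "{a, e} \<subseteq> ?I \<union> ?O" using a e by blast
      have "card {a, e} \<le> card (?I \<union> ?O)" using sub fin by (intro card_mono finite_UnI)
      also have "\<dots> \<le> card ?I + card ?O" by (rule card_Un_le)
      finally have "valency G v = 2" using le a(2) by (simp add: val)
      then obtain b where b: "b \<in> arcs G" "tail G b = v" "head G b = v" using val2[OF v] by blast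
      then have "b \<notin> {a, e}" using a e by blast
      have "card (?I \<union> ?O) + card (?I \<inter> ?O) = card ?I + card ?O"
        using card_Un_Int[OF fin] by simp
      moreover have "card {a, b, e} \<le> card (?I \<union> ?O)" 
        using sub b fin by (intro card_mono finite_UnI) blast+
      moreover have "card {a, b, e} = 3" using \<open>b \<notin> {a, e}\<close> a(2) by auto
      ultimately show False using le by (simp add: val)
    qed
  qed
  have head_verts: "head G ` arcs G \<subseteq> verts G" and tail_verts: "tail G ` arcs G \<subseteq> verts G"
    by (rule image_subsetI, erule head_in_verts tail_in_verts)+
  have "(\<Sum>v\<in>verts G. card {e \<in> arcs G. head G e = v}) = card (arcs G)"
    using sum.group[OF finite_arcs finite_verts head_verts, of "\<lambda>_. 1::nat"] by simp
  moreover have "(\<Sum>v\<in>verts G. card {e \<in> arcs G. tail G e = v}) = card (arcs G)"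
    using sum.group[OF finite_arcs finite_verts tail_verts, of "\<lambda>_. 1::nat"] by simp
  ultimately have "(\<Sum>v\<in>verts G. valency G v) = 2 * card (arcs G)"
    by (simp add: val sum.distrib)
  moreover have "(\<Sum>v\<in>verts G. 3) \<le> (\<Sum>v\<in>verts G. valency G v)"
    using val3 by (rule sum_mono)
  ultimately have "card (verts G) \<le> 2" using gen by simp
  moreover have "card (verts G) > 0" using ne by (simp add: card_gt_0_iff)
  ultimately consider "card (verts G) = 1" | "card (verts G) = 2" by linarith
  then show ?thesis
  proof cases
    case 1
    then obtain u where u: "verts G = {u}" by (rule card_1_singletonE)
    have "card (arcs G) = 2" using gen 1 by simp
    then obtain a b where ab: "arcs G = {a, b}" "a \<noteq> b" by (auto simp: card_2_iff)
    have "tail G x = u \<and> head G x = u" if "x \<in> arcs G" for x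
      using tail_in_verts[OF that] head_in_verts[OF that] u by simp
    then have "rose_graph G u (\<lambda>k. if k = 0 then a else b)"
      using ab u by (auto simp: rose_graph_def inj_on_def)
    then show ?thesis by blast
  next
    case 2
    then obtain u v where uv: "verts G = {u, v}" "u \<noteq> v" by (auto simp: card_2_iff)
    have card3: "card (arcs G) = 3" using gen 2 by simp
    have noloop: "tail G a \<noteq> head G a" if a: "a \<in> arcs G" for a
    proof
      assume loop: "tail G a = head G a"
      obtain y where y: "y \<in> verts G" "y \<noteq> head G a" using uv head_in_verts[OF a] by auto
      have vy: "verts G = {head G a, y}" using uv y head_in_verts[OF a] by auto
      have "card (arcs G - {a}) = 2" using a card3 by simp
      then obtain b c where bc: "arcs G - {a} = {b, c}" "b \<noteq> c" by (auto simp: card_2_iff)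
      have arcs: "arcs G = {a, b, c}" using bc a by auto
      have br: "bridge G c" if "tail G b = y" "head G b = y" "b \<in> arcs G" "c \<in> arcs G"
        "\<forall>x\<in>arcs G. x = a \<or> x = b \<or> x = c" for b c
        by (rule bridgeI[of c G "{y}"]) (use that y vy loop in auto)
      let ?I = "{e \<in> arcs G. head G e = y}" and ?O = "{e \<in> arcs G. tail G e = y}"
      have sub: "?I \<union> ?O \<subseteq> {b, c}" using arcs y loop by auto
      have "?I \<inter> ?O = {}"
        using br[of b c] br[of c b] nobridge sub arcs by blast
      then have "card ?I + card ?O = card (?I \<union> ?O)" by (simp add: card_Un_disjoint)
      also have "\<dots> \<le> card {b, c}" by (rule card_mono) (use sub in auto)
      also have "\<dots> = 2" using bc by simp
      finally show False using val3[OF y(1)] by (simp add: val)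
    qed
    have ends: "{tail G a, head G a} = {u, v}" if "a \<in> arcs G" for a
      using noloop[OF that] tail_in_verts[OF that] head_in_verts[OF that] uv by auto
    obtain a b c where abc: "arcs G = {a, b, c}" "a \<noteq> b" "a \<noteq> c" "b \<noteq> c"
      using card3 by (auto simp: card_3_iff)
    then have "theta_graph G u v (\<lambda>k. if k = 0 then a else if k = 1 then b else c)"
      using uv ends by (auto simp: theta_graph_def inj_on_def)
    then show ?thesis by blast
  qed
qed

section \<open>The theta metric\<close>

definition len :: "real \<Rightarrow> nat \<Rightarrow> real" where "len c k = (if k = 2 then c else 1)"

text \<open>
  Distances to the two vertices of the theta graph; the second route passes through the opposite
  vertex and the short edge.
\<close>

definition to_u :: "real \<Rightarrow> nat \<Rightarrow> real \<Rightarrow> real" where "to_u c k t = min t (len c k - t + c)"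
definition to_v :: "real \<Rightarrow> nat \<Rightarrow> real \<Rightarrow> real" where "to_v c k t = min (len c k - t) (t + c)"

text \<open>
  A path between two points runs within an edge or passes through a vertex. Passing through both
  vertices is taken into account by \<open>to_u\<close> and \<open>to_v\<close>.
\<close>

definition theta_dist :: "real \<Rightarrow> nat \<Rightarrow> real \<Rightarrow> nat \<Rightarrow> real \<Rightarrow> real" where
  "theta_dist c k t k' t' =
     (let m = min (to_u c k t + to_u c k' t') (to_v c k t + to_v c k' t')
      in if k = k' then min m \<bar>t - t'\<bar> else m)"

lemmas theta_dist_defs = theta_dist_def Let_def to_u_def to_v_def

lemma theta_dist_0:
  assumes "0 \<le> c" "c \<le> 1" "0 \<le> t" "t \<le> len c k"
  shows "theta_dist c k t k' 0 = to_u c k t" "theta_dist c k t k' (len c k') = to_v c k t"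
  using assms by (auto simp: theta_dist_defs len_def min_def abs_if split: if_splits)

lemma theta_dist_self:
  assumes "0 \<le> c" "0 \<le> t" "t \<le> len c k"
  shows "theta_dist c k t k t = 0"
  using assms by (auto simp: theta_dist_defs min_def)

lemma min_lipschitz:
  fixes a b :: real
  shows "\<bar>a - a'\<bar> \<le> r \<Longrightarrow> \<bar>b - b'\<bar> \<le> r \<Longrightarrow> \<bar>min a b - min a' b'\<bar> \<le> r"
  by (linarith | smt (verit))

lemma theta_dist_lipschitz: "\<bar>theta_dist c k t k' t1 - theta_dist c k t k' t2\<bar> \<le> \<bar>t1 - t2\<bar>"
proof -
  have u: "\<bar>to_u c k' t1 - to_u c k' t2\<bar> \<le> \<bar>t1 - t2\<bar>" and v: "\<bar>to_v c k' t1 - to_v c k' t2\<bar> \<le> \<bar>t1 - t2\<bar>"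
    unfolding to_u_def to_v_def by (intro min_lipschitz; simp)+
  have m: "\<bar>min (to_u c k t + to_u c k' t1) (to_v c k t + to_v c k' t1) -
    min (to_u c k t + to_u c k' t2) (to_v c k t + to_v c k' t2)\<bar> \<le> \<bar>t1 - t2\<bar>"
    by (intro min_lipschitz) (use u v in simp_all)
  show ?thesis
  proof (cases "k = k'")
    case True
    have "\<bar>\<bar>t - t1\<bar> - \<bar>t - t2\<bar>\<bar> \<le> \<bar>t1 - t2\<bar>" by linarith
    from min_lipschitz[OF m this] True show ?thesis by (simp add: theta_dist_def Let_def)
  next
    case False
    then show ?thesis using m by (simp add: theta_dist_def Let_def)
  qed
qed

text \<open>
  The symmetry of the theta graph that interchanges its vertices.
\<close>

lemma theta_dist_flip:
  "theta_dist c k (len c k - t) k' (len c k' - t') = theta_dist c k t k' t'"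
proof -
  have "to_u c k (len c k - t) = to_v c k t" "to_v c k (len c k - t) = to_u c k t" for k t
    by (simp_all add: to_u_def to_v_def)
  then show ?thesis
    by (cases "k = k'") (simp_all add: theta_dist_def min.commute Let_def abs_minus_commute)
qed

text \<open>
  Explicit paths bound the distance from above; it is bounded from below because the formula, with
  one point fixed, defines a Lipschitz function on the graph. The Boolean \<open>r k\<close> tells
  whether the edge \<open>e k\<close> is parametrized from \<open>b\<close> to \<open>a\<close>.
  Besides the theta graph with \<open>K = {0, 1, 2}\<close>, the statement covers the rose, with
  \<open>K = {0, 1}\<close>, \<open>a = b\<close> and \<open>c = 0\<close>.
\<close>

lemma (in metric_graph) dist_eq_theta_dist:
  fixes e :: "nat \<Rightarrow> 'e" and r :: "nat \<Rightarrow> bool"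
  defines "pt \<equiv> \<lambda>k s. ep (e k) (if r k then 1 - s else s)"
  assumes arcs: "arcs G = e ` K" and inj: "inj_on e K"
    and c: "0 \<le> c" "c \<le> 1" and l: "\<And>k. k \<in> K \<Longrightarrow> l (e k) = len c k"
    and ends: "\<And>k. k \<in> K \<Longrightarrow> pt k 0 = Vert a \<and> pt k 1 = Vert b"
    and ab: "d (Vert a) (Vert b) \<le> c" and eq: "a = b \<Longrightarrow> c = 0"
    and k: "k \<in> K" "k' \<in> K" and s: "s \<in> {0..1}" "s' \<in> {0..1}"
  shows "d (pt k s) (pt k' s') = theta_dist c k (len c k * s) k' (len c k' * s')"
proof -
  have pt_mem: "pt i q \<in> pts" if "i \<in> K" "q \<in> {0..1}" for i q
    unfolding pt_def using that arcs by (intro ep_mem) auto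
  have ab_mem: "Vert a \<in> pts" "Vert b \<in> pts"
    using pt_mem[OF k(1), of 0] pt_mem[OF k(1), of 1] ends[OF k(1)] by auto
  have pt_edge: "d (pt i q) (pt i q') \<le> len c i * \<bar>q - q'\<bar>"
    if "i \<in> K" "q \<in> {0..1}" "q' \<in> {0..1}" for i q q'
  proof -
    have "d (pt i q) (pt i q') \<le> l (e i) * \<bar>(if r i then 1 - q else q) - (if r i then 1 - q' else q')\<bar>"
      unfolding pt_def by (rule d_edge) (use that arcs in auto)
    also have "\<bar>(if r i then 1 - q else q) - (if r i then 1 - q' else q')\<bar> = \<bar>q - q'\<bar>" by auto
    finally show ?thesis by (simp only: l[OF that(1)])
  qed
  have range: "0 \<le> len c i * q" "len c i * q \<le> len c i" if "q \<in> {0..1}" for i q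
    using that c by (auto simp: len_def intro: mult_left_le)
  have to_u: "d (pt i q) (Vert a) \<le> to_u c i (len c i * q)" and to_v: "d (pt i q) (Vert b) \<le> to_v c i (len c i * q)"
    if i: "i \<in> K" and q: "q \<in> {0..1}" for i q
  proof -
    have u: "d (pt i q) (Vert a) \<le> len c i * q" using pt_edge[OF i q, of 0] ends[OF i] q by simp
    have v: "d (pt i q) (Vert b) \<le> len c i - len c i * q"
      using pt_edge[OF i q, of 1] ends[OF i] q by (simp add: algebra_simps)
    have "d (pt i q) (Vert a) \<le> d (pt i q) (Vert b) + d (Vert b) (Vert a)"
      "d (pt i q) (Vert b) \<le> d (pt i q) (Vert a) + d (Vert a) (Vert b)"
      by (rule d_triangle; use pt_mem[OF i q] ab_mem in simp)+
    then show "d (pt i q) (Vert a) \<le> to_u c i (len c i * q)" "d (pt i q) (Vert b) \<le> to_v c i (len c i * q)"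
      using u v ab d_sym[of "Vert b" "Vert a"] by (simp_all add: to_u_def to_v_def)
  qed
  show ?thesis
  proof (rule antisym)
    have "d (pt k s) (pt k' s') \<le> d (pt k s) (Vert a) + d (Vert a) (pt k' s')"
      "d (pt k s) (pt k' s') \<le> d (pt k s) (Vert b) + d (Vert b) (pt k' s')"
      by (rule d_triangle; use pt_mem k s ab_mem in simp)+
    then have "d (pt k s) (pt k' s') \<le> to_u c k (len c k * s) + to_u c k' (len c k' * s')"
      "d (pt k s) (pt k' s') \<le> to_v c k (len c k * s) + to_v c k' (len c k' * s')"
      using to_u[OF k(1) s(1)] to_u[OF k(2) s(2)] to_v[OF k(1) s(1)] to_v[OF k(2) s(2)]
        d_sym[of "Vert a" "pt k' s'"] d_sym[of "Vert b" "pt k' s'"] by linarith+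
    moreover have "d (pt k s) (pt k' s') \<le> \<bar>len c k * s - len c k' * s'\<bar>" if "k = k'"
    proof -
      have "len c k \<ge> 0" using c by (simp add: len_def)
      then have "len c k * \<bar>s - s'\<bar> = \<bar>len c k * s - len c k * s'\<bar>"
        by (simp add: right_diff_distrib[symmetric] abs_mult)
      with pt_edge[OF k(1) s] that show ?thesis by simp
    qed
    ultimately show "d (pt k s) (pt k' s') \<le> theta_dist c k (len c k * s) k' (len c k' * s')"
      unfolding theta_dist_def Let_def by (simp only: min.bounded_iff split: if_split) blast
  next
    let ?t = "len c k * s"
    define \<phi> where "\<phi> = (\<lambda>z. case z of Vert x \<Rightarrow> if x = a then to_u c k ?t else to_v c k ?t
      | Inner y q \<Rightarrow> (let i = the_inv_into K e y in
           theta_dist c k ?t i (len c i * (if r i then 1 - q else q))))"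
    have \<phi>: "\<phi> (pt i q) = theta_dist c k ?t i (len c i * q)" if i: "i \<in> K" and q: "q \<in> {0..1}" for i q
    proof -
      consider "q = 0" | "q = 1" | "0 < q" "q < 1" using q by fastforce
      then show ?thesis
      proof cases
        case 1
        then show ?thesis using ends[OF i] theta_dist_0(1)[OF c range[OF s(1), of k]] by (simp add: \<phi>_def)
      next
        case 2
        have "a = b \<Longrightarrow> to_u c k ?t = to_v c k ?t"
          using eq by (simp add: to_u_def to_v_def min.commute)
        then show ?thesis
          using 2 ends[OF i] theta_dist_0(2)[OF c range[OF s(1), of k], of i] by (auto simp: \<phi>_def)
      next
        case 3
        have "pt i q = Inner (e i) (if r i then 1 - q else q)"
          using 3 by (auto simp: pt_def edge_point_def)
        then show ?thesis using the_inv_into_f_f[OF inj i] by (simp add: \<phi>_def Let_def)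
      qed
    qed
    have "\<bar>\<phi> (pt k s) - \<phi> (pt k' s')\<bar> \<le> d (pt k s) (pt k' s')"
    proof (rule d_lipschitz)
      fix y q q' assume y: "y \<in> arcs G" and q: "q \<in> {0..1::real}" "q' \<in> {0..1::real}"
      then obtain i where i: "i \<in> K" "y = e i" using arcs by auto
      let ?f = "\<lambda>q. if r i then 1 - q else q"
      have "ep y q = pt i (?f q)" "ep y q' = pt i (?f q')" by (auto simp: pt_def i(2))
      moreover have "?f q \<in> {0..1}" "?f q' \<in> {0..1}" using q by auto
      ultimately have "\<bar>\<phi> (ep y q) - \<phi> (ep y q')\<bar> \<le> \<bar>len c i * ?f q - len c i * ?f q'\<bar>"
        using \<phi>[OF i(1)] theta_dist_lipschitz by simp
      also have "\<dots> = len c i * \<bar>?f q - ?f q'\<bar>"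
        using c by (simp add: right_diff_distrib[symmetric] abs_mult len_def)
      also have "\<bar>?f q - ?f q'\<bar> = \<bar>q - q'\<bar>" by auto
      also have "len c i * \<bar>q - q'\<bar> = l y * \<bar>q - q'\<bar>" by (simp only: i(2) l[OF i(1)])
      finally show "\<bar>\<phi> (ep y q) - \<phi> (ep y q')\<bar> \<le> l y * \<bar>q - q'\<bar>" .
    qed (use pt_mem k s in auto)
    moreover have "\<phi> (pt k s) = 0"
      using \<phi>[OF k(1) s(1)] theta_dist_self[OF c(1) range[OF s(1)]] by simp
    ultimately show "theta_dist c k (len c k * s) k' (len c k' * s') \<le> d (pt k s) (pt k' s')"
      using \<phi>[OF k(2) s(2)] by linarith
  qed
qed

section \<open>The topology of the moduli space\<close>

lemma (in contraction) cv_empty: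
  assumes "F = {}" "w \<in> verts G"
  shows "cv w = w"
proof -
  have "x = w" if "(w, x) \<in> R" for x
  proof -
    have "(w, x) \<in> rtrancl_on (verts G) (\<Union>e\<in>F. {(tail G e, head G e), (head G e, tail G e)})"
      using that unfolding R_def .
    then have "(w, x) \<in> rtrancl_on (verts G) {}" using assms(1) by simp
    then show ?thesis by (induction rule: rtrancl_on.induct) auto
  qed
  then have "(w, x) \<in> R \<longleftrightarrow> x = w" for x using R_refl[OF assms(2)] by blast
  then show ?thesis unfolding cv_eq by (auto intro: Least_equality)
qed

lemma theta_graphD:
  assumes "theta_graph G u v e"
  shows "verts G = {u, v}" "u \<noteq> v" "arcs G = e ` {0, 1, 2}" "inj_on e {0, 1, 2}"
  using assms unfolding theta_graph_def by blast+

lemma theta_ends: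
  assumes "theta_graph G u v e" "k \<in> {0, 1, 2}"
  shows "{tail G (e k), head G (e k)} = {u, v}"
  using assms unfolding theta_graph_def by blast

lemma theta_forest:
  assumes "theta_graph G u v e" "forest_edges G F" "j \<in> {0,1,2}" "k \<in> {0,1,2}" "e j \<in> F" "e k \<in> F"
  shows "j = k"
proof (rule ccontr)
  assume "j \<noteq> k"
  then have "e j \<noteq> e k" using inj_onD[OF theta_graphD(4)[OF assms(1)], of j k] assms(3,4) by blast
  note ends = theta_ends[OF assms(1,3)] theta_ends[OF assms(1,4)] theta_graphD(2)[OF assms(1)]
  have "undirected_cycle G [u, v] [e j, e k]"
    using ends \<open>e j \<noteq> e k\<close> assms(2,5,6)
    by (auto simp: undirected_cycle_def forest_edges_def less_Suc_eq numeral_2_eq_2 insert_commute)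
  then show False using assms(2,5,6) unfolding forest_edges_def by fastforce
qed

lemma rose_forest:
  assumes "rose_graph G u e" "forest_edges G F"
  shows "F = {}"
proof (rule ccontr)
  assume "F \<noteq> {}"
  then obtain x where x: "x \<in> F" by blast
  then have "x \<in> arcs G" using assms(2) by (auto simp: forest_edges_def)
  then have "tail G x = u \<and> head G x = u" using assms(1) by (auto simp: rose_graph_def)
  then have "undirected_cycle G [u] [x]"
    using \<open>x \<in> arcs G\<close> by (auto simp: undirected_cycle_def)
  then show False using assms(2) x unfolding forest_edges_def by fastforce
qed

lemma theta_single_forest:
  assumes "theta_graph G u v e" "k \<in> {0,1,2}" "F \<subseteq> {e k}"
  shows "forest_edges G F"
  unfolding forest_edges_def
proof (intro conjI notI)
  show "F \<subseteq> arcs G" using theta_graphD(3)[OF assms(1)] assms(2,3) by blast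
  assume "\<exists>vs es. undirected_cycle G vs es \<and> set es \<subseteq> F"
  then obtain vs es where cyc: "undirected_cycle G vs es" "set es \<subseteq> {e k}" using assms(3) by blast
  then have "length es = card (set es)" by (simp add: undirected_cycle_def distinct_card)
  also have "\<dots> \<le> 1" using card_mono[OF _ cyc(2)] by simp
  finally have "length es = 1" using cyc(1) by (cases es) (auto simp: undirected_cycle_def)
  then obtain a w where "es = [a]" "vs = [w]"
    using cyc(1) by (auto simp: undirected_cycle_def length_Suc_conv)
  then have "{tail G (e k), head G (e k)} = {w}"
    using cyc by (auto simp: undirected_cycle_def)
  then show False
    using theta_ends[OF assms(1,2)] theta_graphD(2)[OF assms(1)] by auto
qed

lemma theta_permute:
  assumes "theta_graph G u v e" "bij_betw \<pi> {0,1,2} {0,1,2}"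
  shows "theta_graph G u v (e \<circ> \<pi>)"
  unfolding theta_graph_def
proof (intro conjI ballI)
  have im: "\<pi> ` {0,1,2} = {0,1,2}" and inj: "inj_on \<pi> {0,1,2}"
    using assms(2) by (simp_all add: bij_betw_def)
  show "arcs G = (e \<circ> \<pi>) ` {0,1,2}"
    unfolding image_comp[symmetric] im by (rule theta_graphD(3)[OF assms(1)])
  show "inj_on (e \<circ> \<pi>) {0,1,2}"
    by (rule comp_inj_on[OF inj]) (simp only: im theta_graphD(4)[OF assms(1)])
  show "{tail G ((e \<circ> \<pi>) k), head G ((e \<circ> \<pi>) k)} = {u, v}" if "k \<in> {0,1,2}" for k
    using theta_ends[OF assms(1), of "\<pi> k"] that im by auto
qed (use theta_graphD[OF assms(1)] in blast)+

lemma contract_theta_empty: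
  assumes "theta_graph G u v e" "contraction G l {}"
  shows "theta_graph (contract_graph G {}) u v e"
proof -
  interpret contraction G l "{}" by fact
  have "cv u = u" "cv v = v" using cv_empty[OF HOL.refl] theta_graphD(1)[OF assms(1)] by simp_all
  moreover note theta_graphD[OF assms(1)]
  moreover have "{cv (tail G (e k)), cv (head G (e k))} = {u, v}" if "k \<in> {0,1,2}" for k
    using theta_edge_cases[OF assms(1) that] \<open>cv u = u\<close> \<open>cv v = v\<close> by auto
  ultimately show ?thesis
    by (simp add: theta_graph_def contract_graph_def)
qed

lemma contract_theta_edge:
  assumes "theta_graph G u v e" "contraction G l {e 2}"
  shows "rose_graph (contract_graph G {e 2}) (contract_vert G {e 2} u) e"
proof -
  interpret contraction G l "{e 2}" by fact
  have cv: "cv v = cv u"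
    using cv_edge[of "e 2"] theta_edge_cases[OF assms(1), of 2] by auto
  note G = theta_graphD(1,3,4)[OF assms(1)]
  have "e ` {0,1,2} - {e 2} = e ` {0,1}"
    using G(3) by (auto simp: inj_on_def)
  moreover have "cv (tail G (e k)) = cv u \<and> cv (head G (e k)) = cv u" if "k \<in> {0,1}" for k
    using theta_edge_cases[OF assms(1), of k] that cv by auto
  moreover have "inj_on e {0,1}" using G(3) by (rule inj_on_subset) auto
  ultimately show ?thesis
    using G cv by (simp add: rose_graph_def contract_graph_def)
qed

lemma contract_rose:
  assumes "rose_graph G u e" "contraction G l {}"
  shows "rose_graph (contract_graph G {}) u e"
proof -
  interpret contraction G l "{}" by fact
  have "cv u = u" using cv_empty[OF HOL.refl] assms(1) by (auto simp: rose_graph_def)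
  then show ?thesis using assms(1) by (auto simp: rose_graph_def contract_graph_def)
qed

lemma swap2_bij: "k \<in> {0,1,2} \<Longrightarrow> bij_betw (Transposition.transpose k 2) {0,1,2::nat} {0,1,2}"
  by (auto simp: bij_betw_def inj_on_def Transposition.transpose_def)

lemma contract_stable:
  assumes "G \<in> stable_graphs 2" "contraction G l F" "forest_edges G F"
  shows "contract_graph G F \<in> stable_graphs 2"
  using stable_genus2_cases[OF assms(1)]
proof
  assume "\<exists>u v e. theta_graph G u v e"
  then obtain u v e where th: "theta_graph G u v e" by blast
  show ?thesis
  proof (cases "F = {}")
    case True
    then show ?thesis using contract_theta_empty[OF th] assms(2) theta_stable by blast
  next
    case False
    then obtain x where "x \<in> F" by blast
    moreover have "F \<subseteq> e ` {0,1,2}"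
      using assms(3) theta_graphD(3)[OF th] by (simp add: forest_edges_def)
    ultimately obtain k where k: "k \<in> {0,1,2}" "e k \<in> F" by blast
    have "F = {e k}"
      using theta_forest[OF th assms(3) _ k(1) _ k(2)] \<open>F \<subseteq> e ` {0,1,2}\<close> k(2) by blast
    define e' where "e' = e \<circ> Transposition.transpose k 2"
    have th': "theta_graph G u v e'"
      unfolding e'_def by (rule theta_permute[OF th swap2_bij[OF k(1)]])
    have "F = {e' 2}" using \<open>F = {e k}\<close> by (simp add: e'_def)
    then show ?thesis using contract_theta_edge[OF th'] assms(2) rose_stable by blast
  qed
next
  assume "\<exists>u e. rose_graph G u e"
  then obtain u e where ro: "rose_graph G u e" by blast
  have "F = {}" by (rule rose_forest[OF ro assms(3)])
  then show ?thesis using contract_rose[OF ro] assms(2) rose_stable by blast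
qed

lemma parameter_spaceD:
  assumes "(G, l, p) \<in> topspace (parameter_space 2 n)"
  shows "G \<in> stable_graphs 2" "contraction G l {e \<in> arcs G. l e = 0}" "forest_edges G {e \<in> arcs G. l e = 0}"
    "p \<in> PiE {1..n} (\<lambda>_. realization_points G)"
proof -
  have mem: "G \<in> stable_graphs 2" "l \<in> topspace (length_space G)"
    "p \<in> topspace (product_topology (\<lambda>_. realization G) {1..n})"
    using assms by (auto simp: parameter_space_def)
  then show "G \<in> stable_graphs 2" by simp
  have fc: "fin_conn_graph G" using mem(1) by (simp add: stable_graphs_def)
  then have "topspace (realization G) = realization_points G"
    by (intro topspace_realization) (simp add: fin_conn_graph_def)
  then show "p \<in> PiE {1..n} (\<lambda>_. realization_points G)" using mem(3) by simp
  have "\<forall>e\<in>arcs G. 0 \<le> l e" "forest_edges G {e \<in> arcs G. l e = 0}"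
    using mem(2) by (auto simp: length_space_def)
  then show "contraction G l {e \<in> arcs G. l e = 0}" "forest_edges G {e \<in> arcs G. l e = 0}"
    using fc by (auto simp: contraction_def contraction_axioms_def metric_graph_def)
qed

lemma contract_marked_mem:
  assumes "(G, l, p) \<in> topspace (parameter_space 2 n)"
  shows "contract_marked n (G, l, p) \<in> marked_graphs 2 n"
proof -
  define F where "F = {e \<in> arcs G. l e = 0}"
  note P = parameter_spaceD[OF assms, folded F_def]
  interpret contraction G l F by (rule P(2))
  have "G' \<in> stable_graphs 2" by (rule contract_stable[OF P(1-3)])
  moreover have "l' \<in> arcs G' \<rightarrow>\<^sub>E {0<..}"
  proof
    fix a assume "a \<in> arcs G'"
    then have "a \<in> arcs G" "a \<notin> F" by (auto simp: arcs_G')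
    then have "l a > 0" using l_nonneg[of a] by (auto simp: F_def less_le)
    then show "l' a \<in> {0<..}" using \<open>a \<in> arcs G\<close> \<open>a \<notin> F\<close> by simp
  qed (auto simp: arcs_G')
  moreover have "restrict (\<lambda>i. cp (p i)) {1..n} \<in> {1..n} \<rightarrow>\<^sub>E C.pts"
    using P(4) by (auto intro!: cp_mem)
  ultimately show ?thesis
    by (simp add: contract_marked_def Let_def F_def[symmetric] marked_graphs_def)
qed

text \<open>
  Isometries preserve distances between marks, hence any representative of the class may be
  chosen.
\<close>

definition mark_dist :: "nat \<Rightarrow> nat \<Rightarrow> marked_graph set \<Rightarrow> real" where
  "mark_dist i j C = (case SOME M. M \<in> C of (G, l, p) \<Rightarrow> length_dist G l (p i) (p j))"

lemma mark_dist_class: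
  assumes "(G, l, p) \<in> marked_graphs g n" "i \<in> {1..n}" "j \<in> {1..n}"
  shows "mark_dist i j (isometry_rel g n `` {(G, l, p)}) = length_dist G l (p i) (p j)"
proof -
  let ?C = "isometry_rel g n `` {(G, l, p)}"
  have "(G, l, p) \<in> ?C" using equiv_class_self[OF equiv_isometry_rel assms(1)] .
  then have "(SOME M. M \<in> ?C) \<in> ?C" by (rule someI[of "\<lambda>M. M \<in> ?C"])
  then obtain G1 l1 p1 f where 1: "(SOME M. M \<in> ?C) = (G1, l1, p1)" "marked_isometry n (G, l, p) (G1, l1, p1) f"
    by (cases "SOME M. M \<in> ?C") (auto simp: isometry_rel_def)
  have "p i \<in> realization_points G" "p j \<in> realization_points G"
    using assms by (auto simp: marked_graphs_def)
  then have "length_dist G1 l1 (p1 i) (p1 j) = length_dist G l (p i) (p j)"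
    using 1(2) assms(2,3) unfolding marked_isometry_def by fastforce
  then show ?thesis by (simp only: mark_dist_def 1(1) prod.case)
qed

lemma mark_dist_contract:
  assumes "(G, l, p) \<in> topspace (parameter_space 2 n)" "i \<in> {1..n}" "j \<in> {1..n}"
  shows "mark_dist i j (isometry_rel 2 n `` {contract_marked n (G, l, p)}) = length_dist G l (p i) (p j)"
proof -
  define F where "F = {e \<in> arcs G. l e = 0}"
  note P = parameter_spaceD[OF assms(1), folded F_def]
  interpret contraction G l F by (rule P(2))
  have eq: "contract_marked n (G, l, p) = (G', l', restrict (\<lambda>i. cp (p i)) {1..n})"
    by (simp add: contract_marked_def Let_def F_def)
  have "mark_dist i j (isometry_rel 2 n `` {contract_marked n (G, l, p)}) = C.d (cp (p i)) (cp (p j))"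
    using mark_dist_class[OF contract_marked_mem[OF assms(1), unfolded eq] assms(2,3)] assms(2,3)
    by (simp add: eq)
  also have "\<dots> = d (p i) (p j)"
    by (rule d_contract) (use P(4) assms(2,3) in auto)
  finally show ?thesis .
qed

abbreviation "moduli_class n M \<equiv> isometry_rel 2 n `` {contract_marked n M}"

lemma moduli_class_mem:
  "M \<in> topspace (parameter_space 2 n) \<Longrightarrow> moduli_class n M \<in> marked_graphs 2 n // isometry_rel 2 n"
  using contract_marked_mem by (cases M) (auto intro: quotientI)

lemma topspace_TMb: "topspace (TMb 2 n) = marked_graphs 2 n // isometry_rel 2 n"
proof
  show "topspace (TMb 2 n) \<subseteq> marked_graphs 2 n // isometry_rel 2 n"
    by (auto simp: TMb_def topspace_def openin_final_topology)
  have "{M \<in> topspace (parameter_space 2 n). moduli_class n M \<in> marked_graphs 2 n // isometry_rel 2 n}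
      = topspace (parameter_space 2 n)"
    using moduli_class_mem by blast
  then have "openin (TMb 2 n) (marked_graphs 2 n // isometry_rel 2 n)"
    by (simp add: TMb_def openin_final_topology)
  then show "marked_graphs 2 n // isometry_rel 2 n \<subseteq> topspace (TMb 2 n)"
    by (rule openin_subset)
qed

lemma continuous_map_into_TMb:
  assumes g: "continuous_map Y (parameter_space 2 n) g"
  shows "continuous_map Y (TMb 2 n) (\<lambda>x. moduli_class n (g x))"
  unfolding continuous_map
proof (intro conjI allI impI)
  have top: "g x \<in> topspace (parameter_space 2 n)" if "x \<in> topspace Y" for x
    using continuous_map_image_subset_topspace[OF g] that by blast
  then show "(\<lambda>x. moduli_class n (g x)) ` topspace Y \<subseteq> topspace (TMb 2 n)"
    unfolding topspace_TMb using moduli_class_mem by blast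
  fix U assume "openin (TMb 2 n) U"
  then have "openin (parameter_space 2 n) {M \<in> topspace (parameter_space 2 n). moduli_class n M \<in> U}"
    by (simp add: TMb_def openin_final_topology)
  from openin_continuous_map_preimage[OF g this]
  show "openin Y {x \<in> topspace Y. moduli_class n (g x) \<in> U}"
    by (rule back_subst[of "openin Y"]) (use top in auto)
qed

text \<open>
  Contraction preserves distances, so continuity on the quotient can be checked on the parameter
  spaces of the uncontracted graphs.
\<close>

lemma continuous_map_mark_dist:
  assumes "i \<in> {1..n}" "j \<in> {1..n}"
  shows "continuous_map (TMb 2 n) euclideanreal (mark_dist i j)"
  unfolding continuous_map
proof (intro conjI allI impI)
  fix V :: "real set" assume V: "openin euclidean V"
  let ?A = "marked_graphs 2 n // isometry_rel 2 n"
  define W where "W = {M \<in> topspace (parameter_space 2 n). moduli_class n M \<in> {x \<in> ?A. mark_dist i j x \<in> V}}"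
  let ?P = "\<lambda>G. prod_topology (length_space G) (product_topology (\<lambda>_. realization G) {1..n})"
  have "openin (sum_topology ?P (stable_graphs 2)) W"
    unfolding openin_sum_topology
  proof (intro conjI ballI)
    have "W \<subseteq> topspace (parameter_space 2 n)" unfolding W_def by (rule Collect_restrict)
    then show "W \<subseteq> Sigma (stable_graphs 2) (topspace \<circ> ?P)"
      unfolding parameter_space_def topspace_sum_topology .
    fix G :: ngraph assume G: "G \<in> stable_graphs 2"
    then have "fin_conn_graph G" by (simp add: stable_graphs_def)
    have "openin (?P G) {x \<in> topspace (?P G). (case x of (l, p) \<Rightarrow> length_dist G l (p i) (p j)) \<in> V}"
      by (rule openin_continuous_map_preimage[OF continuous_map_length_dist[OF \<open>fin_conn_graph G\<close> assms] V])
    moreover have "(G, x) \<in> W \<longleftrightarrow> x \<in> topspace (?P G) \<and> (case x of (l, p) \<Rightarrow> length_dist G l (p i) (p j)) \<in> V" for x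
    proof -
      obtain l p where [simp]: "x = (l, p)" by (cases x)
      have "(G, l, p) \<in> topspace (parameter_space 2 n) \<longleftrightarrow> (l, p) \<in> topspace (?P G)"
        using G by (simp add: parameter_space_def)
      then show ?thesis
        using mark_dist_contract[of G l p n i j] moduli_class_mem[of "(G, l, p)" n] assms by (auto simp: W_def)
    qed
    ultimately show "openin (?P G) {x. (G, x) \<in> W}" by simp
  qed
  then show "openin (TMb 2 n) {x \<in> topspace (TMb 2 n). mark_dist i j x \<in> V}"
    unfolding topspace_TMb by (simp add: TMb_def openin_final_topology W_def parameter_space_def)
qed auto

section \<open>Rigidity of a configuration of four marks\<close>

lemma theta_dist_sym: "theta_dist c k t k' t' = theta_dist c k' t' k t"
  by (simp add: theta_dist_def Let_def add.commute abs_minus_commute)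

lemma theta_dist_le:
  "theta_dist c k t k' t' \<le> t + t'" "theta_dist c k t k' t' \<le> (len c k - t) + (len c k' - t')"
  "k = k' \<Longrightarrow> theta_dist c k t k' t' \<le> \<bar>t - t'\<bar>"
  by (auto simp: theta_dist_defs min_le_iff_disj)

text \<open>
  If two of three points lie on a common edge, then all three lie on a closed curve of length at
  most \<open>2\<close>.
\<close>

lemma perimeter_le:
  assumes "k1 = k2" "c \<le> 1" "t1 \<le> len c k1" "t2 \<le> len c k2"
  shows "theta_dist c k1 t1 k2 t2 + theta_dist c k1 t1 k3 t3 + theta_dist c k2 t2 k3 t3 \<le> 2"
proof -
  have L: "len c k1 \<le> 1" "len c k3 \<le> 1" using assms(2) by (auto simp: len_def)
  show ?thesis
    using theta_dist_le(3)[OF assms(1), of c t1 t2] theta_dist_le(1)[of c k1 t1 k3 t3]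
      theta_dist_le(2)[of c k1 t1 k3 t3] theta_dist_le(1)[of c k2 t2 k3 t3] theta_dist_le(2)[of c k2 t2 k3 t3] L
    unfolding assms(1) by linarith
qed

lemma theta_dist_other:
  "k \<noteq> k' \<Longrightarrow> theta_dist c k t k' t' = min (to_u c k t + to_u c k' t') (to_v c k t + to_v c k' t')"
  by (simp add: theta_dist_def)

lemma theta_dist_same:
  "theta_dist c k t k t' = min (min (to_u c k t + to_u c k t') (to_v c k t + to_v c k t')) \<bar>t - t'\<bar>"
  by (simp add: theta_dist_def)

lemma to_u_v:
  assumes "0 \<le> c" "c \<le> 1" "0 \<le> t" "t \<le> len c k"
  shows "to_u c k t + to_v c k t \<le> len c k" "to_u c k t + to_v c k t \<ge> c" "0 \<le> to_u c k t" "0 \<le> to_v c k t"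
  using assms by (auto simp: to_u_def to_v_def len_def min_def)

text \<open>
  If the shortest way to a vertex passed through the opposite vertex, the point would be within
  \<open>8/100\<close> of the latter. Two other points, described by their distances \<open>ru,
  rv\<close> and \<open>su, sv\<close> from the vertices, would then be at least
  \<open>85/100\<close> away from it, hence within \<open>15/100\<close> of the former vertex and
  too close to each other.
\<close>

lemma no_shortcut:
  assumes "92/100 \<le> c" "c \<le> 1" "0 \<le> t" "t \<le> len c k"
    and "93/100 \<le> to_u c k t + ru" "93/100 \<le> to_v c k t + rv"
    and "93/100 \<le> to_u c k t + su" "93/100 \<le> to_v c k t + sv"
    and "93/100 \<le> ru + su" "93/100 \<le> rv + sv" "ru + rv \<le> 1" "su + sv \<le> 1"
  shows "to_u c k t = t" "to_v c k t = len c k - t"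
proof -
  have L: "len c k \<le> 1" "c \<le> len c k" using assms(2) by (auto simp: len_def)
  note sum = to_u_v[OF _ assms(2-4)]
  show "to_u c k t = t"
  proof (rule ccontr)
    assume "to_u c k t \<noteq> t"
    then have "to_u c k t = len c k - t + c" by (auto simp: to_u_def min_def split: if_splits)
    with sum L assms show False by linarith
  qed
  show "to_v c k t = len c k - t"
  proof (rule ccontr)
    assume "to_v c k t \<noteq> len c k - t"
    then have "to_v c k t = t + c" by (auto simp: to_v_def min_def split: if_splits)
    with sum L assms show False by linarith
  qed
qed

text \<open>
  The marks \<open>a, b, q, m\<close> lie on the edges \<open>ka, kb, kq, km\<close> at distances
  \<open>ta, tb, tq, tm\<close> from the first vertex. The distances are those found for \<open>c
  = 95/100\<close> and \<open>ta = 46/100, tb = 47/100, tq = 2/100, tm = 52/100\<close>, with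
  \<open>q\<close> and \<open>m\<close> on a common edge; only for the pair \<open>a, m\<close>,
  at distance \<open>98/100\<close>, a lower bound suffices. They force \<open>a, b, m\<close>
  onto three different edges, near the midpoints, while \<open>q\<close> breaks the symmetry
  between the vertices.
\<close>

locale four_marks =
  fixes c :: real and ka kb kq km :: nat and ta tb tq tm :: real
  assumes c: "0 \<le> c" "c \<le> 1"
    and k: "ka \<in> {0,1,2}" "kb \<in> {0,1,2}" "kq \<in> {0,1,2}" "km \<in> {0,1,2}"
    and t: "0 \<le> ta" "ta \<le> len c ka" "0 \<le> tb" "tb \<le> len c kb" "0 \<le> tq" "tq \<le> len c kq" "0 \<le> tm" "tm \<le> len c km"
    and d: "theta_dist c ka ta kq tq = 48/100" "theta_dist c kq tq km tm = 50/100"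
      "theta_dist c ka ta kb tb = 93/100" "theta_dist c kb tb kq tq = 49/100"
      "theta_dist c kb tb km tm = 96/100" "975/1000 \<le> theta_dist c ka ta km tm"
begin

lemma distinct: "ka \<noteq> km" "ka \<noteq> kb" "kb \<noteq> km"
proof -
  show "ka \<noteq> km"
    using perimeter_le[of ka km c ta tm kb tb] c t d theta_dist_sym[of c km tm kb tb] by auto
  show "ka \<noteq> kb"
    using perimeter_le[of ka kb c ta tb km tm] c t d by auto
  show "kb \<noteq> km"
    using perimeter_le[of kb km c tb tm ka ta] c t d theta_dist_sym[of c kb tb ka ta] theta_dist_sym[of c km tm ka ta] by auto
qed

lemma lens: "len c ka = c \<and> len c kb = 1 \<and> len c km = 1 \<or> len c ka = 1 \<and> len c kb = c \<and> len c km = 1 \<or>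
    len c ka = 1 \<and> len c kb = 1 \<and> len c km = c"
  using distinct k by (auto simp: len_def)

lemma bounds:
  "975/1000 \<le> to_u c ka ta + to_u c km tm" "975/1000 \<le> to_v c ka ta + to_v c km tm"
  "93/100 \<le> to_u c ka ta + to_u c kb tb" "93/100 \<le> to_v c ka ta + to_v c kb tb"
  "96/100 \<le> to_u c kb tb + to_u c km tm" "96/100 \<le> to_v c kb tb + to_v c km tm"
  using d(6) d(3) d(5) unfolding theta_dist_other[OF distinct(1)] theta_dist_other[OF distinct(2)] theta_dist_other[OF distinct(3)]
  by (simp_all add: min_def split: if_splits)

lemma sums: "to_u c ka ta + to_v c ka ta \<le> len c ka" "to_u c kb tb + to_v c kb tb \<le> len c kb"
  "to_u c km tm + to_v c km tm \<le> len c km"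
  using to_u_v(1)[OF c] t by auto

lemma c_large: "92/100 \<le> c"
  using bounds sums lens c by linarith

lemma straight: "to_u c ka ta = ta" "to_v c ka ta = len c ka - ta" "to_u c kb tb = tb" "to_v c kb tb = len c kb - tb"
  "to_u c km tm = tm" "to_v c km tm = len c km - tm"
proof -
  have L: "len c ka \<le> 1" "len c kb \<le> 1" "len c km \<le> 1" using c by (auto simp: len_def)
  show "to_u c ka ta = ta" "to_v c ka ta = len c ka - ta"
    by (rule no_shortcut[OF c_large c(2) t(1,2), of "to_u c kb tb" "to_v c kb tb" "to_u c km tm" "to_v c km tm"];
        use bounds sums L in linarith)+
  show "to_u c kb tb = tb" "to_v c kb tb = len c kb - tb"
    by (rule no_shortcut[OF c_large c(2) t(3,4), of "to_u c ka ta" "to_v c ka ta" "to_u c km tm" "to_v c km tm"];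
        use bounds sums L in linarith)+
  show "to_u c km tm = tm" "to_v c km tm = len c km - tm"
    by (rule no_shortcut[OF c_large c(2) t(7,8), of "to_u c ka ta" "to_v c ka ta" "to_u c kb tb" "to_v c kb tb"];
        use bounds sums L in linarith)+
qed

lemma middle: "43/100 \<le> ta" "ta \<le> 57/100" "43/100 \<le> tb" "tb \<le> 57/100" "43/100 \<le> tm" "tm \<le> 57/100"
  using bounds[unfolded straight] lens c by linarith+

text \<open>
  The mark \<open>q\<close> shares its edge with \<open>a\<close>, \<open>b\<close> or
  \<open>m\<close>. The first two cases contradict the distance of \<open>a\<close> and
  \<open>b\<close>, and in the third one the distances are linear in the positions.
\<close>

lemma q_near_u:
  assumes u: "to_u c kq tq \<le> 1/5"
  shows "kq = km" "kb = 2" "c = 95/100" "ta = 46/100" "tb = 47/100" "tq = 2/100" "tm = 52/100"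
proof -
  have L: "c \<le> len c k" "len c k \<le> 1" for k using c by (auto simp: len_def)
  have qu: "to_u c kq tq = tq"
    using u c_large L[of kq] t by (auto simp: to_u_def min_def split: if_splits)
  have qv: "72/100 \<le> to_v c kq tq"
    using to_u_v(2)[OF c t(5,6)] u c_large by linarith
  have other: "theta_dist c k r kq tq = r + tq"
    if "k \<noteq> kq" "to_u c k r = r" "to_v c k r = len c k - r" "r \<le> 57/100" for k r
    unfolding theta_dist_other[OF that(1)] that(2,3) qu
    using qv L[of k] c_large u that(4) by (simp add: qu min_def)
  have same: "theta_dist c kq tq kq r = r - tq"
    if "to_u c kq r = r" "to_v c kq r = len c kq - r" "43/100 \<le> r" "r \<le> 57/100" for r
    unfolding theta_dist_same that(1,2) qu
    using qv L[of kq] c_large u that(3,4) t(5) by (simp add: qu min_def)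
  have ab: "ta + tb = 93/100 \<or> len c ka + len c kb - ta - tb = 93/100"
    using d(3) unfolding theta_dist_other[OF distinct(2)] straight by (auto simp: min_def split: if_splits)
  have bm: "tb + tm = 96/100 \<or> len c kb + len c km - tb - tm = 96/100"
    using d(5) unfolding theta_dist_other[OF distinct(3)] straight by (auto simp: min_def split: if_splits)
  have kq: "kq = ka \<or> kq = kb \<or> kq = km" using distinct k by auto
  have "kq \<noteq> ka"
  proof
    assume q: "kq = ka"
    have "ta - tq = 48/100" using same[of ta] straight middle d(1) theta_dist_sym[of c ka ta kq tq] q by simp
    moreover have "tb + tq = 49/100" using other[of kb tb] straight middle d(4) q distinct by simp
    ultimately show False using ab L[of ka] L[of kb] lens c_large by linarith
  qed
  moreover have "kq \<noteq> kb"
  proof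
    assume q: "kq = kb"
    have "tb - tq = 49/100" using same[of tb] straight middle d(4) theta_dist_sym[of c kb tb kq tq] q by simp
    moreover have "ta + tq = 48/100" using other[of ka ta] straight middle d(1) q distinct by simp
    ultimately show False using ab L[of ka] L[of kb] lens c_large by linarith
  qed
  ultimately show q: "kq = km" using kq by blast
  have eqs: "ta + tq = 48/100" "tb + tq = 49/100" "tm - tq = 50/100"
    using other[of ka ta] other[of kb tb] same[of tm] straight middle d(1,2,4) q distinct by simp_all
  have km: "len c km = 1" "len c ka = 1" "len c kb = c" "c = 95/100"
    using eqs bm lens bounds(2)[unfolded straight] t(5) by linarith+
  then show "kb = 2" "c = 95/100" by (auto simp: len_def split: if_splits)
  show "ta = 46/100" "tb = 47/100" "tq = 2/100" "tm = 52/100"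
    using eqs ab km t(5) by linarith+
qed

lemma q_near_end: "to_u c kq tq \<le> 1/5 \<or> to_v c kq tq \<le> 1/5"
proof (cases "kq = ka")
  case True
  then have "kb \<noteq> kq" using distinct by auto
  with d(4) show ?thesis
    unfolding theta_dist_other[OF \<open>kb \<noteq> kq\<close>] straight using middle lens c_large
    by (auto simp: min_def split: if_splits)
next
  case False
  then have "ka \<noteq> kq" by auto
  with d(1) show ?thesis
    unfolding theta_dist_other[OF \<open>ka \<noteq> kq\<close>] straight using middle lens c_large
    by (auto simp: min_def split: if_splits)
qed

lemma flipped: "four_marks c ka kb kq km (len c ka - ta) (len c kb - tb) (len c kq - tq) (len c km - tm)"
  by unfold_locales (use c k t d in \<open>auto simp: theta_dist_flip\<close>)

theorem four_marks_unique:
  "kq = km \<and> kb = 2 \<and> c = 95/100 \<and>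
    (ta = 46/100 \<and> tb = 47/100 \<and> tq = 2/100 \<and> tm = 52/100 \<or>
     ta = 54/100 \<and> tb = 48/100 \<and> tq = 98/100 \<and> tm = 48/100)"
proof (cases "to_u c kq tq \<le> 1/5")
  case True
  then show ?thesis using q_near_u by simp
next
  case False
  then have "to_v c kq tq \<le> 1/5" using q_near_end by simp
  then have u: "to_u c kq (len c kq - tq) \<le> 1/5" by (simp add: to_u_def to_v_def)
  interpret F: four_marks c ka kb kq km "len c ka - ta" "len c kb - tb" "len c kq - tq" "len c km - tm"
    by (rule flipped)
  note R = F.q_near_u[OF u]
  have L: "len c kb = c" "len c km = 1" "len c ka = 1" "len c kq = 1"
    using R(1,2) distinct by (auto simp: len_def)
  have "ta = 54/100 \<and> tb = 48/100 \<and> tq = 98/100 \<and> tm = 48/100"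
    using R(3-7)[unfolded L] by linarith
  then show ?thesis using R(1-3) by blast
qed

end

lemma theta_dist_near:
  assumes c: "\<bar>c - 95/100\<bar> \<le> 1/1000" and t: "\<bar>ta - 46/100\<bar> \<le> 1/1000" "\<bar>tb - 47/100\<bar> \<le> 2/1000"
    "\<bar>tq - 2/100\<bar> \<le> 1/1000" "\<bar>tm - 52/100\<bar> \<le> 1/1000"
    and k: "ka < 2" "km < 2" "ka \<noteq> km"
  shows "theta_dist c ka ta km tq = ta + tq" "theta_dist c km tq km tm = tm - tq"
    "theta_dist c ka ta 2 tb = ta + tb" "theta_dist c 2 tb km tq = tb + tq"
    "theta_dist c 2 tb km tm = 1 + c - tb - tm" "theta_dist c ka ta km tm = ta + tm"
proof -
  have b: "94/100 \<le> c" "c \<le> 96/100" "45/100 \<le> ta" "ta \<le> 47/100" "46/100 \<le> tb" "tb \<le> 48/100"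
    "1/100 \<le> tq" "tq \<le> 3/100" "51/100 \<le> tm" "tm \<le> 53/100"
    using c t by linarith+
  have "to_u c ka ta = ta" "to_v c ka ta = 1 - ta" "to_u c 2 tb = tb" "to_v c 2 tb = c - tb"
    "to_u c km tm = tm" "to_v c km tm = 1 - tm" "to_u c km tq = tq"
    using b k by (auto simp: to_u_def to_v_def len_def)
  moreover have "90/100 \<le> to_v c km tq" using b k by (auto simp: to_v_def len_def)
  moreover have "1 + c - tb - tm \<le> tb + tm" "ta + tm \<le> 2 - ta - tm"
    using c t by linarith+
  ultimately show "theta_dist c ka ta km tq = ta + tq" "theta_dist c km tq km tm = tm - tq"
    "theta_dist c ka ta 2 tb = ta + tb" "theta_dist c 2 tb km tq = tb + tq"
    "theta_dist c 2 tb km tm = 1 + c - tb - tm" "theta_dist c ka ta km tm = ta + tm"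
    using b k by (auto simp: theta_dist_def Let_def min_def)
qed

section \<open>Configurations of marks\<close>

lemma (in metric_graph) theta_configuration:
  fixes e :: "nat \<Rightarrow> 'e" and r :: "nat \<Rightarrow> bool"
  defines "pt \<equiv> \<lambda>k s. ep (e k) (if r k then 1 - s else s)"
  assumes verts: "verts G = {a, b}" and arcs: "arcs G = e ` K" and inj: "inj_on e K" and "K \<noteq> {}"
    and c: "0 \<le> c" "c \<le> 1" and l: "\<And>k. k \<in> K \<Longrightarrow> l (e k) = len c k"
    and ends: "\<And>k. k \<in> K \<Longrightarrow> pt k 0 = Vert a \<and> pt k 1 = Vert b"
    and ab: "d (Vert a) (Vert b) \<le> c" and eq: "a = b \<Longrightarrow> c = 0"
    and p: "\<And>i. i \<in> I \<Longrightarrow> p i \<in> pts"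
  shows "\<exists>k t. (\<forall>i\<in>I. k i \<in> K \<and> 0 \<le> t i \<and> t i \<le> len c (k i)) \<and>
    (\<forall>i\<in>I. \<forall>j\<in>I. d (p i) (p j) = theta_dist c (k i) (t i) (k j) (t j))"
proof -
  have "\<exists>k s. k \<in> K \<and> s \<in> {0..1} \<and> x = pt k s" if "x \<in> pts" for x
    using that
  proof (cases rule: realization_points_cases)
    case (1 v)
    obtain k where "k \<in> K" using \<open>K \<noteq> {}\<close> by blast
    show ?thesis
    proof (cases "v = a")
      case True
      then have "k \<in> K \<and> 0 \<in> {0..1::real} \<and> x = pt k 0" using ends[OF \<open>k \<in> K\<close>] 1 \<open>k \<in> K\<close> by simp
      then show ?thesis by blast
    next
      case False
      then have "v = b" using 1 verts by blast
      then have "k \<in> K \<and> 1 \<in> {0..1::real} \<and> x = pt k 1" using ends[OF \<open>k \<in> K\<close>] 1 \<open>k \<in> K\<close> by simp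
      then show ?thesis by blast
    qed
  next
    case (2 y s)
    then obtain k where k: "k \<in> K" "y = e k" using arcs by blast
    have "k \<in> K \<and> (if r k then 1 - s else s) \<in> {0..1} \<and> x = pt k (if r k then 1 - s else s)"
      using 2 k by (simp add: pt_def)
    then show ?thesis by blast
  qed
  then have "\<forall>i\<in>I. \<exists>q. fst q \<in> K \<and> snd q \<in> {0..1} \<and> p i = pt (fst q) (snd q)"
    using p by force
  then obtain q where q: "\<And>i. i \<in> I \<Longrightarrow> fst (q i) \<in> K \<and> snd (q i) \<in> {0..1} \<and> p i = pt (fst (q i)) (snd (q i))"
    by (metis (no_types, lifting))
  define k where "k = (\<lambda>i. fst (q i))"
  define t where "t = (\<lambda>i. len c (k i) * snd (q i))"
  have "d (p i) (p j) = theta_dist c (k i) (t i) (k j) (t j)" if "i \<in> I" "j \<in> I" for i j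
  proof -
    have "d (pt (k i) (snd (q i))) (pt (k j) (snd (q j))) = theta_dist c (k i) (t i) (k j) (t j)"
      unfolding pt_def t_def
      by (rule dist_eq_theta_dist[OF arcs inj c l ends[unfolded pt_def] ab eq]) (use q that in \<open>auto simp: k_def\<close>)
    then show ?thesis using q[OF that(1)] q[OF that(2)] by (simp add: k_def)
  qed
  moreover have "k i \<in> K \<and> 0 \<le> t i \<and> t i \<le> len c (k i)" if "i \<in> I" for i
    using q[OF that] c by (auto simp: k_def t_def len_def intro: mult_left_le)
  ultimately show ?thesis by blast
qed

definition configuration :: "nat \<Rightarrow> real \<Rightarrow> (nat \<Rightarrow> nat) \<Rightarrow> (nat \<Rightarrow> real) \<Rightarrow> bool" where
  "configuration n c k t \<longleftrightarrow> 0 \<le> c \<and> c \<le> 1 \<and>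
     (\<forall>i\<in>{1..n}. k i \<in> {0,1,2} \<and> 0 \<le> t i \<and> t i \<le> len c (k i))"

text \<open>
  Two edges of a theta graph form a cycle, so at most one of them is shorter than
  \<open>1\<close>; it is given the number \<open>2\<close>. The loops of a rose cannot be short,
  which makes the rose the case \<open>c = 0\<close>.
\<close>

lemma X_space_configuration:
  assumes "C \<in> topspace (X_space 2 n)"
  obtains c k t where "configuration n c k t"
    "\<And>i j. i \<in> {1..n} \<Longrightarrow> j \<in> {1..n} \<Longrightarrow> mark_dist i j C = theta_dist c (k i) (t i) (k j) (t j)"
proof -
  obtain G l p where M: "(G, l, p) \<in> marked_graphs 2 n" and C: "C = isometry_rel 2 n `` {(G, l, p)}"
    and mx: "Max (l ` arcs G) = 1" and forest: "forest_edges G {e \<in> arcs G. l e < 1}"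
    using assms by (auto simp: X_space_def)
  have G: "G \<in> stable_graphs 2" and pos: "\<And>e. e \<in> arcs G \<Longrightarrow> 0 < l e"
    and p: "\<And>i. i \<in> {1..n} \<Longrightarrow> p i \<in> realization_points G"
    using M by (auto simp: marked_graphs_def)
  have conn: "fin_conn_graph G" using G by (simp add: stable_graphs_def)
  interpret metric_graph G l by unfold_locales (use conn pos in \<open>auto intro: less_imp_le\<close>)
  have le1: "l e \<le> 1" if "e \<in> arcs G" for e
    using Max_ge[of "l ` arcs G" "l e"] that mx by auto
  have "\<exists>c k t. 0 \<le> c \<and> c \<le> 1 \<and> (\<forall>i\<in>{1..n}. k i \<in> {0,1,2} \<and> 0 \<le> t i \<and> t i \<le> len c (k i)) \<and>
    (\<forall>i\<in>{1..n}. \<forall>j\<in>{1..n}. d (p i) (p j) = theta_dist c (k i) (t i) (k j) (t j))"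
    using stable_genus2_cases[OF G]
  proof
    assume "\<exists>u v e. theta_graph G u v e"
    then obtain u v e0 where th0: "theta_graph G u v e0" by blast
    have "\<exists>m\<in>{0,1,2}. \<forall>k\<in>{0,1,2}. k \<noteq> m \<longrightarrow> l (e0 k) = 1"
    proof (cases "\<exists>m\<in>{0,1,2}. l (e0 m) < 1")
      case True
      then obtain m where m: "m \<in> {0,1,2}" "l (e0 m) < 1" by blast
      have "l (e0 k) = 1" if k: "k \<in> {0,1,2}" "k \<noteq> m" for k
      proof -
        have arc: "e0 k \<in> arcs G" "e0 m \<in> arcs G" unfolding theta_graphD(3)[OF th0] using k(1) m(1) by blast+
        have "\<not> l (e0 k) < 1"
        proof
          assume "l (e0 k) < 1"
          then have "k = m"
            by (intro theta_forest[OF th0 forest k(1) m(1)]) (use arc m(2) in simp_all)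
          with k(2) show False by simp
        qed
        then show ?thesis using le1[OF arc(1)] by simp
      qed
      with m(1) show ?thesis by blast
    next
      case False
      have "l (e0 k) = 1" if k: "k \<in> {0,1,2}" for k
      proof -
        have "e0 k \<in> arcs G" unfolding theta_graphD(3)[OF th0] using k by blast
        then show ?thesis using False k le1[of "e0 k"] by force
      qed
      then show ?thesis by blast
    qed
    then obtain m where m: "m \<in> {0,1,2}" "\<And>k. k \<in> {0,1,2} \<Longrightarrow> k \<noteq> m \<Longrightarrow> l (e0 k) = 1" by blast
    define e where "e = e0 \<circ> Transposition.transpose m 2"
    have th: "theta_graph G u v e" unfolding e_def by (rule theta_permute[OF th0 swap2_bij[OF m(1)]])
    note arcs = theta_graphD(3)[OF th]
    have arc: "e k \<in> arcs G" if "k \<in> {0,1,2}" for k unfolding arcs using that by blast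
    define c where "c = l (e 2)"
    have c: "0 \<le> c" "c \<le> 1" using l_nonneg[OF arc[of 2]] le1[OF arc[of 2]] by (simp_all add: c_def)
    have l: "l (e k) = len c k" if k: "k \<in> {0,1,2}" for k
    proof (cases "k = 2")
      case False
      then have "Transposition.transpose m 2 k \<in> {0,1,2} \<and> Transposition.transpose m 2 k \<noteq> m"
        using k m(1) by (auto simp: Transposition.transpose_def)
      then show ?thesis using False m(2) by (simp add: e_def len_def)
    qed (simp add: c_def len_def)
    define r where "r = (\<lambda>k. tail G (e k) \<noteq> u)"
    have ends: "ep (e k) (if r k then 1 - 0 else 0) = Vert u \<and> ep (e k) (if r k then 1 - 1 else 1) = Vert v"
      if "k \<in> {0,1,2}" for k
      using theta_edge_cases[OF th that] theta_graphD(2)[OF th] by (auto simp: r_def edge_point_def)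
    have "d (ep (e 2) (if r 2 then 1 - 0 else 0)) (ep (e 2) (if r 2 then 1 - 1 else 1)) \<le>
      l (e 2) * \<bar>(if r 2 then 1 - 0 else 0) - (if r 2 then 1 - 1 else 1)\<bar>"
      by (rule d_edge) (use arc in auto)
    then have ab: "d (Vert u) (Vert v) \<le> c" using ends[of 2] by (auto simp: c_def split: if_splits)
    have "\<exists>k t. (\<forall>i\<in>{1..n}. k i \<in> {0,1,2} \<and> 0 \<le> t i \<and> t i \<le> len c (k i)) \<and>
      (\<forall>i\<in>{1..n}. \<forall>j\<in>{1..n}. d (p i) (p j) = theta_dist c (k i) (t i) (k j) (t j))"
      by (rule theta_configuration[OF theta_graphD(1)[OF th] arcs theta_graphD(4)[OF th] _ c l ends ab _ p])
        (use theta_graphD(2)[OF th] in auto)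
    then show ?thesis using c by blast
  next
    assume "\<exists>u e. rose_graph G u e"
    then obtain u e where ro: "rose_graph G u e" by blast
    then have R: "verts G = {u, u}" "arcs G = e ` {0,1}" "inj_on e {0,1}"
      and ends: "\<And>k. k \<in> {0,1} \<Longrightarrow> tail G (e k) = u \<and> head G (e k) = u"
      unfolding rose_graph_def by auto
    have none: "{e \<in> arcs G. l e < 1} = {}" by (rule rose_forest[OF ro forest])
    have "l y = 1" if "y \<in> arcs G" for y using none le1[OF that] that by fastforce
    then have l: "l (e k) = len 0 k" if "k \<in> {0,1}" for k
      using that unfolding R(2) by (auto simp: len_def)
    have "d (Vert u) (Vert u) \<le> 0" using R(1) by (subst d_refl) (auto simp: realization_points_def)
    have "\<exists>k t. (\<forall>i\<in>{1..n}. k i \<in> {0,1} \<and> 0 \<le> t i \<and> t i \<le> len 0 (k i)) \<and>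
      (\<forall>i\<in>{1..n}. \<forall>j\<in>{1..n}. d (p i) (p j) = theta_dist 0 (k i) (t i) (k j) (t j))"
      by (rule theta_configuration[where r = "\<lambda>_. False", OF R _ _ _ l _ \<open>d (Vert u) (Vert u) \<le> 0\<close> _ p])
        (use ends in \<open>auto simp: edge_point_def\<close>)
    then obtain k t where "\<forall>i\<in>{1..n}. k i \<in> {0,1} \<and> 0 \<le> t i \<and> t i \<le> len 0 (k i)"
      "\<forall>i\<in>{1..n}. \<forall>j\<in>{1..n}. d (p i) (p j) = theta_dist 0 (k i) (t i) (k j) (t j)" by blast
    then show ?thesis by (intro exI[of _ 0] exI[of _ k] exI[of _ t]) auto
  qed
  then obtain c k t where ckt: "0 \<le> c" "c \<le> 1" "\<forall>i\<in>{1..n}. k i \<in> {0,1,2} \<and> 0 \<le> t i \<and> t i \<le> len c (k i)"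
    "\<forall>i\<in>{1..n}. \<forall>j\<in>{1..n}. d (p i) (p j) = theta_dist c (k i) (t i) (k j) (t j)" by blast
  show thesis
  proof (rule that)
    show "configuration n c k t" using ckt by (simp add: configuration_def)
    show "mark_dist i j C = theta_dist c (k i) (t i) (k j) (t j)" if "i \<in> {1..n}" "j \<in> {1..n}" for i j
      using mark_dist_class[OF M that] ckt(4) that by (simp add: C)
  qed
qed

section \<open>Cubes of marked theta graphs\<close>

definition Theta :: ngraph where
  "Theta = \<lparr>verts = {0, 1}, arcs = {0, 1, 2}, tail = \<lambda>_. 0, head = \<lambda>_. 1\<rparr>"

text \<open>
  All further marks follow the fourth, so that one cycle serves all numbers of marks.
\<close>

definition marked_theta :: "nat \<Rightarrow> real \<Rightarrow> (nat \<Rightarrow> nat) \<Rightarrow> (nat \<Rightarrow> real) \<Rightarrow> marked_graph" where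
  "marked_theta n c k s = (Theta, restrict (len c) {0,1,2},
     restrict (\<lambda>i. edge_point Theta (k (min i 4)) (s (min i 4))) {1..n})"

definition theta_class :: "nat \<Rightarrow> real \<Rightarrow> (nat \<Rightarrow> nat) \<Rightarrow> (nat \<Rightarrow> real) \<Rightarrow> marked_graph set" where
  "theta_class n c k s = moduli_class n (marked_theta n c k s)"

lemma Theta_simps [simp]:
  "verts Theta = {0, 1}" "arcs Theta = {0, 1, 2}" "tail Theta e = 0" "head Theta e = 1"
  by (simp_all add: Theta_def)

lemma Theta_theta: "theta_graph Theta 0 1 id"
  by (auto simp: theta_graph_def)

lemma Theta_stable: "Theta \<in> stable_graphs 2"
  by (rule theta_stable[OF Theta_theta])

lemma Theta_conn: "fin_conn_graph Theta"
  by (rule theta_fin_conn[OF Theta_theta])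

lemma Theta_edge_point_mem: "k \<in> {0,1,2} \<Longrightarrow> s \<in> {0..1} \<Longrightarrow> edge_point Theta k s \<in> realization_points Theta"
  by (auto simp: edge_point_def realization_points_def)

lemma topspace_realization_Theta [simp]: "topspace (realization Theta) = realization_points Theta"
  using Theta_conn by (intro topspace_realization) (simp add: fin_conn_graph_def)

lemma Theta_zero_edges:
  assumes "0 \<le> c"
  shows "{e \<in> arcs Theta. restrict (len c) {0,1,2} e = 0} = (if c = 0 then {2} else {})"
  by (auto simp: len_def)

lemma Theta_length_mem:
  assumes "0 \<le> c"
  shows "restrict (len c) {0,1,2} \<in> topspace (length_space Theta)"
proof -
  have "forest_edges Theta {e \<in> arcs Theta. restrict (len c) {0,1,2} e = 0}"
    unfolding Theta_zero_edges[OF assms]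
    by (rule theta_single_forest[OF Theta_theta, of 2]) auto
  moreover have "\<forall>e\<in>arcs Theta. 0 \<le> restrict (len c) {0,1,2} e" using assms by (auto simp: len_def)
  ultimately show ?thesis unfolding length_space_def topspace_subtopology by simp
qed

lemma marked_theta_mem:
  assumes "0 \<le> c" "\<And>i. i \<in> {1..4} \<Longrightarrow> k i \<in> {0,1,2} \<and> s i \<in> {0..1}"
  shows "marked_theta n c k s \<in> topspace (parameter_space 2 n)"
proof -
  have "restrict (\<lambda>i. edge_point Theta (k (min i 4)) (s (min i 4))) {1..n} \<in> {1..n} \<rightarrow>\<^sub>E realization_points Theta"
  proof
    fix i assume "i \<in> {1..n}"
    then have "min i 4 \<in> {1..4}" by auto
    from assms(2)[OF this] show "restrict (\<lambda>i. edge_point Theta (k (min i 4)) (s (min i 4))) {1..n} i \<in> realization_points Theta"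
      using \<open>i \<in> {1..n}\<close> Theta_edge_point_mem by simp
  qed auto
  then show ?thesis
    using Theta_stable Theta_length_mem[OF assms(1)] by (simp add: marked_theta_def parameter_space_def)
qed

lemma theta_class_dist:
  assumes "0 \<le> c" "c \<le> 1" "\<And>i. i \<in> {1..4} \<Longrightarrow> k i \<in> {0,1,2} \<and> s i \<in> {0..1}"
    and ij: "i \<in> {1..n}" "j \<in> {1..n}" "i \<in> {1..4}" "j \<in> {1..4}"
  shows "mark_dist i j (theta_class n c k s) = theta_dist c (k i) (len c (k i) * s i) (k j) (len c (k j) * s j)"
proof -
  let ?l = "restrict (len c) {0,1,2}"
  have "mark_dist i j (theta_class n c k s) = length_dist Theta ?l (edge_point Theta (k i) (s i)) (edge_point Theta (k j) (s j))"
    unfolding theta_class_def marked_theta_def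
    by (subst mark_dist_contract[OF marked_theta_mem[OF assms(1,3), unfolded marked_theta_def] ij(1,2)]) (use ij in auto)
  also have "\<dots> = theta_dist c (k i) (len c (k i) * s i) (k j) (len c (k j) * s j)"
  proof -
    interpret metric_graph Theta ?l
      by unfold_locales (use Theta_conn assms(1) in \<open>auto simp: len_def\<close>)
    have "d (ep 2 0) (ep 2 1) \<le> ?l 2 * \<bar>0 - 1\<bar>" by (rule d_edge) auto
    then have ab: "d (Vert 0) (Vert 1) \<le> c" by (simp add: edge_point_def len_def)
    show ?thesis
      using dist_eq_theta_dist[where e = id and r = "\<lambda>_. False" and K = "{0,1,2}" and a = 0 and b = 1, OF _ _ assms(1,2) _ _ ab,
          of "k i" "k j" "s i" "s j"] assms(3)[OF ij(3)] assms(3)[OF ij(4)]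
      by (auto simp: edge_point_def)
  qed
  finally show ?thesis .
qed

lemma theta_class_X:
  assumes "0 \<le> c" "c \<le> 1" "\<And>i. i \<in> {1..4} \<Longrightarrow> k i \<in> {0,1,2} \<and> s i \<in> {0..1}"
  shows "theta_class n c k s \<in> topspace (X_space 2 n)"
proof -
  let ?l = "restrict (len c) {0,1,2}"
  define F where "F = {e \<in> arcs Theta. ?l e = 0}"
  define G' where "G' = contract_graph Theta F"
  define l' where "l' = restrict ?l (arcs Theta - F)"
  define p' where "p' = restrict (\<lambda>i. contract_point Theta F (restrict (\<lambda>i. edge_point Theta (k (min i 4)) (s (min i 4))) {1..n} i)) {1..n}"
  have P: "marked_theta n c k s \<in> topspace (parameter_space 2 n)"
    by (rule marked_theta_mem[OF assms(1,3)])
  have eq: "contract_marked n (marked_theta n c k s) = (G', l', p')"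
    by (simp only: marked_theta_def contract_marked_def Let_def prod.case F_def G'_def l'_def p'_def)
  have M: "(G', l', p') \<in> marked_graphs 2 n"
    using contract_marked_mem[OF P[unfolded marked_theta_def]] eq unfolding marked_theta_def by simp
  have con: "contraction Theta ?l F"
    using parameter_spaceD(2)[OF P[unfolded marked_theta_def]] unfolding F_def .
  have F: "F = (if c = 0 then {2} else {})" unfolding F_def by (rule Theta_zero_edges[OF assms(1)])
  have arcs: "arcs G' = {0,1,2} - F" by (simp add: G'_def contract_graph_def)
  have l': "l' ` arcs G' \<subseteq> {..1}" "l' 0 = 1" "0 \<in> arcs G'"
    using assms(2) by (auto simp: l'_def arcs F len_def)
  have "Max (l' ` arcs G') = 1"
  proof (rule Max_eqI)
    show "finite (l' ` arcs G')" by (simp add: arcs)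
    show "y \<le> 1" if "y \<in> l' ` arcs G'" for y using l'(1) that by blast
    show "1 \<in> l' ` arcs G'" using l'(2,3) by force
  qed
  moreover have "forest_edges G' {e \<in> arcs G'. l' e < 1}"
  proof (cases "c = 0")
    case True
    then have none: "{e \<in> arcs G'. l' e < 1} = {}" by (auto simp: l'_def arcs F len_def)
    show ?thesis unfolding none by (auto simp: forest_edges_def undirected_cycle_def)
  next
    case False
    then have "theta_graph G' 0 1 id"
      using contract_theta_empty[OF Theta_theta] con by (simp add: G'_def F)
    then show ?thesis
      by (rule theta_single_forest[of _ _ _ _ 2]) (auto simp: l'_def arcs F len_def split: if_splits)
  qed
  moreover have "theta_class n c k s \<in> topspace (TMb 2 n)"
    unfolding theta_class_def topspace_TMb by (rule moduli_class_mem[OF P])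
  ultimately show ?thesis
    using M unfolding X_space_def topspace_subtopology theta_class_def eq by blast
qed

lemma continuous_map_edge_point:
  assumes "k \<in> {0,1,2}"
  shows "continuous_map (top_of_set {0..1}) (realization Theta) (edge_point Theta k)"
  unfolding continuous_map
proof (intro conjI allI impI)
  show "edge_point Theta k ` topspace (top_of_set {0..1}) \<subseteq> topspace (realization Theta)"
    using Theta_edge_point_mem[OF assms] by auto
  show "openin (top_of_set {0..1}) {x \<in> topspace (top_of_set {0..1}). edge_point Theta k x \<in> U}"
    if "openin (realization Theta) U" for U
    using that assms by (auto simp: openin_realization)
qed

lemma continuous_map_theta_class:
  assumes c: "continuous_map Y euclideanreal c" "\<And>x. x \<in> topspace Y \<Longrightarrow> 0 \<le> c x \<and> c x \<le> 1"
    and k: "\<And>i. i \<in> {1..4} \<Longrightarrow> k i \<in> {0,1,2}"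
    and s: "\<And>i. i \<in> {1..4} \<Longrightarrow> continuous_map Y (top_of_set {0..1}) (s i)"
  shows "continuous_map Y (X_space 2 n) (\<lambda>x. theta_class n (c x) k (\<lambda>i. s i x))"
proof -
  have s01: "s i x \<in> {0..1}" if "i \<in> {1..4}" "x \<in> topspace Y" for i x
    using continuous_map_image_subset_topspace[OF s[OF that(1)]] that(2) by auto
  have l: "continuous_map Y (length_space Theta) (\<lambda>x. restrict (len (c x)) {0,1,2})"
    unfolding length_space_def continuous_map_in_subtopology
  proof
    have "continuous_map Y euclideanreal (\<lambda>x. restrict (len (c x)) {0,1,2} e)" if "e \<in> {0,1,2}" for e
      using that c(1) by (cases "e = 2") (auto simp: len_def)
    then show "continuous_map Y (product_topology (\<lambda>_. euclideanreal) (arcs Theta)) (\<lambda>x. restrict (len (c x)) {0,1,2})"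
      by (auto simp: continuous_map_componentwise)
    show "(\<lambda>x. restrict (len (c x)) {0,1,2}) \<in> topspace Y \<rightarrow> {l. (\<forall>e\<in>arcs Theta. 0 \<le> l e) \<and> forest_edges Theta {e \<in> arcs Theta. l e = 0}}"
      using Theta_length_mem c(2) unfolding length_space_def topspace_subtopology by blast
  qed
  have p: "continuous_map Y (product_topology (\<lambda>_. realization Theta) {1..n})
    (\<lambda>x. restrict (\<lambda>i. edge_point Theta (k (min i 4)) (s (min i 4) x)) {1..n})"
    unfolding continuous_map_componentwise
  proof (intro conjI ballI)
    fix i assume i: "i \<in> {1..n}"
    then have i4: "min i 4 \<in> {1..4}" by auto
    from continuous_map_compose[OF s[OF i4] continuous_map_edge_point[OF k[OF i4]]] i
    show "continuous_map Y (realization Theta) (\<lambda>x. restrict (\<lambda>i. edge_point Theta (k (min i 4)) (s (min i 4) x)) {1..n} i)"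
      by (simp add: o_def)
  qed auto
  have "continuous_map Y (parameter_space 2 n) (\<lambda>x. marked_theta n (c x) k (\<lambda>i. s i x))"
    using continuous_map_compose[OF continuous_map_pairedI[OF l p] continuous_map_component_injection[OF Theta_stable,
      of "\<lambda>G. prod_topology (length_space G) (product_topology (\<lambda>_. realization G) {1..n})"]]
    by (simp add: o_def marked_theta_def parameter_space_def)
  from continuous_map_into_TMb[OF this]
  have "continuous_map Y (TMb 2 n) (\<lambda>x. theta_class n (c x) k (\<lambda>i. s i x))"
    unfolding theta_class_def .
  moreover have "theta_class n (c x) k (\<lambda>i. s i x) \<in> topspace (X_space 2 n)" if "x \<in> topspace Y" for x
    by (rule theta_class_X) (use c(2)[OF that] k s01 that in auto)
  ultimately show ?thesis
    unfolding X_space_def continuous_map_in_subtopology topspace_subtopology by blast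
qed

section \<open>Gluing\<close>

text \<open>
  The gluings at \<open>c = 1\<close> and \<open>c = 0\<close> come from isometric involutions
  \<open>f\<close> of the contracted graph, which permute the edges by \<open>\<tau>\<close> and
  reparametrize them by \<open>\<rho>\<close>.
\<close>

lemma moduli_class_eqI:
  assumes P: "(G, l, p) \<in> topspace (parameter_space 2 n)" "(G, l, p') \<in> topspace (parameter_space 2 n)"
    and F: "F = {e \<in> arcs G. l e = 0}" and arc: "\<And>e. e \<in> arcs G - F \<Longrightarrow> \<tau> e \<in> arcs G - F \<and> l (\<tau> e) = l e"
    and f: "\<And>x. x \<in> realization_points (contract_graph G F) \<Longrightarrow>
      f x \<in> realization_points (contract_graph G F) \<and> f (f x) = x"
    and edge: "\<And>e s. e \<in> arcs G - F \<Longrightarrow> s \<in> {0..1} \<Longrightarrow>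
      f (edge_point (contract_graph G F) e s) = edge_point (contract_graph G F) (\<tau> e) (\<rho> e s)"
    and \<rho>: "\<And>e s t. s \<in> {0..1} \<Longrightarrow> t \<in> {0..1} \<Longrightarrow> \<rho> e s \<in> {0..1} \<and> \<bar>\<rho> e s - \<rho> e t\<bar> = \<bar>s - t\<bar>"
    and marks: "\<And>i. i \<in> {1..n} \<Longrightarrow> f (contract_point G F (p i)) = contract_point G F (p' i)"
  shows "moduli_class n (G, l, p) = moduli_class n (G, l, p')"
proof -
  interpret contraction G l F using parameter_spaceD(2)[OF P(1)] unfolding F .
  have M: "contract_marked n (G, l, q) = (G', l', restrict (\<lambda>i. cp (q i)) {1..n})" for q
    by (simp only: contract_marked_def Let_def prod.case F)
  have "bij_betw f C.pts C.pts"
    by (rule bij_betw_byWitness[where f' = f]) (use f in auto)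
  moreover have "C.d (f x) (f y) = C.d x y" if "x \<in> C.pts" "y \<in> C.pts" for x y
    by (rule C.d_involution[where \<tau> = \<tau> and \<rho> = \<rho>, OF f _ _ \<rho> that])
      (use arc edge in \<open>auto simp: arcs_G'\<close>)
  ultimately have "marked_isometry n (contract_marked n (G, l, p)) (contract_marked n (G, l, p')) f"
    using marks by (simp add: marked_isometry_def M)
  then have "(contract_marked n (G, l, p), contract_marked n (G, l, p')) \<in> isometry_rel 2 n"
    using contract_marked_mem[OF P(1)] contract_marked_mem[OF P(2)] unfolding isometry_rel_def by blast
  then show ?thesis by (rule equiv_class_eq[OF equiv_isometry_rel])
qed

lemma theta_class_at_vertices:
  assumes "\<And>i. i \<in> {1..4} \<Longrightarrow> s i = s' i \<and> (k i = k' i \<or> s i \<in> {0, 1})"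
  shows "theta_class n c k s = theta_class n c k' s'"
proof -
  have "edge_point Theta (k (min i 4)) (s (min i 4)) = edge_point Theta (k' (min i 4)) (s' (min i 4))"
    if "i \<in> {1..n}" for i
  proof -
    have "min i 4 \<in> {1..4}" using that by auto
    from assms[OF this] show ?thesis by (auto simp: edge_point_def)
  qed
  then have "marked_theta n c k s = marked_theta n c k' s'"
    unfolding marked_theta_def by (simp cong: restrict_cong)
  then show ?thesis by (simp only: theta_class_def)
qed

lemma theta_class_swap_edges:
  assumes "\<And>i. i \<in> {1..4} \<Longrightarrow> k i \<in> {0,1,2} \<and> k' i = 2 - k i \<and> s i \<in> {0..1} \<and> s' i = s i"
  shows "theta_class n 1 k s = theta_class n 1 k' s'"
proof -
  have k': "k' i \<in> {0,1,2} \<and> s' i \<in> {0..1}" if "i \<in> {1..4}" for i using assms[OF that] by auto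
  define f :: "npoint \<Rightarrow> npoint" where "f = (\<lambda>z. case z of Vert v \<Rightarrow> Vert v | Inner e s \<Rightarrow> Inner (2 - e) s)"
  have F: "{} = {e \<in> arcs Theta. restrict (len 1) {0,1,2} e = 0}" by (subst Theta_zero_edges) simp_all
  have P: "marked_theta n 1 k s \<in> topspace (parameter_space 2 n)" "marked_theta n 1 k' s' \<in> topspace (parameter_space 2 n)"
    by (rule marked_theta_mem; use assms k' in simp)+
  show ?thesis
    unfolding theta_class_def marked_theta_def
  proof (rule moduli_class_eqI[where f = f and \<tau> = "\<lambda>e. 2 - e" and \<rho> = "\<lambda>_ s. s", OF P[unfolded marked_theta_def] F])
    let ?G = "contract_graph Theta {}"
    show "2 - e \<in> arcs Theta - {} \<and> restrict (len 1) {0,1,2} (2 - e) = restrict (len 1) {0,1,2} e"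
      if "e \<in> arcs Theta - {}" for e
      using that by (auto simp: len_def)
    show "f x \<in> realization_points ?G \<and> f (f x) = x" if "x \<in> realization_points ?G" for x
      using that by (auto simp: f_def realization_points_def contract_graph_def)
    show "f (edge_point ?G e t) = edge_point ?G (2 - e) t" for e t
      by (simp add: f_def edge_point_def contract_graph_def)
    show "f (contract_point Theta {} (restrict (\<lambda>i. edge_point Theta (k (min i 4)) (s (min i 4))) {1..n} i)) =
      contract_point Theta {} (restrict (\<lambda>i. edge_point Theta (k' (min i 4)) (s' (min i 4))) {1..n} i)"
      if "i \<in> {1..n}" for i
    proof -
      have "min i 4 \<in> {1..4}" using that by auto
      from assms[OF this] that show ?thesis by (simp add: edge_point_def f_def)
    qed
  qed simp
qed

lemma theta_class_reverse_loop:
  assumes "\<And>i. i \<in> {1..4} \<Longrightarrow> k i \<in> {0,1,2} \<and> s i \<in> {0..1} \<and> s' i = (if k i = 1 then 1 - s i else s i)"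
  shows "theta_class n 0 k s = theta_class n 0 k s'"
proof -
  have s': "k i \<in> {0,1,2} \<and> s' i \<in> {0..1}" if "i \<in> {1..4}" for i using assms[OF that] by auto
  define f :: "npoint \<Rightarrow> npoint" where
    "f = (\<lambda>z. case z of Vert v \<Rightarrow> Vert v | Inner e s \<Rightarrow> Inner e (if e = 1 then 1 - s else s))"
  have F: "{2} = {e \<in> arcs Theta. restrict (len 0) {0,1,2} e = 0}" by (subst Theta_zero_edges) simp_all
  have P: "marked_theta n 0 k s \<in> topspace (parameter_space 2 n)" "marked_theta n 0 k s' \<in> topspace (parameter_space 2 n)"
    by (rule marked_theta_mem; use assms s' in simp)+
  interpret contraction Theta "restrict (len 0) {0,1,2}" "{2}"
    using parameter_spaceD(2)[OF P(1)[unfolded marked_theta_def]] unfolding F[symmetric] .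
  have cv: "contract_vert Theta {2} (Suc 0) = contract_vert Theta {2} 0"
    using cv_edge[of 2] by simp
  show ?thesis
    unfolding theta_class_def marked_theta_def
  proof (rule moduli_class_eqI[where f = f and \<tau> = "\<lambda>e. e" and \<rho> = "\<lambda>e s. if e = 1 then 1 - s else s",
        OF P[unfolded marked_theta_def] F])
    let ?G = "contract_graph Theta {2}"
    show "f x \<in> realization_points ?G \<and> f (f x) = x" if "x \<in> realization_points ?G" for x
      using that by (auto simp: f_def realization_points_def)
    show "f (edge_point ?G e t) = edge_point ?G e (if e = 1 then 1 - t else t)" for e t
      by (simp add: f_def edge_point_def contract_graph_def cv)
    show "(if e = 1 then 1 - t else t) \<in> {0..1::real} \<and>
      \<bar>(if e = 1 then 1 - t else t) - (if e = 1 then 1 - t' else t')\<bar> = \<bar>t - t'\<bar>"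
      if "t \<in> {0..1}" "t' \<in> {0..1}" for e t t'
      using that by auto
    show "f (contract_point Theta {2} (restrict (\<lambda>i. edge_point Theta (k (min i 4)) (s (min i 4))) {1..n} i)) =
      contract_point Theta {2} (restrict (\<lambda>i. edge_point Theta (k (min i 4)) (s' (min i 4))) {1..n} i)"
      if "i \<in> {1..n}" for i
    proof -
      have "min i 4 \<in> {1..4}" using that by auto
      from assms[OF this] that show ?thesis by (auto simp add: edge_point_def f_def cv)
    qed
  qed auto
qed

lemma theta_class_contracted_edge:
  assumes "\<And>i. i \<in> {1..4} \<Longrightarrow> k i \<in> {0,1,2} \<and> s i \<in> {0..1} \<and> s' i \<in> {0..1} \<and> (k i = 2 \<or> s' i = s i)"
  shows "theta_class n 0 k s = theta_class n 0 k s'"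
proof -
  have zero_edges: "{e \<in> arcs Theta. restrict (len 0) {0,1,2} e = 0} = {2}" by (subst Theta_zero_edges) simp_all
  have P: "marked_theta n 0 k s \<in> topspace (parameter_space 2 n)"
    by (rule marked_theta_mem; use assms in simp)
  interpret contraction Theta "restrict (len 0) {0,1,2}" "{2}"
    using parameter_spaceD(2)[OF P[unfolded marked_theta_def]] unfolding zero_edges .
  have marks: "cp (edge_point Theta (k (min i 4)) (s (min i 4))) = cp (edge_point Theta (k (min i 4)) (s' (min i 4)))"
    if "i \<in> {1..n}" for i
  proof -
    have i4: "min i 4 \<in> {1..4}" using that by auto
    show ?thesis
    proof (cases "k (min i 4) = 2")
      case True
      show ?thesis unfolding True
        using cp_edge_F[of 2 "s (min i 4)"] cp_edge_F[of 2 "s' (min i 4)"] assms[OF i4] by simp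
    next
      case False
      then have "s' (min i 4) = s (min i 4)" using assms[OF i4] by blast
      then show ?thesis by (simp only:)
    qed
  qed
  have contract: "contract_marked n (Theta, restrict (len 0) {0,1,2}, p) =
    (G', l', restrict (\<lambda>i. cp (p i)) {1..n})" for p
    by (simp only: contract_marked_def Let_def prod.case zero_edges)
  have "restrict (\<lambda>i. cp (restrict (\<lambda>i. edge_point Theta (k (min i 4)) (s (min i 4))) {1..n} i)) {1..n} =
    restrict (\<lambda>i. cp (restrict (\<lambda>i. edge_point Theta (k (min i 4)) (s' (min i 4))) {1..n} i)) {1..n}"
    by (rule restrict_ext) (simp only: restrict_apply' marks)
  then have "contract_marked n (marked_theta n 0 k s) = contract_marked n (marked_theta n 0 k s')"
    unfolding marked_theta_def contract by (simp only:)
  then show ?thesis by (simp only: theta_class_def)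
qed

section \<open>The cycle of cubes\<close>

text \<open>
  The sign selects a half of the edge, \<open>x i = 0\<close> is its midpoint and \<open>x i =
  1\<close> a vertex.
\<close>

definition position :: "(nat \<Rightarrow> int) \<Rightarrow> (nat \<Rightarrow> real) \<Rightarrow> nat \<Rightarrow> real" where
  "position \<epsilon> x i = (1 + real_of_int (\<epsilon> i) * x i) / 2"

definition cube :: "nat \<Rightarrow> (nat \<Rightarrow> nat) \<times> (nat \<Rightarrow> int) \<Rightarrow> (nat \<Rightarrow> real) \<Rightarrow> marked_graph set" where
  "cube n = (\<lambda>(w, \<epsilon>) x. theta_class n (x 0) w (position \<epsilon> x))"

definition cubes :: "((nat \<Rightarrow> nat) \<times> (nat \<Rightarrow> int)) set" where
  "cubes = ({1..4} \<rightarrow>\<^sub>E {0, 1, 2}) \<times> ({1..4} \<rightarrow>\<^sub>E {1, -1})"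

text \<open>
  The weight has to change its sign in two ways. When a mark at a vertex changes its edge, one
  letter changes; when the edges \<open>0\<close> and \<open>2\<close> are exchanged at \<open>c =
  1\<close>, all four letters do. Two factors of the antisymmetric kind \<open>letter_sign\<close>
  are invariant under the latter, so the marks one and two need a joint factor that changes its
  sign. Moreover, a nonzero weight without the letter \<open>2\<close> puts exactly one mark on
  the edge \<open>1\<close>, so that reversing this loop at \<open>c = 0\<close> changes exactly
  one sign \<open>\<epsilon> i\<close>.
\<close>

definition letter_sign :: "nat \<Rightarrow> int" where "letter_sign a = 1 - int a"

definition pair_sign :: "nat \<Rightarrow> nat \<Rightarrow> int" where
  "pair_sign a b = (if b = Suc a mod 3 then 1 else if a = Suc b mod 3 then -1 else 0)"

definition weight :: "(nat \<Rightarrow> nat) \<Rightarrow> int" where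
  "weight w = pair_sign (w 1) (w 2) * letter_sign (w 3) * letter_sign (w 4)"

definition coefficient :: "(nat \<Rightarrow> nat) \<times> (nat \<Rightarrow> int) \<Rightarrow> int" where
  "coefficient = (\<lambda>(w, \<epsilon>). weight w * (\<epsilon> 1 * \<epsilon> 2 * \<epsilon> 3 * \<epsilon> 4))"

definition third :: "nat \<Rightarrow> nat \<Rightarrow> nat" where "third a b = (if a = b then a else 3 - a - b)"

lemma marks_eq: "{1..4} = {1, 2, 3, 4::nat}"
  by auto

lemma finite_cubes: "finite cubes"
  unfolding cubes_def by (intro finite_cartesian_product finite_PiE) auto

lemma cubesD:
  assumes "(w, \<epsilon>) \<in> cubes" "i \<in> {1..4}"
  shows "w i \<in> {0, 1, 2}" "\<epsilon> i \<in> {1, -1}"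
proof -
  have *: "w \<in> {1..4} \<rightarrow>\<^sub>E {0, 1, 2}" "\<epsilon> \<in> {1..4} \<rightarrow>\<^sub>E {1, -1}" using assms(1) by (simp_all add: cubes_def)
  show "w i \<in> {0, 1, 2}" "\<epsilon> i \<in> {1, -1}" by (rule PiE_mem[OF *(1) assms(2)], rule PiE_mem[OF *(2) assms(2)])
qed

lemma cubes_extensional: "(w, \<epsilon>) \<in> cubes \<Longrightarrow> w \<in> extensional {1..4} \<and> \<epsilon> \<in> extensional {1..4}"
  by (auto simp: cubes_def PiE_iff)

lemma cubes_update_sign: "(w, \<epsilon>) \<in> cubes \<Longrightarrow> i \<in> {1..4} \<Longrightarrow> (w, \<epsilon>(i := - \<epsilon> i)) \<in> cubes"
  by (auto simp: cubes_def PiE_iff extensional_def)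

lemma cubes_update_letter: "(w, \<epsilon>) \<in> cubes \<Longrightarrow> i \<in> {1..4} \<Longrightarrow> a \<in> {0, 1, 2} \<Longrightarrow> (w(i := a), \<epsilon>) \<in> cubes"
  by (auto simp: cubes_def PiE_iff extensional_def)

lemma coefficient_update_sign: "i \<in> {1..4} \<Longrightarrow> coefficient (w, \<epsilon>(i := - \<epsilon> i)) = - coefficient (w, \<epsilon>)"
  unfolding marks_eq by (auto simp: coefficient_def)

lemma unit_boxD: "x \<in> unit_box \<Longrightarrow> 0 \<le> x i \<and> x i \<le> 1"
  by (simp add: unit_box_def)

lemma position_mem: "\<epsilon> i \<in> {1, -1} \<Longrightarrow> x \<in> unit_box \<Longrightarrow> position \<epsilon> x i \<in> {0..1}"
  using unit_boxD[of x i] by (auto simp: position_def)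

lemma third_simps:
  assumes "a \<in> {0, 1, 2}" "b \<in> {0, 1, 2}"
  shows "third a b \<in> {0, 1, 2}" "third (third a b) b = a"
    "pair_sign (third a b) b = - pair_sign a b" "pair_sign b (third a b) = - pair_sign b a"
proof -
  have "a = 0 \<or> a = 1 \<or> a = 2" "b = 0 \<or> b = 1 \<or> b = 2" using assms by simp_all
  then show "third a b \<in> {0, 1, 2}" "third (third a b) b = a"
    "pair_sign (third a b) b = - pair_sign a b" "pair_sign b (third a b) = - pair_sign b a"
    by (elim disjE; simp add: third_def pair_sign_def)+
qed

lemma pair_sign_reflect:
  "a \<in> {0, 1, 2} \<Longrightarrow> b \<in> {0, 1, 2} \<Longrightarrow> pair_sign (2 - a) (2 - b) = - pair_sign a b"
  by (simp, elim disjE; simp add: pair_sign_def)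

lemma letter_sign_reflect: "a \<in> {0, 1, 2} \<Longrightarrow> letter_sign (2 - a) = - letter_sign a"
  by (auto simp: letter_sign_def)

lemma face_pairingI:
  assumes "\<And>w \<epsilon>. (w, \<epsilon>) \<in> cubes \<Longrightarrow> \<iota> (w, \<epsilon>) \<in> cubes \<and> \<iota> (\<iota> (w, \<epsilon>)) = (w, \<epsilon>)"
    and "\<And>w \<epsilon>. (w, \<epsilon>) \<in> cubes \<Longrightarrow> coefficient (\<iota> (w, \<epsilon>)) = - coefficient (w, \<epsilon>)"
    and "\<And>w \<epsilon> x. (w, \<epsilon>) \<in> cubes \<Longrightarrow> x \<in> unit_box \<Longrightarrow> x i = b \<Longrightarrow> cube n (\<iota> (w, \<epsilon>)) x = cube n (w, \<epsilon>) x"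
  shows "\<exists>\<iota>. bij_betw \<iota> cubes cubes \<and> (\<forall>j\<in>cubes. coefficient (\<iota> j) = - coefficient j \<and>
    (\<forall>x\<in>unit_box. x i = b \<longrightarrow> cube n (\<iota> j) x = cube n j x))"
proof (intro exI conjI ballI impI)
  have inv: "\<iota> j \<in> cubes \<and> \<iota> (\<iota> j) = j" if "j \<in> cubes" for j
    using assms(1) that by (cases j) simp
  show "bij_betw \<iota> cubes cubes"
    by (rule bij_betw_byWitness[where f' = \<iota>]) (use inv in auto)
  show "coefficient (\<iota> j) = - coefficient j" if "j \<in> cubes" for j
    using assms(2) that by (cases j) simp
  show "cube n (\<iota> j) x = cube n j x" if "j \<in> cubes" "x \<in> unit_box" "x i = b" for j x
    using assms(3) that by (cases j) simp
qed

text \<open>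
  The index \<open>h w\<close> is that of a mark on the contracted edge, where the half does not
  matter; if there is none, it is that of the only mark on the loop \<open>1\<close>, which can be
  reversed.
\<close>

lemma face_contracted_edge:
  "\<exists>\<iota>. bij_betw \<iota> cubes cubes \<and> (\<forall>j\<in>cubes. coefficient (\<iota> j) = - coefficient j \<and>
    (\<forall>x\<in>unit_box. x 0 = 0 \<longrightarrow> cube n (\<iota> j) x = cube n j x))"
proof -
  define h where "h = (\<lambda>w :: nat \<Rightarrow> nat. if \<exists>i\<in>{1..4}. w i = 2 then SOME i. i \<in> {1..4} \<and> w i = 2
    else if w 1 = 1 then 1 else 2)"
  have h2: "h w \<in> {1..4} \<and> w (h w) = 2" if "\<exists>i\<in>{1..4}. w i = 2" for w
  proof -
    have ex: "\<exists>i. i \<in> {1..4} \<and> w i = 2" using that by blast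
    have eq: "h w = (SOME i. i \<in> {1..4} \<and> w i = 2)" by (simp only: h_def that if_True)
    show ?thesis unfolding eq by (rule someI_ex[OF ex])
  qed
  have h: "h w \<in> {1..4}" for w
  proof (cases "\<exists>i\<in>{1..4}. w i = 2")
    case False
    have "h w = (if w 1 = 1 then 1 else 2)" by (simp only: h_def False if_False)
    then show ?thesis by simp
  qed (use h2 in blast)
  define \<iota> :: "(nat \<Rightarrow> nat) \<times> (nat \<Rightarrow> int) \<Rightarrow> (nat \<Rightarrow> nat) \<times> (nat \<Rightarrow> int)" where
    "\<iota> = (\<lambda>(w, \<epsilon>). (w, if weight w = 0 then \<epsilon> else \<epsilon>(h w := - \<epsilon> (h w))))"
  show ?thesis
  proof (rule face_pairingI[where \<iota> = \<iota>])
    fix w \<epsilon> assume j: "(w, \<epsilon>) \<in> cubes"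
    show "\<iota> (w, \<epsilon>) \<in> cubes \<and> \<iota> (\<iota> (w, \<epsilon>)) = (w, \<epsilon>)"
      using cubes_update_sign[OF j h] j by (simp add: \<iota>_def)
    show "coefficient (\<iota> (w, \<epsilon>)) = - coefficient (w, \<epsilon>)"
      using coefficient_update_sign[OF h, of w \<epsilon>] by (simp add: \<iota>_def) (simp add: coefficient_def)
  next
    fix w \<epsilon> and x :: "nat \<Rightarrow> real" assume j: "(w, \<epsilon>) \<in> cubes" and x: "x \<in> unit_box" "x 0 = 0"
    have w3: "w i \<in> {0, 1, 2}" if "i \<in> {1..4}" for i by (rule cubesD(1)[OF j that])
    show "cube n (\<iota> (w, \<epsilon>)) x = cube n (w, \<epsilon>) x"
    proof (cases "weight w = 0")
      case False
      let ?e = "\<epsilon>(h w := - \<epsilon> (h w))"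
      have pos: "position \<epsilon> x i \<in> {0..1} \<and> position ?e x i \<in> {0..1}" if "i \<in> {1..4}" for i
        using position_mem[of \<epsilon> i x] position_mem[of ?e i x] x(1) cubesD(2)[OF j that] cubesD(2)[OF cubes_update_sign[OF j h] that] by blast
      have flip: "position ?e x i = (if i = h w then 1 - position \<epsilon> x i else position \<epsilon> x i)" for i
        by (simp add: position_def field_simps)
      have "theta_class n 0 w (position \<epsilon> x) = theta_class n 0 w (position ?e x)"
      proof (cases "\<exists>i\<in>{1..4}. w i = 2")
        case True
        show ?thesis
        proof (rule theta_class_contracted_edge)
          fix i :: nat assume i: "i \<in> {1..4}"
          show "w i \<in> {0, 1, 2} \<and> position \<epsilon> x i \<in> {0..1} \<and> position ?e x i \<in> {0..1} \<and>
            (w i = 2 \<or> position ?e x i = position \<epsilon> x i)"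
            using w3[OF i] pos[OF i] flip[of i] h2[OF True] by (cases "i = h w") simp_all
        qed
      next
        case no2: False
        have signs: "letter_sign (w 3) \<noteq> 0" "letter_sign (w 4) \<noteq> 0" "pair_sign (w 1) (w 2) \<noteq> 0"
          using False by (simp_all add: weight_def)
        have w01: "w i = 0 \<or> w i = 1" if "i \<in> {1..4}" for i
          using w3[OF that] no2 that by blast
        have w34: "w 3 = 0" "w 4 = 0" using signs(1,2) w01[of 3] w01[of 4] by (auto simp: letter_sign_def)
        have w12: "w 1 \<noteq> w 2" using signs(3) w01[of 1] by (auto simp: pair_sign_def)
        have hw: "h w = (if w 1 = 1 then 1 else 2)" by (simp only: h_def no2 if_False)
        have hit: "w i = 1 \<longleftrightarrow> i = h w" if i: "i \<in> {1..4}" for i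
        proof -
          consider "i = 1" | "i = 2" | "i = 3" | "i = 4" using i unfolding marks_eq by blast
          then show ?thesis by cases (use w34 w12 hw w01[of 1] w01[of 2] in auto)
        qed
        show ?thesis
        proof (rule theta_class_reverse_loop)
          fix i :: nat assume i: "i \<in> {1..4}"
          show "w i \<in> {0, 1, 2} \<and> position \<epsilon> x i \<in> {0..1} \<and>
            position ?e x i = (if w i = 1 then 1 - position \<epsilon> x i else position \<epsilon> x i)"
            using w3[OF i] pos[OF i] flip[of i] hit[OF i] by simp
        qed
      qed
      then show ?thesis using False x(2) by (simp add: \<iota>_def cube_def)
    qed (simp add: \<iota>_def)
  qed
qed

lemma face_equal_edges:
  "\<exists>\<iota>. bij_betw \<iota> cubes cubes \<and> (\<forall>j\<in>cubes. coefficient (\<iota> j) = - coefficient j \<and>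
    (\<forall>x\<in>unit_box. x 0 = 1 \<longrightarrow> cube n (\<iota> j) x = cube n j x))"
proof (rule face_pairingI[where \<iota> = "\<lambda>(w, \<epsilon>). (restrict (\<lambda>i. 2 - w i) {1..4}, \<epsilon>)"])
  fix w \<epsilon> assume j: "(w, \<epsilon>) \<in> cubes"
  have w: "w i \<in> {0, 1, 2}" if "i \<in> {1..4}" for i by (rule cubesD(1)[OF j that])
  have "restrict (\<lambda>i. 2 - restrict (\<lambda>i. 2 - w i) {1..4} i) {1..4} = w"
  proof (rule extensionalityI[of _ "{1..4}"])
    show "w \<in> extensional {1..4}" using cubes_extensional[OF j] by blast
    show "restrict (\<lambda>i. 2 - restrict (\<lambda>i. 2 - w i) {1..4} i) {1..4} i = w i" if "i \<in> {1..4}" for i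
      using w[OF that] that by (simp only: restrict_apply' insert_iff empty_iff) auto
  qed simp
  moreover have "(restrict (\<lambda>i. 2 - w i) {1..4}, \<epsilon>) \<in> cubes"
    using j w by (auto simp: cubes_def)
  ultimately show "(case (w, \<epsilon>) of (w, \<epsilon>) \<Rightarrow> (restrict (\<lambda>i. 2 - w i) {1..4}, \<epsilon>)) \<in> cubes \<and>
    (case case (w, \<epsilon>) of (w, \<epsilon>) \<Rightarrow> (restrict (\<lambda>i. 2 - w i) {1..4}, \<epsilon>) of (w, \<epsilon>) \<Rightarrow> (restrict (\<lambda>i. 2 - w i) {1..4}, \<epsilon>)) = (w, \<epsilon>)"
    by simp
  show "coefficient (case (w, \<epsilon>) of (w, \<epsilon>) \<Rightarrow> (restrict (\<lambda>i. 2 - w i) {1..4}, \<epsilon>)) = - coefficient (w, \<epsilon>)"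
  proof -
    have "w 1 \<in> {0, 1, 2}" "w 2 \<in> {0, 1, 2}" "w 3 \<in> {0, 1, 2}" "w 4 \<in> {0, 1, 2}" by (rule w; simp)+
    then show ?thesis
      by (simp add: coefficient_def weight_def pair_sign_reflect letter_sign_reflect del: insert_iff)
  qed
next
  fix w \<epsilon> and x :: "nat \<Rightarrow> real" assume j: "(w, \<epsilon>) \<in> cubes" and x: "x \<in> unit_box" "x 0 = 1"
  have "theta_class n 1 w (position \<epsilon> x) = theta_class n 1 (restrict (\<lambda>i. 2 - w i) {1..4}) (position \<epsilon> x)"
  proof (rule theta_class_swap_edges)
    fix i :: nat assume i: "i \<in> {1..4}"
    show "w i \<in> {0, 1, 2} \<and> restrict (\<lambda>i. 2 - w i) {1..4} i = 2 - w i \<and> position \<epsilon> x i \<in> {0..1} \<and>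
      position \<epsilon> x i = position \<epsilon> x i"
      using cubesD(1)[OF j i] position_mem[of \<epsilon> i, OF cubesD(2)[OF j i] x(1)] i by (simp only: restrict_apply')
  qed
  then show "cube n (case (w, \<epsilon>) of (w, \<epsilon>) \<Rightarrow> (restrict (\<lambda>i. 2 - w i) {1..4}, \<epsilon>)) x = cube n (w, \<epsilon>) x"
    by (simp add: cube_def x(2))
qed

lemma face_midpoint:
  assumes i: "i \<in> {1..4}"
  shows "\<exists>\<iota>. bij_betw \<iota> cubes cubes \<and> (\<forall>j\<in>cubes. coefficient (\<iota> j) = - coefficient j \<and>
    (\<forall>x\<in>unit_box. x i = 0 \<longrightarrow> cube n (\<iota> j) x = cube n j x))"
proof (rule face_pairingI[where \<iota> = "\<lambda>(w, \<epsilon>). (w, \<epsilon>(i := - \<epsilon> i))"])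
  fix w :: "nat \<Rightarrow> nat" and \<epsilon> and x :: "nat \<Rightarrow> real" assume "x i = 0"
  then have "position (\<epsilon>(i := - \<epsilon> i)) x = position \<epsilon> x"
    by (auto simp: position_def)
  then show "cube n (case (w, \<epsilon>) of (w, \<epsilon>) \<Rightarrow> (w, \<epsilon>(i := - \<epsilon> i))) x = cube n (w, \<epsilon>) x"
    by (simp add: cube_def)
qed (use i cubes_update_sign coefficient_update_sign in auto)

text \<open>
  At a vertex the letter of the mark is irrelevant and can be replaced so as to negate the weight.
\<close>

lemma face_vertex:
  assumes i: "i \<in> {1..4}"
  shows "\<exists>\<iota>. bij_betw \<iota> cubes cubes \<and> (\<forall>j\<in>cubes. coefficient (\<iota> j) = - coefficient j \<and>
    (\<forall>x\<in>unit_box. x i = 1 \<longrightarrow> cube n (\<iota> j) x = cube n j x))"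
proof -
  define g where "g = (\<lambda>w. if i \<le> 2 then third (w i) (w (3 - i)) else 2 - w i)"
  have g: "g w \<in> {0, 1, 2}" "g (w(i := g w)) = w i" "weight (w(i := g w)) = - weight w"
    if "(w, \<epsilon>) \<in> cubes" for w \<epsilon>
  proof -
    have w: "w j \<in> {0, 1, 2}" if "j \<in> {1..4}" for j by (rule cubesD(1)[OF \<open>(w, \<epsilon>) \<in> cubes\<close> that])
    have w': "w 1 \<in> {0, 1, 2}" "w 2 \<in> {0, 1, 2}" "w 3 \<in> {0, 1, 2}" "w 4 \<in> {0, 1, 2}" by (rule w; simp)+
    have "g w \<in> {0, 1, 2} \<and> g (w(i := g w)) = w i"
    proof (cases "i \<le> 2")
      case True
      then have "3 - i \<in> {1..4}" "3 - i \<noteq> i" using i unfolding atLeastAtMost_iff by arith+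
      then show ?thesis using third_simps(1,2)[OF w[OF i] w[of "3 - i"]] True by (simp add: g_def del: insert_iff)
    next
      case False
      then show ?thesis using w[OF i] by (auto simp: g_def)
    qed
    then show "g w \<in> {0, 1, 2}" "g (w(i := g w)) = w i" by blast+
    consider "i = 1" | "i = 2" | "i = 3" | "i = 4" using i unfolding marks_eq by blast
    then show "weight (w(i := g w)) = - weight w"
      by cases (simp_all add: g_def weight_def third_simps(3)[OF w'(1,2), unfolded One_nat_def] third_simps(4)[OF w'(2,1), unfolded One_nat_def]
        letter_sign_reflect[OF w'(3)] letter_sign_reflect[OF w'(4)])
  qed
  show ?thesis
  proof (rule face_pairingI[where \<iota> = "\<lambda>(w, \<epsilon>). (w(i := g w), \<epsilon>)"])
    fix w \<epsilon> assume j: "(w, \<epsilon>) \<in> cubes"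
    show "(case (w, \<epsilon>) of (w, \<epsilon>) \<Rightarrow> (w(i := g w), \<epsilon>)) \<in> cubes \<and>
      (case case (w, \<epsilon>) of (w, \<epsilon>) \<Rightarrow> (w(i := g w), \<epsilon>) of (w, \<epsilon>) \<Rightarrow> (w(i := g w), \<epsilon>)) = (w, \<epsilon>)"
      using cubes_update_letter[OF j i g(1)[OF j]] g(2)[OF j] by simp
    show "coefficient (case (w, \<epsilon>) of (w, \<epsilon>) \<Rightarrow> (w(i := g w), \<epsilon>)) = - coefficient (w, \<epsilon>)"
      using g(3)[OF j] by (simp add: coefficient_def)
  next
    fix w \<epsilon> and x :: "nat \<Rightarrow> real" assume j: "(w, \<epsilon>) \<in> cubes" and "x i = 1"
    then have "position \<epsilon> x i \<in> {0, 1}" using cubesD(2)[OF j i] by (auto simp: position_def)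
    then have "theta_class n (x 0) (w(i := g w)) (position \<epsilon> x) = theta_class n (x 0) w (position \<epsilon> x)"
      by (intro theta_class_at_vertices) auto
    then show "cube n (case (w, \<epsilon>) of (w, \<epsilon>) \<Rightarrow> (w(i := g w), \<epsilon>)) x = cube n (w, \<epsilon>) x"
      by (simp add: cube_def)
  qed
qed

lemma cube_faces:
  assumes "i < 5" "b \<in> {0, 1::real}"
  shows "\<exists>\<iota>. bij_betw \<iota> cubes cubes \<and> (\<forall>j\<in>cubes. coefficient (\<iota> j) = - coefficient j \<and>
    (\<forall>x\<in>unit_box. x i = b \<longrightarrow> cube n (\<iota> j) x = cube n j x))"
proof -
  consider "i = 0" "b = 0" | "i = 0" "b = 1" | "i \<in> {1..4}" "b = 0" | "i \<in> {1..4}" "b = 1"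
  proof -
    have "b = 0 \<or> b = 1" "i = 0 \<or> i \<in> {1..4}" using assms by auto
    then show ?thesis using that by blast
  qed
  then show ?thesis
    by cases (use face_contracted_edge face_equal_edges face_midpoint face_vertex in \<open>simp_all only:\<close>)
qed

lemma continuous_map_cube:
  assumes "j \<in> cubes"
  shows "continuous_map (top_of_set unit_box) (X_space 2 n) (cube n j)"
proof -
  obtain w \<epsilon> where j: "j = (w, \<epsilon>)" "(w, \<epsilon>) \<in> cubes" using assms by (cases j) auto
  have coord: "continuous_on unit_box (\<lambda>x::nat \<Rightarrow> real. x i)" for i
    by (rule continuous_on_subset[OF continuous_on_product_coordinates]) simp
  have "continuous_map (top_of_set unit_box) (X_space 2 n) (\<lambda>x. theta_class n (x 0) w (\<lambda>i. position \<epsilon> x i))"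
  proof (rule continuous_map_theta_class[where s = "\<lambda>i x. position \<epsilon> x i"])
    show "continuous_map (top_of_set unit_box) (top_of_set {0..1}) (\<lambda>x. position \<epsilon> x i)" if "i \<in> {1..4}" for i
      using position_mem[of \<epsilon> i, OF cubesD(2)[OF j(2) that]]
      by (auto simp: position_def[abs_def] intro!: continuous_intros coord)
  qed (use coord unit_boxD cubesD(1)[OF j(2)] in auto)
  then show ?thesis by (simp add: j cube_def)
qed

section \<open>Detection by distances\<close>

text \<open>
  For marks \<open>1, 2, 3\<close> on different edges that are connected through a common vertex
  the triangle of their distances is a tripod, whose legs are recovered by the Gromov products.
  The position of the fourth mark follows from its distance to the third, which lies on the same
  edge, and the length of the short edge from the cycle through the marks two and four.
\<close>

definition pos_a :: "(nat \<Rightarrow> nat \<Rightarrow> real) \<Rightarrow> real" where "pos_a D = (D 1 3 + D 1 2 - D 2 3) / 2"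
definition pos_b :: "(nat \<Rightarrow> nat \<Rightarrow> real) \<Rightarrow> real" where "pos_b D = (D 1 2 + D 2 3 - D 1 3) / 2"
definition pos_q :: "(nat \<Rightarrow> nat \<Rightarrow> real) \<Rightarrow> real" where "pos_q D = (D 1 3 + D 2 3 - D 1 2) / 2"
definition pos_m :: "(nat \<Rightarrow> nat \<Rightarrow> real) \<Rightarrow> real" where "pos_m D = D 3 4 + pos_q D"
definition short_edge :: "(nat \<Rightarrow> nat \<Rightarrow> real) \<Rightarrow> real" where "short_edge D = D 2 4 + pos_m D + pos_b D - 1"

text \<open>
  In the third coordinate the position of the mark two is compared with a fixed fraction of the
  length of its edge, so that the sign of this coordinate depends on a single coordinate of the
  cube.
\<close>

definition detector :: "(nat \<Rightarrow> nat \<Rightarrow> real) \<Rightarrow> nat \<Rightarrow> real" where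
  "detector D i =
    (if i = 0 then short_edge D - 95/100 else if i = 1 then pos_a D - 46/100
     else if i = 2 then pos_b D - 47/95 * short_edge D else if i = 3 then pos_q D - 2/100
     else if i = 4 then pos_m D - 52/100 else D 1 3 + D 3 4 - D 1 4 - 1/200)"

lemmas detector_defs = detector_def pos_a_def pos_b_def pos_m_def pos_q_def short_edge_def

lemma detector_cong:
  "(\<And>i j. i \<in> {1..4} \<Longrightarrow> j \<in> {1..4} \<Longrightarrow> D i j = D' i j) \<Longrightarrow> detector D m = detector D' m"
  by (simp add: detector_defs)

lemma detector_zero:
  assumes "\<forall>i<5. detector D i = 0" "detector D 5 \<le> 0"
  shows "D 1 3 = 48/100" "D 3 4 = 50/100" "D 1 2 = 93/100" "D 2 3 = 49/100" "D 2 4 = 96/100"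
    "975/1000 \<le> D 1 4"
proof -
  have "detector D 0 = 0" "detector D 1 = 0" "detector D 2 = 0" "detector D 3 = 0" "detector D 4 = 0"
    using assms(1) by simp_all
  then have *: "short_edge D = 95/100" "pos_a D = 46/100" "pos_b D = 47/95 * short_edge D" "pos_q D = 2/100" "pos_m D = 52/100"
    by (simp_all add: detector_def)
  from *(3) have "pos_b D = 47/100" unfolding *(1) by simp
  have solve: "aq = 48/100 \<and> qm = 50/100 \<and> ab = 93/100 \<and> bq = 49/100 \<and> bm = 96/100"
    if "bm + (qm + (aq + bq - ab) / 2) + (ab + bq - aq) / 2 - 1 = 95/100" "(aq + ab - bq) / 2 = 46/100"
      "(ab + bq - aq) / 2 = 47/100" "(aq + bq - ab) / 2 = 2/100" "qm + (aq + bq - ab) / 2 = 52/100"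
    for aq ab bq qm bm :: real
  proof -
    have *: "aq + ab - bq = 92/100" "ab + bq - aq = 94/100" "aq + bq - ab = 4/100" using that(2-4) by simp_all
    have 1: "aq = 48/100" "ab = 93/100" "bq = 49/100" using * by linarith+
    have 2: "qm = 50/100" using that(5) 1 by simp
    have "bm = 96/100" using that(1) 1 2 by simp
    then show ?thesis using 1 2 by blast
  qed
  show "D 1 3 = 48/100" "D 3 4 = 50/100" "D 1 2 = 93/100" "D 2 3 = 49/100" "D 2 4 = 96/100"
    using solve[OF *(1)[unfolded short_edge_def pos_m_def pos_q_def pos_b_def] *(2)[unfolded pos_a_def]
      \<open>pos_b D = 47/100\<close>[unfolded pos_b_def] *(4)[unfolded pos_q_def] *(5)[unfolded pos_m_def pos_q_def]] by blast+
  then show "975/1000 \<le> D 1 4" using assms(2) by (simp add: detector_def)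
qed

text \<open>
  The last coordinate is a slack in the triangle inequality for the marks \<open>1, 3, 4\<close>.
  Its constant \<open>-1/200\<close> turns the vanishing slack of the rigid configuration into a
  negative value, yet leaves a lower bound for the distance of the marks \<open>1\<close> and
  \<open>4\<close> in the hypotheses of the rigidity theorem.
\<close>

lemma detected_configuration:
  fixes c k t
  defines "D \<equiv> \<lambda>i j. theta_dist c (k i) (t i) (k j) (t j)"
  assumes "configuration 4 c k t" "\<forall>i<5. detector D i = 0" "detector D 5 \<le> 0"
  shows "k 3 = k 4" "k 2 = 2" "k 1 \<noteq> 2" "k 4 \<noteq> 2" "k 1 \<noteq> k 4" "c = 95/100"
    "t 1 = 46/100 \<and> t 2 = 47/100 \<and> t 3 = 2/100 \<and> t 4 = 52/100 \<or>
     t 1 = 54/100 \<and> t 2 = 48/100 \<and> t 3 = 98/100 \<and> t 4 = 48/100"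
    "detector D 5 = - 1/200"
proof -
  have conf: "0 \<le> c" "c \<le> 1" "\<And>i. i \<in> {1..4} \<Longrightarrow> k i \<in> {0,1,2} \<and> 0 \<le> t i \<and> t i \<le> len c (k i)"
    using assms(2) by (auto simp: configuration_def)
  note Z = detector_zero[OF assms(3,4)]
  interpret four_marks c "k 1" "k 2" "k 3" "k 4" "t 1" "t 2" "t 3" "t 4"
    by unfold_locales (use conf(1,2) conf(3)[of 1] conf(3)[of 2] conf(3)[of 3] conf(3)[of 4] Z in \<open>simp_all add: D_def\<close>)
  show k': "k 3 = k 4" "k 2 = 2" "k 1 \<noteq> 2" "k 4 \<noteq> 2" "k 1 \<noteq> k 4" "c = 95/100"
    and t': "t 1 = 46/100 \<and> t 2 = 47/100 \<and> t 3 = 2/100 \<and> t 4 = 52/100 \<or>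
     t 1 = 54/100 \<and> t 2 = 48/100 \<and> t 3 = 98/100 \<and> t 4 = 48/100"
    using four_marks_unique distinct by auto
  have L: "len c (k 1) = 1" "len c (k 4) = 1" using k' by (simp_all add: len_def)
  have "k 1 < 2" "k 4 < 2" using conf(3)[of 1] conf(3)[of 4] k' by auto
  then have near: "theta_dist c (k 1) (46/100) (k 4) (52/100) = 98/100"
    unfolding k'(6) using theta_dist_near(6)[of "95/100" "46/100" "47/100" "2/100" "52/100" "k 1" "k 4"] k'(5) by simp
  have "D 1 4 = 98/100"
    using t'
  proof
    assume "t 1 = 54/100 \<and> t 2 = 48/100 \<and> t 3 = 98/100 \<and> t 4 = 48/100"
    then have t14: "t 1 = 54/100" "t 4 = 48/100" by blast+
    have "t 1 = len c (k 1) - 46/100" "t 4 = len c (k 4) - 52/100" unfolding t14 L by simp_all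
    then show ?thesis using near by (simp only: D_def theta_dist_flip)
  next
    assume "t 1 = 46/100 \<and> t 2 = 47/100 \<and> t 3 = 2/100 \<and> t 4 = 52/100"
    then have t14: "t 1 = 46/100" "t 4 = 52/100" by blast+
    show ?thesis unfolding D_def t14 by (rule near)
  qed
  note D14 = this
  have "detector D 5 = D 1 3 + D 3 4 - D 1 4 - 1/200" by (simp add: detector_def)
  also have "\<dots> = - 1/200" unfolding Z(1,2) D14 by simp
  finally show "detector D 5 = - 1/200" .
qed

text \<open>
  The two cubes through the rigid configuration. They have opposite signs
  \<open>\<epsilon>\<close>, since the symmetry of the theta graph reverses all edges, and
  \<open>hit_point\<close> is the same in both.
\<close>

definition hit_letters :: "nat \<Rightarrow> nat" where
  "hit_letters = restrict (\<lambda>i. if i = 1 then 1 else if i = 2 then 2 else 0) {1..4}"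

definition hit_signs :: "int \<Rightarrow> nat \<Rightarrow> int" where
  "hit_signs \<delta> = restrict (\<lambda>i. if i = 4 then \<delta> else - \<delta>) {1..4}"

definition hit_point :: "nat \<Rightarrow> real" where
  "hit_point i = (if i = 0 then 19/20 else if i = 1 then 2/25 else if i = 2 then 1/95 else if i = 3 then 24/25 else 1/25)"

definition hit_cubes :: "((nat \<Rightarrow> nat) \<times> (nat \<Rightarrow> int)) set" where
  "hit_cubes = {(hit_letters, hit_signs 1), (hit_letters, hit_signs (-1))}"

abbreviation "distances C \<equiv> \<lambda>i j. mark_dist i j C"

lemma cube_dist:
  assumes "n \<ge> 4" "(w, \<epsilon>) \<in> cubes" "x \<in> unit_box" "i \<in> {1..4}" "j \<in> {1..4}"
  shows "mark_dist i j (cube n (w, \<epsilon>) x) = theta_dist (x 0) (w i) (len (x 0) (w i) * position \<epsilon> x i)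
    (w j) (len (x 0) (w j) * position \<epsilon> x j)"
  unfolding cube_def prod.case
proof (rule theta_class_dist)
  fix k :: nat assume k: "k \<in> {1..4}"
  show "w k \<in> {0, 1, 2} \<and> position \<epsilon> x k \<in> {0..1}"
    using cubesD(1)[OF assms(2) k] position_mem[of \<epsilon> k, OF cubesD(2)[OF assms(2) k] assms(3)] by blast
qed (use assms unit_boxD in auto)

lemma cube_detector:
  assumes "n \<ge> 4" "(w, \<epsilon>) \<in> cubes" "x \<in> unit_box"
  shows "detector (distances (cube n (w, \<epsilon>) x)) m = detector (\<lambda>i j. theta_dist (x 0)
    (w i) (len (x 0) (w i) * position \<epsilon> x i) (w j) (len (x 0) (w j) * position \<epsilon> x j)) m"
  by (rule detector_cong) (rule cube_dist[OF assms])

lemma hit_cubes_mem: "hit_cubes \<subseteq> cubes"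
  by (auto simp: hit_cubes_def cubes_def hit_letters_def hit_signs_def)

lemma cube_hit:
  assumes n: "n \<ge> 4" and j: "(w, \<epsilon>) \<in> cubes" and coeff: "coefficient (w, \<epsilon>) \<noteq> 0" and x: "x \<in> unit_box"
    and zero: "\<forall>i<5. detector (distances (cube n (w, \<epsilon>) x)) i = 0" "detector (distances (cube n (w, \<epsilon>) x)) 5 \<le> 0"
  shows "(w, \<epsilon>) \<in> hit_cubes \<and> (\<forall>i<5. x i = hit_point i)"
proof -
  let ?t = "\<lambda>i. len (x 0) (w i) * position \<epsilon> x i"
  have "configuration 4 (x 0) w ?t"
    unfolding configuration_def
  proof (intro conjI ballI)
    fix i :: nat assume i: "i \<in> {1..4}"
    show "w i \<in> {0,1,2}" by (rule cubesD(1)[OF j i])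
    show "0 \<le> ?t i" "?t i \<le> len (x 0) (w i)"
      using position_mem[of \<epsilon> i, OF cubesD(2)[OF j i] x] unit_boxD[OF x, of 0] by (auto simp: len_def intro: mult_left_le)
  qed (use unit_boxD[OF x] in auto)
  note R = detected_configuration[OF this zero[unfolded cube_detector[OF n j x]]]
  have ls: "letter_sign (w 3) \<noteq> 0" "letter_sign (w 4) \<noteq> 0" using coeff by (auto simp: coefficient_def weight_def)
  have w4: "w 4 = 0" using ls(2) cubesD(1)[OF j, of 4] R(4) by (auto simp: letter_sign_def)
  have w: "w 1 = 1" "w 2 = 2" "w 3 = 0"
    using w4 cubesD(1)[OF j, of 1] R(1,2,3,5) by auto
  have wh: "w = hit_letters"
  proof (rule extensionalityI[of _ "{1..4}"])
    show "w i = hit_letters i" if "i \<in> {1..4}" for i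
      using that w w4 unfolding marks_eq by (auto simp: hit_letters_def)
  qed (use cubes_extensional[OF j] in \<open>auto simp: hit_letters_def\<close>)
  have eps: "\<epsilon> i = 1 \<or> \<epsilon> i = -1" if "i \<in> {1..4}" for i using cubesD(2)[OF j that] by auto
  have bx: "0 \<le> x i" for i using unit_boxD[OF x] by blast
  have x0: "x 0 = 19/20" using R(6) by simp
  have t: "?t 1 = (1 + \<epsilon> 1 * x 1) / 2" "?t 2 = 19/20 * ((1 + \<epsilon> 2 * x 2) / 2)" "?t 3 = (1 + \<epsilon> 3 * x 3) / 2"
    "?t 4 = (1 + \<epsilon> 4 * x 4) / 2"
    using w w4 by (simp_all add: x0 len_def position_def)
  have point: "(\<forall>i<5. x i = hit_point i)" if "x 1 = 2/25" "x 2 = 1/95" "x 3 = 24/25" "x 4 = 1/25"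
    using that x0 by (auto simp: hit_point_def less_Suc_eq numeral_eq_Suc)
  have signs: "\<epsilon> = hit_signs \<delta>" if "\<epsilon> 1 = - \<delta>" "\<epsilon> 2 = - \<delta>" "\<epsilon> 3 = - \<delta>" "\<epsilon> 4 = \<delta>" for \<delta>
  proof (rule extensionalityI[of _ "{1..4}"])
    show "\<epsilon> i = hit_signs \<delta> i" if "i \<in> {1..4}" for i
      using that \<open>\<epsilon> 1 = - \<delta>\<close> \<open>\<epsilon> 2 = - \<delta>\<close> \<open>\<epsilon> 3 = - \<delta>\<close> \<open>\<epsilon> 4 = \<delta>\<close> unfolding marks_eq
      by (auto simp: hit_signs_def)
  qed (use cubes_extensional[OF j] in \<open>auto simp: hit_signs_def\<close>)
  from R(7) show ?thesis
    unfolding t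
  proof
    assume T: "(1 + \<epsilon> 1 * x 1) / 2 = 46/100 \<and> 19/20 * ((1 + \<epsilon> 2 * x 2) / 2) = 47/100 \<and>
      (1 + \<epsilon> 3 * x 3) / 2 = 2/100 \<and> (1 + \<epsilon> 4 * x 4) / 2 = 52/100"
    have e: "\<epsilon> 1 = -1" "\<epsilon> 2 = -1" "\<epsilon> 3 = -1" "\<epsilon> 4 = 1"
      using T eps[of 1] eps[of 2] eps[of 3] eps[of 4] bx[of 1] bx[of 2] bx[of 3] bx[of 4] by auto
    have \<epsilon>: "\<epsilon> = hit_signs 1" by (rule signs) (use e in auto)
    have "x 1 = 2/25" "x 2 = 1/95" "x 3 = 24/25" "x 4 = 1/25" using T e by (auto simp: field_simps)
    then have "\<forall>i<5. x i = hit_point i" by (rule point)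
    then show ?thesis unfolding hit_cubes_def wh \<epsilon> by blast
  next
    assume T: "(1 + \<epsilon> 1 * x 1) / 2 = 54/100 \<and> 19/20 * ((1 + \<epsilon> 2 * x 2) / 2) = 48/100 \<and>
      (1 + \<epsilon> 3 * x 3) / 2 = 98/100 \<and> (1 + \<epsilon> 4 * x 4) / 2 = 48/100"
    have e: "\<epsilon> 1 = 1" "\<epsilon> 2 = 1" "\<epsilon> 3 = 1" "\<epsilon> 4 = -1"
      using T eps[of 1] eps[of 2] eps[of 3] eps[of 4] bx[of 1] bx[of 2] bx[of 3] bx[of 4] by auto
    have \<epsilon>: "\<epsilon> = hit_signs (-1)" by (rule signs) (use e in auto)
    have "x 1 = 2/25" "x 2 = 1/95" "x 3 = 24/25" "x 4 = 1/25" using T e by (auto simp: field_simps)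
    then have "\<forall>i<5. x i = hit_point i" by (rule point)
    then show ?thesis unfolding hit_cubes_def wh \<epsilon> by blast
  qed
qed

lemma detector_near_hit:
  assumes n: "n \<ge> 4" and j: "j \<in> hit_cubes" and x: "x \<in> unit_box"
    and near: "\<forall>i<5. \<bar>x i - hit_point i\<bar> \<le> 1/1000"
  defines "\<Delta> \<equiv> detector (distances (cube n j x))"
  shows "\<Delta> 0 = x 0 - 19/20" "\<Delta> 1 = - (x 1 - 2/25) / 2" "\<Delta> 2 = - (x 0 / 2) * (x 2 - 1/95)"
    "\<Delta> 3 = - (x 3 - 24/25) / 2" "\<Delta> 4 = (x 4 - 1/25) / 2" "\<Delta> 5 = - 1/200"
proof -
  obtain \<delta> where \<delta>: "j = (hit_letters, hit_signs \<delta>)" "\<delta> \<in> {1, -1}" using j by (auto simp: hit_cubes_def)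
  let ?w = hit_letters
  have mem: "(?w, hit_signs d) \<in> cubes" if "d \<in> {1, -1}" for d
    using hit_cubes_mem that by (auto simp: hit_cubes_def)
  let ?D = "\<lambda>\<delta> i j. theta_dist (x 0) (?w i) (len (x 0) (?w i) * position (hit_signs \<delta>) x i)
    (?w j) (len (x 0) (?w j) * position (hit_signs \<delta>) x j)"
  have "?D \<delta> i j = ?D 1 i j" if "i \<in> {1..4}" "j \<in> {1..4}" for i j
  proof (cases "\<delta> = 1")
    case False
    then have "\<delta> = -1" using \<delta>(2) by blast
    then have flip: "len (x 0) (?w i) * position (hit_signs \<delta>) x i =
        len (x 0) (?w i) - len (x 0) (?w i) * position (hit_signs 1) x i" if "i \<in> {1..4}" for i
      using that by (simp add: position_def hit_signs_def field_simps)
    show ?thesis unfolding flip[OF that(1)] flip[OF that(2)] by (rule theta_dist_flip)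
  qed simp
  then have \<Delta>: "\<Delta> m = detector (?D 1) m" for m
    unfolding \<Delta>_def \<delta>(1) cube_detector[OF n mem[OF \<delta>(2)] x] by (rule detector_cong)
  define ta tb tq tm where "ta = (1 - x 1) / 2" and "tb = x 0 * ((1 - x 2) / 2)"
    and "tq = (1 - x 3) / 2" and "tm = (1 + x 4) / 2"
  have t: "len (x 0) (?w 1) * position (hit_signs 1) x 1 = ta" "len (x 0) (?w 2) * position (hit_signs 1) x 2 = tb"
    "len (x 0) (?w 3) * position (hit_signs 1) x 3 = tq" "len (x 0) (?w 4) * position (hit_signs 1) x 4 = tm"
    by (simp_all add: position_def hit_signs_def hit_letters_def len_def ta_def tb_def tq_def tm_def)
  have w: "?w 1 = 1" "?w 2 = 2" "?w 3 = 0" "?w 4 = 0" by (simp_all add: hit_letters_def)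
  have N: "\<bar>x 0 - 19/20\<bar> \<le> 1/1000" "\<bar>x 1 - 2/25\<bar> \<le> 1/1000" "\<bar>x 2 - 1/95\<bar> \<le> 1/1000" "\<bar>x 3 - 24/25\<bar> \<le> 1/1000"
    "\<bar>x 4 - 1/25\<bar> \<le> 1/1000"
    using near[rule_format, of 0] near[rule_format, of 1] near[rule_format, of 2] near[rule_format, of 3] near[rule_format, of 4]
    by (simp_all add: hit_point_def)
  have x2: "x 2 \<le> 1/95 + 1/1000" "1/95 - 1/1000 \<le> x 2" using N(3) by linarith+
  have x0: "949/1000 \<le> x 0" "x 0 \<le> 951/1000" using N(1) by linarith+
  have "4942/10000 \<le> (1 - x 2) / 2" "(1 - x 2) / 2 \<le> 4953/10000" using x2 by simp_all
  note b = x0 this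
  have "949/1000 * (4942/10000) \<le> tb" "tb \<le> 951/1000 * (4953/10000)"
    unfolding tb_def by (rule mult_mono; use b in linarith)+
  then have "\<bar>tb - 47/100\<bar> \<le> 2/1000" by linarith
  moreover have "2 * ta = 1 - x 1" "2 * tq = 1 - x 3" "2 * tm = 1 + x 4" by (simp_all add: ta_def tq_def tm_def)
  then have "\<bar>ta - 46/100\<bar> \<le> 1/1000" "\<bar>tq - 2/100\<bar> \<le> 1/1000" "\<bar>tm - 52/100\<bar> \<le> 1/1000"
    using N(2,4,5) by (simp_all only: abs_le_iff) linarith+
  moreover have "\<bar>x 0 - 95/100\<bar> \<le> 1/1000" using N(1) by linarith
  ultimately have T: "\<bar>x 0 - 95/100\<bar> \<le> 1/1000" "\<bar>ta - 46/100\<bar> \<le> 1/1000" "\<bar>tb - 47/100\<bar> \<le> 2/1000"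
    "\<bar>tq - 2/100\<bar> \<le> 1/1000" "\<bar>tm - 52/100\<bar> \<le> 1/1000"
    by blast+
  have D: "?D 1 1 3 = ta + tq" "?D 1 3 4 = tm - tq" "?D 1 1 2 = ta + tb" "?D 1 2 3 = tb + tq"
    "?D 1 2 4 = 1 + x 0 - tb - tm" "?D 1 1 4 = ta + tm"
    unfolding t unfolding w by (rule theta_dist_near[OF T, of 1 0]; simp)+
  have pos: "pos_a (?D 1) = ta" "pos_b (?D 1) = tb" "pos_q (?D 1) = tq" "pos_m (?D 1) = tm" "short_edge (?D 1) = x 0"
    unfolding short_edge_def pos_m_def pos_a_def pos_b_def pos_q_def D by simp_all
  show "\<Delta> 0 = x 0 - 19/20" "\<Delta> 1 = - (x 1 - 2/25) / 2" "\<Delta> 2 = - (x 0 / 2) * (x 2 - 1/95)"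
    "\<Delta> 3 = - (x 3 - 24/25) / 2" "\<Delta> 4 = (x 4 - 1/25) / 2" "\<Delta> 5 = - 1/200"
    unfolding \<Delta> detector_def pos D by (simp_all add: ta_def tb_def tq_def tm_def field_simps)
qed

lemma continuous_map_detector:
  assumes "n \<ge> 4"
  shows "continuous_map (X_space 2 n) euclideanreal (\<lambda>C. detector (distances C) m)"
proof -
  have D: "continuous_map (X_space 2 n) euclideanreal (mark_dist i j)" if "i \<in> {1..4}" "j \<in> {1..4}" for i j
    unfolding X_space_def
    by (rule continuous_map_from_subtopology, rule continuous_map_mark_dist) (use that assms in auto)
  have half: "continuous_map (X_space 2 n) euclideanreal (\<lambda>C. f C / 2)"
    if "continuous_map (X_space 2 n) euclideanreal f" for f
    using continuous_map_real_mult_right[OF that, of "1/2"] by simp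
  have pos: "continuous_map (X_space 2 n) euclideanreal (\<lambda>C. pos_a (distances C))"
    "continuous_map (X_space 2 n) euclideanreal (\<lambda>C. pos_b (distances C))"
    "continuous_map (X_space 2 n) euclideanreal (\<lambda>C. pos_q (distances C))"
    unfolding pos_a_def pos_b_def pos_q_def by (intro half continuous_map_diff continuous_map_add D; simp)+
  have m: "continuous_map (X_space 2 n) euclideanreal (\<lambda>C. pos_m (distances C))"
    unfolding pos_m_def by (intro continuous_map_add D pos) simp_all
  have s: "continuous_map (X_space 2 n) euclideanreal (\<lambda>C. short_edge (distances C))"
    unfolding short_edge_def by (intro continuous_map_diff continuous_map_add D pos m) simp_all
  have if_cont: "continuous_map (X_space 2 n) euclideanreal (\<lambda>C. if P then f C else g C)"
    if "continuous_map (X_space 2 n) euclideanreal f" "continuous_map (X_space 2 n) euclideanreal g" for P f g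
    using that by (cases P) simp_all
  show ?thesis
    unfolding detector_def
    by (intro if_cont continuous_map_diff continuous_map_add continuous_map_real_mult_left pos m s D) simp_all
qed

theorem mainTheorem9:
  fixes n :: nat
  assumes "n \<ge> 4"
  shows "\<not> contractible_space (X_space 2 n)"
proof
  assume contr: "contractible_space (X_space 2 n)"
  let ?u = "\<lambda>j x. detector (distances (cube n j x))"
  define \<sigma> :: "nat \<Rightarrow> int" where "\<sigma> i = (if i \<in> {1, 2, 3} then -1 else 1)" for i
  have "\<forall>\<^sub>F N in sequentially. (\<Sum>j\<in>cubes. coefficient j * cell_count 5 N (?u j)) = 0"
  proof (rule cubical_cycle_count[OF contr finite_cubes])
    show "continuous_map (X_space 2 n) euclideanreal (\<lambda>C. detector (distances C) i)" for i
      by (rule continuous_map_detector[OF assms])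
    show False if C: "C \<in> topspace (X_space 2 n)" and zero: "\<forall>i\<le>5. detector (distances C) i = 0" for C
    proof -
      obtain c k t where conf: "configuration n c k t"
        and D: "\<And>i j. i \<in> {1..n} \<Longrightarrow> j \<in> {1..n} \<Longrightarrow> mark_dist i j C = theta_dist c (k i) (t i) (k j) (t j)"
        using X_space_configuration[OF C] by blast
      let ?D = "\<lambda>i j. theta_dist c (k i) (t i) (k j) (t j)"
      have eq: "detector ?D m = detector (distances C) m" for m
        by (rule detector_cong) (use D assms in auto)
      have "configuration 4 c k t" using conf assms by (auto simp: configuration_def)
      from detected_configuration(8)[OF this] show False
        using zero unfolding eq by simp
    qed
  qed (use continuous_map_cube cube_faces in auto)
  moreover obtain s :: int where s: "s \<in> {1, -1}" and unique: "\<forall>u \<theta> \<sigma> \<eta>.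
    (\<forall>i\<le>5. continuous_on unit_box (\<lambda>x. u x i)) \<longrightarrow>
    (\<forall>i<5. 0 < \<theta> i \<and> \<theta> i < 1 \<and> \<sigma> i \<in> {1, -1}) \<longrightarrow> \<eta> > 0 \<longrightarrow>
    (\<forall>x\<in>unit_box. (\<forall>i<5. \<bar>x i - \<theta> i\<bar> \<le> \<eta>) \<longrightarrow>
       u x 5 \<le> 0 \<and> (\<forall>i<5. u x i > 0 \<longleftrightarrow> real_of_int (\<sigma> i) * (x i - \<theta> i) > 0)) \<longrightarrow>
    (\<forall>x\<in>unit_box. (\<forall>i<5. u x i = 0) \<longrightarrow> u x 5 \<le> 0 \<longrightarrow> (\<forall>i<5. x i = \<theta> i)) \<longrightarrow>
    (\<forall>\<^sub>F N in sequentially. cell_count 5 N u = s * (\<Prod>i<5. \<sigma> i))"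
    using cell_count_eventually_unique[of 5] by blast
  have five: "i < 5 \<longleftrightarrow> i = 0 \<or> i = 1 \<or> i = 2 \<or> i = 3 \<or> i = 4" for i :: nat by auto
  have cont: "continuous_on unit_box (\<lambda>x. ?u j x i)" if "j \<in> cubes" for j i
    using continuous_map_compose[OF continuous_map_cube[OF that] continuous_map_detector[OF assms]]
    by (simp add: o_def)
  have coeff: "coefficient j = -1" if "j \<in> hit_cubes" for j
    using that by (auto simp: hit_cubes_def coefficient_def weight_def hit_letters_def hit_signs_def pair_sign_def letter_sign_def)
  have count: "\<forall>\<^sub>F N in sequentially. coefficient j * cell_count 5 N (?u j) = (if j \<in> hit_cubes then s else 0)"
    if j: "j \<in> cubes" for j
  proof (cases "j \<in> hit_cubes")
    case True
    have near: "\<forall>x\<in>unit_box. (\<forall>i<5. \<bar>x i - hit_point i\<bar> \<le> 1/1000) \<longrightarrow>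
      ?u j x 5 \<le> 0 \<and> (\<forall>i<5. ?u j x i > 0 \<longleftrightarrow> real_of_int (\<sigma> i) * (x i - hit_point i) > 0)"
    proof (intro ballI impI)
      fix x assume x: "x \<in> unit_box" and near: "\<forall>i<5. \<bar>x i - hit_point i\<bar> \<le> 1/1000"
      note R = detector_near_hit[OF assms True x near]
      have "\<bar>x 0 - 19/20\<bar> \<le> 1/1000" using near[rule_format, of 0] by (simp add: hit_point_def)
      then have "x 0 > 0" by linarith
      then have "- (x 0 / 2) * (x 2 - 1/95) > 0 \<longleftrightarrow> - (x 2 - 1/95) > 0"
        by (simp add: zero_less_mult_iff mult_less_0_iff)
      note sign = this
      show "?u j x 5 \<le> 0 \<and> (\<forall>i<5. ?u j x i > 0 \<longleftrightarrow> real_of_int (\<sigma> i) * (x i - hit_point i) > 0)"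
      proof (intro conjI allI impI)
        show "?u j x 5 \<le> 0" unfolding R(6) by simp
        fix i :: nat assume "i < 5"
        then consider "i = 0" | "i = 1" | "i = 2" | "i = 3" | "i = 4" unfolding five by blast
        then show "?u j x i > 0 \<longleftrightarrow> real_of_int (\<sigma> i) * (x i - hit_point i) > 0"
          by cases (simp_all only: R sign, simp_all add: \<sigma>_def hit_point_def)
      qed
    qed
    have only: "\<forall>x\<in>unit_box. (\<forall>i<5. ?u j x i = 0) \<longrightarrow> ?u j x 5 \<le> 0 \<longrightarrow> (\<forall>i<5. x i = hit_point i)"
      using cube_hit[OF assms, of "fst j" "snd j"] j coeff[OF True] by simp
    have range: "\<forall>i<5. 0 < hit_point i \<and> hit_point i < 1 \<and> \<sigma> i \<in> {1, -1}"
      by (auto simp: hit_point_def \<sigma>_def)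
    have "\<forall>\<^sub>F N in sequentially. cell_count 5 N (?u j) = s * (\<Prod>i<5. \<sigma> i)"
      by (rule unique[THEN spec[of _ "?u j"], THEN spec[of _ hit_point], THEN spec[of _ \<sigma>],
          THEN spec[of _ "1/1000"], THEN mp, THEN mp, THEN mp, THEN mp, THEN mp, OF _ range _ near only])
        (use cont[OF j] in auto)
    moreover have "(\<Prod>i<5. \<sigma> i) = -1" by (simp add: \<sigma>_def eval_nat_numeral)
    ultimately have "\<forall>\<^sub>F N in sequentially. cell_count 5 N (?u j) = - s" by simp
    then show ?thesis by eventually_elim (simp add: True coeff[OF True])
  next
    case miss: False
    show ?thesis
    proof (cases "coefficient j = 0")
      case False
      have "\<forall>\<^sub>F N in sequentially. cell_count 5 N (?u j) = 0"
      proof (rule cell_count_eventually_zero[OF cont[OF j]])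
        show False if "x \<in> unit_box" "\<forall>i<5. ?u j x i = 0" "?u j x 5 \<le> 0" for x
          using cube_hit[OF assms, of "fst j" "snd j" x] j False miss that by simp
      qed
      then show ?thesis by eventually_elim (simp add: miss)
    qed (simp add: miss)
  qed
  have "\<forall>\<^sub>F N in sequentially. \<forall>j\<in>cubes. coefficient j * cell_count 5 N (?u j) = (if j \<in> hit_cubes then s else 0)"
    by (rule eventually_ball_finite[OF finite_cubes]) (use count in blast)
  ultimately have "\<forall>\<^sub>F N in sequentially. (\<Sum>j\<in>cubes. if j \<in> hit_cubes then s else 0) = (0::int)"
    by eventually_elim simp
  then have "(\<Sum>j\<in>cubes. if j \<in> hit_cubes then s else 0) = 0" by simp
  moreover have "(\<Sum>j\<in>cubes. if j \<in> hit_cubes then s else 0) = (\<Sum>j\<in>hit_cubes. s)"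
    using hit_cubes_mem by (simp add: sum.If_cases[OF finite_cubes] Int_absorb1)
  moreover have "(hit_letters, hit_signs 1) \<noteq> (hit_letters, hit_signs (-1))"
    by (auto simp: hit_signs_def dest: fun_cong[of _ _ 4])
  ultimately show False using s by (simp add: hit_cubes_def)
qed

end
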